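(* Let $n\ge 3$ and let $K$ be a strong Gelfand subgroup of $B_n$. If $\gamma_K=A_n$, then $K$ is one of the following subgroups: 1. $F\wr A_n$; 2. the Stembridge subgroup of $B_n$, that is, $J_n=\ker\varepsilon\cap\ker\delta$, where $\varepsilon$ and $\delta$ are two inequivalent nontrivial linear characters of $B_n$, and where $n\not\equiv 2 \bmod 4$ for $n\ge 4$; 3. $\mathrm{diag}(F)\times A_3$ or $A_3$, if $n=3$.
   Context: All representations are finite-dimensional over $\mathbb{C}$. For a subgroup $K\leqslant G$ of a finite group, $K$ is a strong Gelfand subgroup of $G$ if $\mathrm{ind}_K^G V$ is multiplicity-free for every irreducible representation $V$ of $K$. Let $F=\mathbb{Z}/2=\{0,1\}$ and $B_n=F\wr S_n=F^n\rtimes S_n$, where $S_n$ permutes the coordinates of $F^n$. For $K\leqslant B_n$, $\gamma_K$ is the image of $K$ under the projection $B_n\to S_n$, $(f,\sigma)\mapsto\sigma$. The linear characters $\varepsilon,\delta:B_n\to\mathbb{C}^*$ are $\varepsilon(f,\sigma)=\mathrm{sgn}(\sigma)$ and $\delta(f,\sigma)=(-1)^{\#f}$, where $\#f$ is the number of $1$'s in $f$; they generate the group of linear characters of $B_n$, which is isomorphic to $\mathbb{Z}/2\times\mathbb{Z}/2$. $F\wr A_n=F^n\rtimes A_n=\ker\varepsilon$. In item 3, $A_3$ denotes $\{(0,\sigma):\sigma\in A_3\}$ and $\mathrm{diag}(F)\times A_3=\{(f,\sigma): f\in\{(0,0,0),(1,1,1)\},\ \sigma\in A_3\}$.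
   Formalization: In item 3 (n=3), K is shown to be a B_3-conjugate of diag(F)×A_3 or of A_3, not literally equal to one of them; the literal claim fails, e.g. for the conjugate of A_3 by ((1,0,0),id), which is strong Gelfand with γ_K=A_3. *)

theory Defs
  imports
    "HOL-Algebra.Sym_Groups"
    "HOL-Library.Z2"
    "HOL-Library.Function_Algebras"
    Complex_Main
begin

section \<open>Complex representations on spaces of functions\<close>

text \<open>
  Representation spaces are finite-dimensional complex subspaces of a function space
  \<open>'i \<Rightarrow> complex\<close> with the pointwise operations. As soon as \<open>'i\<close> is infinite,
  every finite-dimensional complex representation is isomorphic to one of this form.
  The maps involved are linear on the representation space only; their values elsewhere are
  irrelevant.
\<close>

definition fscale :: "complex \<Rightarrow> ('i \<Rightarrow> complex) \<Rightarrow> 'i \<Rightarrow> complex"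
  where "fscale c v = (\<lambda>i. c * v i)"

interpretation fvs: vector_space "fscale :: complex \<Rightarrow> ('i \<Rightarrow> complex) \<Rightarrow> 'i \<Rightarrow> complex"
  by unfold_locales (auto simp: fscale_def fun_eq_iff algebra_simps)

definition linear_on_space ::
    "('i \<Rightarrow> complex) set \<Rightarrow> (('i \<Rightarrow> complex) \<Rightarrow> 'j \<Rightarrow> complex) \<Rightarrow> bool"
  where "linear_on_space V T \<longleftrightarrow>
    (\<forall>u\<in>V. \<forall>v\<in>V. T (u + v) = T u + T v) \<and> (\<forall>c. \<forall>v\<in>V. T (fscale c v) = fscale c (T v))"

definition representation ::
    "('g, 'm) monoid_scheme \<Rightarrow> ('i \<Rightarrow> complex) set \<Rightarrow> ('g \<Rightarrow> ('i \<Rightarrow> complex) \<Rightarrow> 'i \<Rightarrow> complex) \<Rightarrow> bool"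
  where "representation G V \<rho> \<longleftrightarrow>
    (\<exists>B. finite B \<and> V = fvs.span B) \<and>
    (\<forall>g\<in>carrier G. \<rho> g ` V \<subseteq> V \<and> linear_on_space V (\<rho> g)) \<and>
    (\<forall>v\<in>V. \<rho> \<one>\<^bsub>G\<^esub> v = v) \<and>
    (\<forall>g\<in>carrier G. \<forall>h\<in>carrier G. \<forall>v\<in>V. \<rho> (g \<otimes>\<^bsub>G\<^esub> h) v = \<rho> g (\<rho> h v))"

definition subrepresentation ::
    "('g, 'm) monoid_scheme \<Rightarrow> ('i \<Rightarrow> complex) set \<Rightarrow> ('i \<Rightarrow> complex) set
      \<Rightarrow> ('g \<Rightarrow> ('i \<Rightarrow> complex) \<Rightarrow> 'i \<Rightarrow> complex) \<Rightarrow> bool"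
  where "subrepresentation G W V \<rho> \<longleftrightarrow>
    fvs.subspace W \<and> W \<subseteq> V \<and> (\<forall>g\<in>carrier G. \<rho> g ` W \<subseteq> W)"

definition irreducible_rep ::
    "('g, 'm) monoid_scheme \<Rightarrow> ('i \<Rightarrow> complex) set \<Rightarrow> ('g \<Rightarrow> ('i \<Rightarrow> complex) \<Rightarrow> 'i \<Rightarrow> complex) \<Rightarrow> bool"
  where "irreducible_rep G V \<rho> \<longleftrightarrow>
    representation G V \<rho> \<and> V \<noteq> {0} \<and>
    (\<forall>W. subrepresentation G W V \<rho> \<longrightarrow> W = {0} \<or> W = V)"

definition isomorphic_reps ::
    "('g, 'm) monoid_scheme \<Rightarrow> ('i \<Rightarrow> complex) set \<Rightarrow> ('g \<Rightarrow> ('i \<Rightarrow> complex) \<Rightarrow> 'i \<Rightarrow> complex)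
      \<Rightarrow> ('j \<Rightarrow> complex) set \<Rightarrow> ('g \<Rightarrow> ('j \<Rightarrow> complex) \<Rightarrow> 'j \<Rightarrow> complex) \<Rightarrow> bool"
  where "isomorphic_reps G V \<rho> W \<sigma> \<longleftrightarrow>
    (\<exists>T. linear_on_space V T \<and> bij_betw T V W \<and>
      (\<forall>g\<in>carrier G. \<forall>v\<in>V. T (\<rho> g v) = \<sigma> g (T v)))"

definition internal_direct_sum :: "('i \<Rightarrow> complex) set \<Rightarrow> ('i \<Rightarrow> complex) set set \<Rightarrow> bool"
  where "internal_direct_sum V \<W> \<longleftrightarrow>
    finite \<W> \<and> (\<forall>W\<in>\<W>. fvs.subspace W \<and> W \<subseteq> V) \<and>
    (\<forall>v\<in>V. \<exists>!u. u \<in> (\<Pi>\<^sub>E W\<in>\<W>. W) \<and> v = (\<Sum>W\<in>\<W>. u W))"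

definition multiplicity_free ::
    "('g, 'm) monoid_scheme \<Rightarrow> ('i \<Rightarrow> complex) set \<Rightarrow> ('g \<Rightarrow> ('i \<Rightarrow> complex) \<Rightarrow> 'i \<Rightarrow> complex) \<Rightarrow> bool"
  where "multiplicity_free G V \<rho> \<longleftrightarrow>
    (\<exists>\<W>. internal_direct_sum V \<W> \<and> (\<forall>W\<in>\<W>. irreducible_rep G W \<rho>) \<and>
      (\<forall>W\<in>\<W>. \<forall>W'\<in>\<W>. W \<noteq> W' \<longrightarrow> \<not> isomorphic_reps G W \<rho> W' \<rho>))"

text \<open>
  The induced representation consists of the functions \<open>\<phi>\<close> from \<open>G\<close> to \<open>V\<close> with
  \<open>\<phi> (k g) = \<rho> k (\<phi> g)\<close> for \<open>k\<close> in \<open>K\<close>, on which \<open>G\<close> acts by right translation. The functions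
  are uncurried, so that they again lie in a space of complex-valued functions, and they vanish
  outside the carrier of \<open>G\<close>.
\<close>

definition ind_space ::
    "('g, 'm) monoid_scheme \<Rightarrow> 'g set \<Rightarrow> ('i \<Rightarrow> complex) set
      \<Rightarrow> ('g \<Rightarrow> ('i \<Rightarrow> complex) \<Rightarrow> 'i \<Rightarrow> complex) \<Rightarrow> ('g \<times> 'i \<Rightarrow> complex) set"
  where "ind_space G K V \<rho> = {\<phi>.
    (\<forall>g\<in>carrier G. curry \<phi> g \<in> V) \<and> (\<forall>g. g \<notin> carrier G \<longrightarrow> curry \<phi> g = 0) \<and>
    (\<forall>k\<in>K. \<forall>g\<in>carrier G. curry \<phi> (k \<otimes>\<^bsub>G\<^esub> g) = \<rho> k (curry \<phi> g))}"

definition ind_action ::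
    "('g, 'm) monoid_scheme \<Rightarrow> 'g \<Rightarrow> ('g \<times> 'i \<Rightarrow> complex) \<Rightarrow> 'g \<times> 'i \<Rightarrow> complex"
  where "ind_action G x \<phi> = (\<lambda>(g, i). if g \<in> carrier G then \<phi> (g \<otimes>\<^bsub>G\<^esub> x, i) else 0)"

definition strong_gelfand_subgroup :: "'g set \<Rightarrow> ('g, 'm) monoid_scheme \<Rightarrow> bool"
  where "strong_gelfand_subgroup K G \<longleftrightarrow> subgroup K G \<and>
    (\<forall>(V :: (nat \<Rightarrow> complex) set) \<rho>. irreducible_rep (G\<lparr>carrier := K\<rparr>) V \<rho> \<longrightarrow>
      multiplicity_free G (ind_space G K V \<rho>) (ind_action G))"

lemma representation_ind:
  fixes G :: "('g, 'm) monoid_scheme" and V :: "('i \<Rightarrow> complex) set"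
  assumes "group G" "finite (carrier G)" "subgroup K G"
    and rep: "representation (G\<lparr>carrier := K\<rparr>) V \<rho>"
  shows "representation G (ind_space G K V \<rho>) (ind_action G)"
proof -
  interpret group G by fact
  interpret K: subgroup K G by fact
  obtain B where B: "finite B" "V = fvs.span B"
    using rep by (auto simp: representation_def)
  have V: "fvs.subspace V" using B by simp
  have lin: "\<And>k. k \<in> K \<Longrightarrow> linear_on_space V (\<rho> k)"
    using rep by (auto simp: representation_def)
  let ?I = "ind_space G K V \<rho>"
  have c0: "curry 0 = (0 :: 'g \<Rightarrow> 'i \<Rightarrow> complex)"
    and cadd: "\<And>\<phi> \<psi> :: 'g \<times> 'i \<Rightarrow> complex. \<And>g. curry (\<phi> + \<psi>) g = curry \<phi> g + curry \<psi> g"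
    and cscale: "\<And>c (\<phi> :: 'g \<times> 'i \<Rightarrow> complex) g. curry (fscale c \<phi>) g = fscale c (curry \<phi> g)"
    by (auto simp: curry_def fun_eq_iff fscale_def)
  have rho0: "\<rho> k 0 = 0" if "k \<in> K" for k
  proof -
    have "\<rho> k (fscale 0 0) = fscale 0 (\<rho> k 0)"
      using lin[OF that] V unfolding linear_on_space_def by (blast intro: fvs.subspace_0)
    thus ?thesis by (simp add: fscale_def zero_fun_def)
  qed
  have sub: "fvs.subspace ?I"
  proof (rule fvs.subspaceI)
    show "0 \<in> ?I" using V rho0 by (auto simp: ind_space_def c0 fvs.subspace_0)
  next
    fix \<phi> \<psi> assume "\<phi> \<in> ?I" "\<psi> \<in> ?I"
    thus "\<phi> + \<psi> \<in> ?I"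
      using V lin by (auto simp: ind_space_def cadd fvs.subspace_add linear_on_space_def)
  next
    fix c \<phi> assume "\<phi> \<in> ?I"
    thus "fscale c \<phi> \<in> ?I"
      using V lin by (auto simp: ind_space_def cscale fvs.subspace_scale linear_on_space_def)
  qed
  define E where "E = (\<lambda>(h :: 'g) (b :: 'i \<Rightarrow> complex) (g, i). if g = h then b i else 0)"
  define C where "C = (\<lambda>(h, b). E h b) ` (carrier G \<times> B)"
  have finC: "finite C" using B assms(2) by (simp add: C_def)
  have E_span: "E h v \<in> fvs.span C" if h: "h \<in> carrier G" and v: "v \<in> V" for h v
  proof -
    have "v \<in> fvs.span B" using v B by simp
    thus ?thesis
    proof (induction rule: fvs.span_induct_alt)
      case base
      have "E h 0 = 0" by (auto simp: E_def fun_eq_iff)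
      thus ?case by (metis fvs.span_zero)
    next
      case (step c x y)
      have "E h (fscale c x + y) = fscale c (E h x) + E h y"
        by (auto simp: E_def fun_eq_iff fscale_def)
      moreover have "E h x \<in> fvs.span C"
        using step h by (auto simp: C_def intro!: fvs.span_base)
      ultimately show ?case using step(2) fvs.span_add fvs.span_scale by metis
    qed
  qed
  have I_span: "?I \<subseteq> fvs.span C"
  proof
    fix \<phi> assume phi: "\<phi> \<in> ?I"
    have sum_apply: "(\<Sum>h\<in>A. f h) x = (\<Sum>h\<in>A. f h x)" if "finite A"
      for A :: "'g set" and f :: "'g \<Rightarrow> 'g \<times> 'i \<Rightarrow> complex" and x
      using that by (induction A rule: finite_induct) auto
    have "\<phi> = (\<Sum>h\<in>carrier G. E h (curry \<phi> h))"
    proof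
      fix x :: "'g \<times> 'i"
      obtain g i where x: "x = (g, i)" by force
      have "curry \<phi> g i = 0" if "g \<notin> carrier G" using phi that by (auto simp: ind_space_def)
      thus "\<phi> x = (\<Sum>h\<in>carrier G. E h (curry \<phi> h)) x"
        using assms(2) by (auto simp: x sum_apply E_def)
    qed
    also have "\<dots> \<in> fvs.span C"
      using phi by (intro fvs.span_sum E_span) (auto simp: ind_space_def)
    finally show "\<phi> \<in> fvs.span C" .
  qed
  obtain D where D: "D \<subseteq> ?I" "\<not> fvs.dependent D" "?I \<subseteq> fvs.span D"
    using fvs.maximal_independent_subset by blast
  have "finite D" using fvs.independent_span_bound[OF finC D(2)] D(1) I_span by blast
  moreover have "?I = fvs.span D"
    using D(1,3) sub by (meson fvs.span_minimal subset_antisym)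
  moreover have "ind_action G x \<phi> \<in> ?I" if x: "x \<in> carrier G" and phi: "\<phi> \<in> ?I" for x \<phi>
  proof -
    have cin: "curry (ind_action G x \<phi>) g = (if g \<in> carrier G then curry \<phi> (g \<otimes>\<^bsub>G\<^esub> x) else 0)" for g
      by (auto simp: ind_action_def curry_def fun_eq_iff)
    show ?thesis using phi x K.subset
      by (auto simp: ind_space_def cin m_assoc subset_eq)
  qed
  moreover have "linear_on_space ?I (ind_action G x)" for x
    by (auto simp: linear_on_space_def ind_action_def fun_eq_iff fscale_def)
  moreover have "ind_action G \<one>\<^bsub>G\<^esub> \<phi> = \<phi>" if "\<phi> \<in> ?I" for \<phi>
  proof
    fix x :: "'g \<times> 'i"
    obtain g i where x: "x = (g, i)" by force
    have "curry \<phi> g i = 0" if "g \<notin> carrier G" using \<open>\<phi> \<in> ?I\<close> that by (auto simp: ind_space_def)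
    thus "ind_action G \<one>\<^bsub>G\<^esub> \<phi> x = \<phi> x" by (auto simp: ind_action_def x)
  qed
  moreover have "ind_action G (x \<otimes>\<^bsub>G\<^esub> y) \<phi> = ind_action G x (ind_action G y \<phi>)"
    if "x \<in> carrier G" "y \<in> carrier G" for x y \<phi>
    using that by (auto simp: ind_action_def fun_eq_iff m_assoc)
  ultimately show ?thesis unfolding representation_def by blast
qed


section \<open>The hyperoctahedral group\<close>

text \<open>
  \<open>F\<^sup>n\<close> is the set of functions \<open>nat \<Rightarrow> bit\<close> that vanish outside \<open>{1..n}\<close>, and a
  permutation \<open>\<sigma>\<close> acts on it by \<open>(\<sigma> \<cdot> f) i = f (\<sigma>\<inverse> i)\<close>.
\<close>

definition F_pow :: "nat \<Rightarrow> (nat \<Rightarrow> bit) set"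
  where "F_pow n = {f. \<forall>i. i \<notin> {1..n} \<longrightarrow> f i = 0}"

definition hyperoctahedral :: "nat \<Rightarrow> ((nat \<Rightarrow> bit) \<times> (nat \<Rightarrow> nat)) monoid"
  where "hyperoctahedral n =
    \<lparr> carrier = F_pow n \<times> carrier (sym_group n),
      mult = (\<lambda>(f, \<sigma>) (g, \<tau>). (f + (g \<circ> inv' \<sigma>), \<sigma> \<otimes>\<^bsub>sym_group n\<^esub> \<tau>)),
      one = (0, \<one>\<^bsub>sym_group n\<^esub>) \<rparr>"

lemma group_hyperoctahedral: "group (hyperoctahedral n)"
proof (rule groupI)
  fix x y assume "x \<in> carrier (hyperoctahedral n)" "y \<in> carrier (hyperoctahedral n)"
  thus "x \<otimes>\<^bsub>hyperoctahedral n\<^esub> y \<in> carrier (hyperoctahedral n)"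
    by (auto simp: hyperoctahedral_def F_pow_def sym_group_def permutes_compose
        permutes_not_in[OF permutes_inv] simp del: atLeastAtMost_iff)
next
  fix x y z
  assume "x \<in> carrier (hyperoctahedral n)" "y \<in> carrier (hyperoctahedral n)"
    "z \<in> carrier (hyperoctahedral n)"
  thus "x \<otimes>\<^bsub>hyperoctahedral n\<^esub> y \<otimes>\<^bsub>hyperoctahedral n\<^esub> z =
      x \<otimes>\<^bsub>hyperoctahedral n\<^esub> (y \<otimes>\<^bsub>hyperoctahedral n\<^esub> z)"
    by (auto simp: hyperoctahedral_def sym_group_def fun_eq_iff o_inv_distrib permutes_bij
        add.assoc)
next
  fix x assume x: "x \<in> carrier (hyperoctahedral n)"
  obtain f \<sigma> where fs: "x = (f, \<sigma>)" by force
  have s: "\<sigma> permutes {1..n}" and f: "f \<in> F_pow n"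
    using x by (auto simp: fs hyperoctahedral_def sym_group_def)
  have "(f \<circ> \<sigma>, inv' \<sigma>) \<in> carrier (hyperoctahedral n)"
    using s f by (auto simp: hyperoctahedral_def sym_group_def F_pow_def permutes_inv
        permutes_not_in[OF s] simp del: atLeastAtMost_iff)
  moreover have "(f \<circ> \<sigma>, inv' \<sigma>) \<otimes>\<^bsub>hyperoctahedral n\<^esub> x = \<one>\<^bsub>hyperoctahedral n\<^esub>"
    using s by (auto simp: fs hyperoctahedral_def sym_group_def fun_eq_iff permutes_inv_inv
        permutes_inverses)
  ultimately show "\<exists>y\<in>carrier (hyperoctahedral n).
      y \<otimes>\<^bsub>hyperoctahedral n\<^esub> x = \<one>\<^bsub>hyperoctahedral n\<^esub>" by blast
qed (auto simp: hyperoctahedral_def F_pow_def sym_group_def permutes_id fun_eq_iff)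

definition complex_units :: "complex monoid"
  where "complex_units = \<lparr> carrier = UNIV - {0}, mult = (*), one = 1 \<rparr>"

definition eps_char :: "(nat \<Rightarrow> bit) \<times> (nat \<Rightarrow> nat) \<Rightarrow> complex"
  where "eps_char = (\<lambda>(f, \<sigma>). of_int (sign \<sigma>))"

definition delta_char :: "(nat \<Rightarrow> bit) \<times> (nat \<Rightarrow> nat) \<Rightarrow> complex"
  where "delta_char = (\<lambda>(f, \<sigma>). (-1) ^ card {i. f i = 1})"

definition stembridge_subgroup :: "nat \<Rightarrow> ((nat \<Rightarrow> bit) \<times> (nat \<Rightarrow> nat)) set"
  where "stembridge_subgroup n =
    kernel (hyperoctahedral n) complex_units eps_char \<inter>
    kernel (hyperoctahedral n) complex_units delta_char"

definition wreath_alt :: "nat \<Rightarrow> ((nat \<Rightarrow> bit) \<times> (nat \<Rightarrow> nat)) set"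
  where "wreath_alt n = F_pow n \<times> carrier (alt_group n)"

definition alt_copy :: "nat \<Rightarrow> ((nat \<Rightarrow> bit) \<times> (nat \<Rightarrow> nat)) set"
  where "alt_copy n = {0} \<times> carrier (alt_group n)"

definition diag_F :: "nat \<Rightarrow> (nat \<Rightarrow> bit) set"
  where "diag_F n = {f \<in> F_pow n. \<forall>i\<in>{1..n}. \<forall>j\<in>{1..n}. f i = f j}"

definition diag_alt :: "nat \<Rightarrow> ((nat \<Rightarrow> bit) \<times> (nat \<Rightarrow> nat)) set"
  where "diag_alt n = diag_F n \<times> carrier (alt_group n)"

definition conjugate_in :: "('g, 'm) monoid_scheme \<Rightarrow> 'g set \<Rightarrow> 'g set \<Rightarrow> bool"
  where "conjugate_in G H K \<longleftrightarrow>
    (\<exists>x\<in>carrier G. K = (\<lambda>h. x \<otimes>\<^bsub>G\<^esub> h \<otimes>\<^bsub>G\<^esub> inv\<^bsub>G\<^esub> x) ` H)"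

end

theory Submission
  imports Defs "HOL-Computational_Algebra.Fundamental_Theorem_Algebra"
begin

text \<open>
  If \<open>K\<close> is a strong Gelfand subgroup of \<open>G\<close>, then by Frobenius reciprocity every irreducible
  representation of \<open>G\<close> is multiplicity-free on \<open>K\<close>, so by Schur's lemma the sums of the
  \<open>K\<close>-conjugates of two elements of \<open>G\<close> act by commuting operators; hence they commute in the group
  algebra. In the hyperoctahedral group one weights this identity with a character
  \<open>chi S\<close> of \<open>F\<^sup>n\<close>, which restricts the conjugators to the stabiliser of \<open>S\<close>.

  The sign changes in \<open>K\<close> form a submodule of \<open>F\<^sup>n\<close> under the alternating group: either all are
  constant, or all even ones occur. In the second case \<open>K\<close> is \<open>F wr A\<^sub>n\<close> or the Stembridge subgroup. In
  the first case, for \<open>n \<ge> 4\<close>, the weighted identity says that any even \<open>\<sigma>\<close>, \<open>\<tau>\<close> satisfy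
  \<open>\<sigma> \<tau> = \<tau>' \<sigma>'\<close> with conjugates by even permutations preserving \<open>S\<close>, which fails for suitable
  \<open>S\<close>, \<open>\<sigma>\<close>, \<open>\<tau>\<close>. For the Stembridge subgroup with \<open>n = 2 m\<close>, \<open>m\<close> odd, take \<open>S = {1..m}\<close>, the element \<open>u\<close>
  acting as an \<open>m\<close>-cycle on \<open>S\<close> and as its inverse on the complement, and the swap \<open>s\<close> of the two
  blocks: one order of multiplication has solutions, the other would require an even
  permutation that exchanges the blocks and conjugates \<open>u\<close> to an element inverted by \<open>s\<close>.
\<close>

section \<open>Intertwining operators\<close>

text \<open>The weighted identity is a relation between sums of signs, and cancellation is the
  obstacle. Each application therefore shows that in one order all admissible pairs of conjugators
  carry the same nonzero weight; then a single admissible pair in that order forces one in the other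
  order. This dictates \<open>S\<close>. With constant sign changes, \<open>card S\<close> is even,
  so that \<open>chi S\<close> does not see the choice of lifts to \<open>K\<close>. For the
  Stembridge subgroup, \<open>S\<close> is half of the points: on vectors of even parity,
  \<open>chi S\<close> agrees with the character of the complement, which absorbs the exchange of
  the blocks by \<open>s\<close>. Both \<open>\<sigma>\<close> and \<open>\<tau>\<close> must move
  \<open>S\<close>: if \<open>\<sigma>\<close> preserved it, conjugating by the identity and by
  \<open>\<sigma>\<close> would give a factorisation, and if \<open>\<tau>\<close> did, the inverse
  of \<open>\<tau>\<close> and the identity would. The uniform pair lives on seven points, so 4, 5
  and 6 get their own pairs. For \<open>n = 3\<close> the even permutations commute and trivial
  conjugators always work, which leaves room for the exceptional subgroups. Oddness of
  \<open>m\<close> enters three times: it makes \<open>s\<close> odd, the \<open>m\<close>-cycle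
  even, and the inverse of \<open>u\<close> a square of a power of \<open>u\<close>.\<close>

definition intertwines ::
    "('g, 'm) monoid_scheme \<Rightarrow> ('i \<Rightarrow> complex) set \<Rightarrow> ('g \<Rightarrow> ('i \<Rightarrow> complex) \<Rightarrow> 'i \<Rightarrow> complex)
      \<Rightarrow> ('j \<Rightarrow> complex) set \<Rightarrow> ('g \<Rightarrow> ('j \<Rightarrow> complex) \<Rightarrow> 'j \<Rightarrow> complex)
      \<Rightarrow> (('i \<Rightarrow> complex) \<Rightarrow> 'j \<Rightarrow> complex) \<Rightarrow> bool"
  where "intertwines G V \<rho> W \<sigma> T \<longleftrightarrow>
    linear_on_space V T \<and> T ` V \<subseteq> W \<and> (\<forall>g\<in>carrier G. \<forall>v\<in>V. T (\<rho> g v) = \<sigma> g (T v))"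

section \<open>Linear maps on a representation space, kernels and images\<close>

lemma linear_on_space_0:
  assumes "linear_on_space V T" "fvs.subspace V"
  shows "T 0 = 0"
proof -
  have "T (fscale 0 0) = fscale 0 (T 0)"
    using assms unfolding linear_on_space_def by (blast intro: fvs.subspace_0)
  thus ?thesis by (simp add: fscale_def zero_fun_def)
qed

lemma linear_on_space_add:
  "linear_on_space V T \<Longrightarrow> u \<in> V \<Longrightarrow> v \<in> V \<Longrightarrow> T (u + v) = T u + T v"
  by (simp add: linear_on_space_def)

lemma linear_on_space_scale:
  "linear_on_space V T \<Longrightarrow> v \<in> V \<Longrightarrow> T (fscale c v) = fscale c (T v)"
  by (simp add: linear_on_space_def)

lemma linear_on_space_uminus:
  assumes "linear_on_space V T" "v \<in> V"
  shows "T (- v) = - T v"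
  using linear_on_space_scale[OF assms, of "- 1"] fvs.scale_minus_left[of 1]
  by (metis fvs.scale_one)

lemma linear_on_space_diff:
  assumes "linear_on_space V T" "fvs.subspace V" "u \<in> V" "v \<in> V"
  shows "T (u - v) = T u - T v"
  using assms linear_on_space_add[of V T u "- v"] linear_on_space_uminus[of V T v]
    fvs.subspace_neg[of V v] by simp

lemma linear_on_space_sum:
  assumes "linear_on_space V T" "fvs.subspace V" "\<And>a. a \<in> A \<Longrightarrow> f a \<in> V"
  shows "T (\<Sum>a\<in>A. f a) = (\<Sum>a\<in>A. T (f a))"
  using assms(3)
proof (induction A rule: infinite_finite_induct)
  case (insert x A)
  hence "(\<Sum>a\<in>A. f a) \<in> V" using fvs.subspace_sum[OF assms(2)] by blast
  hence "T (f x + (\<Sum>a\<in>A. f a)) = T (f x) + T (\<Sum>a\<in>A. f a)"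
    using insert.prems by (intro linear_on_space_add[OF assms(1)]) auto
  with insert show ?case by (simp only: sum.insert insert_iff simp_thms)
qed (auto simp: linear_on_space_0[OF assms(1,2)])

lemma linear_on_space_subset: "linear_on_space V T \<Longrightarrow> W \<subseteq> V \<Longrightarrow> linear_on_space W T"
  by (auto simp: linear_on_space_def subset_eq)

lemma linear_on_space_diff_maps:
  "linear_on_space V S \<Longrightarrow> linear_on_space V T \<Longrightarrow> linear_on_space V (\<lambda>v. S v - T v)"
  by (simp add: linear_on_space_def fvs.scale_right_diff_distrib)

lemma linear_on_space_comp:
  "linear_on_space V S \<Longrightarrow> S ` V \<subseteq> W \<Longrightarrow> linear_on_space W T \<Longrightarrow> linear_on_space V (\<lambda>v. T (S v))"
  by (simp add: linear_on_space_def subset_eq)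

lemma representation_subspace: "representation G V \<rho> \<Longrightarrow> fvs.subspace V"
  by (auto simp: representation_def)

lemma representation_linear: "representation G V \<rho> \<Longrightarrow> g \<in> carrier G \<Longrightarrow> linear_on_space V (\<rho> g)"
  by (auto simp: representation_def)

lemma representation_closed: "representation G V \<rho> \<Longrightarrow> g \<in> carrier G \<Longrightarrow> v \<in> V \<Longrightarrow> \<rho> g v \<in> V"
  by (auto simp: representation_def)

lemma representation_one: "representation G V \<rho> \<Longrightarrow> v \<in> V \<Longrightarrow> \<rho> \<one>\<^bsub>G\<^esub> v = v"
  by (auto simp: representation_def)

lemma representation_mult:
  "representation G V \<rho> \<Longrightarrow> g \<in> carrier G \<Longrightarrow> h \<in> carrier G \<Longrightarrow> v \<in> V
    \<Longrightarrow> \<rho> (g \<otimes>\<^bsub>G\<^esub> h) v = \<rho> g (\<rho> h v)"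
  by (auto simp: representation_def)

text \<open>\<open>representation\<close> asks for a finite spanning set, so kernels and other
  invariant subspaces need one before they count as representations.\<close>

lemma subspace_of_span:
  assumes "finite B" "fvs.subspace W" "W \<subseteq> fvs.span B"
  shows "\<exists>C. finite C \<and> W = fvs.span C"
proof -
  obtain C where C: "C \<subseteq> W" "\<not> fvs.dependent C" "W \<subseteq> fvs.span C"
    using fvs.maximal_independent_subset by blast
  have "finite C" using fvs.independent_span_bound[OF assms(1) C(2)] C(1) assms(3) by blast
  moreover have "W = fvs.span C"
    using C(1,3) assms(2) by (meson fvs.span_minimal subset_antisym)
  ultimately show ?thesis by blast
qed

lemma subrepresentation_imp_representation:
  assumes "representation G V \<rho>" "subrepresentation G W V \<rho>"
  shows "representation G W \<rho>"
proof -
  have W: "W \<subseteq> V" "fvs.subspace W" using assms(2) by (auto simp: subrepresentation_def)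
  obtain B where "finite B" "V = fvs.span B" using assms(1) by (auto simp: representation_def)
  hence "\<exists>B. finite B \<and> W = fvs.span B" using subspace_of_span W by blast
  moreover have "linear_on_space W (\<rho> g)" if "g \<in> carrier G" for g
    using representation_linear[OF assms(1) that] W(1) by (rule linear_on_space_subset)
  moreover have "\<rho> g ` W \<subseteq> W" if "g \<in> carrier G" for g
    using assms(2) that by (simp add: subrepresentation_def)
  moreover have "\<rho> (g \<otimes>\<^bsub>G\<^esub> h) w = \<rho> g (\<rho> h w)"
    if "g \<in> carrier G" "h \<in> carrier G" "w \<in> W" for g h w
    using representation_mult[OF assms(1)] that W(1) by blast
  moreover have "\<rho> \<one>\<^bsub>G\<^esub> w = w" if "w \<in> W" for w
    using representation_one[OF assms(1)] that W(1) by blast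
  ultimately show ?thesis unfolding representation_def by blast
qed

lemma subrepresentation_trans:
  "subrepresentation G U W \<rho> \<Longrightarrow> subrepresentation G W V \<rho> \<Longrightarrow> subrepresentation G U V \<rho>"
  by (auto simp: subrepresentation_def)

lemma subrepresentation_kernel:
  assumes "representation G V \<rho>" "representation G W \<sigma>" "intertwines G V \<rho> W \<sigma> T"
  shows "subrepresentation G {v \<in> V. T v = 0} V \<rho>"
proof -
  have V: "fvs.subspace V" and W: "fvs.subspace W"
    using assms(1,2) by (auto intro: representation_subspace)
  have T: "linear_on_space V T" using assms(3) by (simp add: intertwines_def)
  have "fvs.subspace {v \<in> V. T v = 0}"
    by (rule fvs.subspaceI)
      (auto simp: linear_on_space_0[OF T V] linear_on_space_add[OF T] linear_on_space_scale[OF T]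
        V fvs.subspace_0 fvs.subspace_add fvs.subspace_scale)
  moreover have "T (\<rho> g v) = 0" if "g \<in> carrier G" "v \<in> V" "T v = 0" for g v
    using assms that linear_on_space_0[OF representation_linear[OF assms(2)] W]
    by (simp add: intertwines_def)
  ultimately show ?thesis
    using representation_closed[OF assms(1)] by (auto simp: subrepresentation_def)
qed

lemma subrepresentation_image:
  assumes "representation G V \<rho>" "representation G W \<sigma>" "intertwines G V \<rho> W \<sigma> T"
  shows "subrepresentation G (T ` V) W \<sigma>"
proof -
  have V: "fvs.subspace V" using assms(1) by (rule representation_subspace)
  have T: "linear_on_space V T" using assms(3) by (simp add: intertwines_def)
  have "fvs.subspace (T ` V)"
  proof (rule fvs.subspaceI)
    show "0 \<in> T ` V"
      using imageI[OF fvs.subspace_0[OF V], of T] linear_on_space_0[OF T V] by simp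
  next
    fix x y assume "x \<in> T ` V" "y \<in> T ` V"
    then obtain u v where "x = T u" "y = T v" "u \<in> V" "v \<in> V" by blast
    thus "x + y \<in> T ` V"
      using imageI[OF fvs.subspace_add[OF V, of u v], of T] linear_on_space_add[OF T, of u v] by simp
  next
    fix c x assume "x \<in> T ` V"
    then obtain u where "x = T u" "u \<in> V" by blast
    thus "fscale c x \<in> T ` V"
      using imageI[OF fvs.subspace_scale[OF V, of u c], of T] linear_on_space_scale[OF T, of u c]
      by simp
  qed
  moreover have "\<sigma> g (T v) \<in> T ` V" if "g \<in> carrier G" "v \<in> V" for g v
    using assms(3) that imageI[OF representation_closed[OF assms(1) that], of T]
    by (simp add: intertwines_def)
  ultimately show ?thesis using assms(3) by (auto simp: subrepresentation_def intertwines_def)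
qed

lemma intertwines_comp:
  assumes "intertwines G U \<rho> V \<sigma> S" "intertwines G V \<sigma> W \<tau> T"
  shows "intertwines G U \<rho> W \<tau> (\<lambda>u. T (S u))"
  using assms by (auto simp: intertwines_def subset_eq intro: linear_on_space_comp[of _ _ V])

subsection \<open>Complete reducibility\<close>

lemma linear_projection:
  assumes "fvs.subspace U"
  obtains p where "\<And>v. p v \<in> U" "\<And>u. u \<in> U \<Longrightarrow> p u = u" "linear_on_space UNIV p"
proof -
  interpret vector_space_pair "fscale :: complex \<Rightarrow> ('a \<Rightarrow> complex) \<Rightarrow> _"
    "fscale :: complex \<Rightarrow> ('a \<Rightarrow> complex) \<Rightarrow> _" ..
  have "Vector_Spaces.linear fscale fscale (\<lambda>v :: 'a \<Rightarrow> complex. v)" by (rule fvs.linear_ident)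
  from linear_exists_left_inverse_on[OF this assms inj_on_id2]
  obtain p where p: "range p \<subseteq> U" "Vector_Spaces.linear fscale fscale p" "\<forall>u\<in>U. p u = u" by blast
  interpret p: Vector_Spaces.linear fscale fscale p by fact
  show ?thesis
    using that[of p] p by (auto simp: linear_on_space_def p.add p.scale)
qed

text \<open>Maschke's theorem. A linear projection onto \<open>U\<close> need not commute with
  \<open>G\<close>; averaging its conjugates repairs this, and the average is still the identity on
  \<open>U\<close> because every conjugate is.\<close>

lemma invariant_projection:
  assumes "group G" "finite (carrier G)" "representation G V \<rho>" "subrepresentation G U V \<rho>"
  obtains P where "intertwines G V \<rho> U \<rho> P" "\<And>u. u \<in> U \<Longrightarrow> P u = u"
proof -
  interpret group G by fact
  note rep = assms(3)
  have U: "fvs.subspace U" "U \<subseteq> V" using assms(4) by (auto simp: subrepresentation_def)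
  have Urep: "representation G U \<rho>" using rep assms(4) by (rule subrepresentation_imp_representation)
  obtain p where p: "\<And>v. p v \<in> U" "\<And>u. u \<in> U \<Longrightarrow> p u = u" "linear_on_space UNIV p"
    using linear_projection[OF U(1)] by metis
  define c :: complex where "c = inverse (of_nat (card (carrier G)))"
  define P where "P = (\<lambda>v. fscale c (\<Sum>g\<in>carrier G. \<rho> g (p (\<rho> (inv\<^bsub>G\<^esub> g) v))))"
  have card0: "card (carrier G) \<noteq> 0" using assms(2) by auto
  have term_in: "\<rho> g (p (\<rho> (inv\<^bsub>G\<^esub> g) v)) \<in> U" if "g \<in> carrier G" for g v
    using representation_closed[OF Urep] p(1) that by blast
  have lin: "linear_on_space V (\<lambda>v. \<rho> g (p (\<rho> (inv\<^bsub>G\<^esub> g) v)))" if g: "g \<in> carrier G" for g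
  proof -
    have "linear_on_space V (\<lambda>v. p (\<rho> (inv\<^bsub>G\<^esub> g) v))"
      using linear_on_space_comp[OF representation_linear[OF rep inv_closed[OF g]] subset_UNIV p(3)] .
    thus ?thesis
      using linear_on_space_comp[of V "\<lambda>v. p (\<rho> (inv\<^bsub>G\<^esub> g) v)" U "\<rho> g"] p(1)
        representation_linear[OF Urep g] by auto
  qed
  have "linear_on_space V P"
    using lin by (auto simp: P_def linear_on_space_def fvs.scale_right_distrib sum.distrib
        fvs.scale_sum_right fvs.scale_left_commute intro!: sum.cong)
  moreover have "P v \<in> U" for v
    unfolding P_def by (intro fvs.subspace_scale fvs.subspace_sum U term_in)
  moreover have "P (\<rho> x v) = \<rho> x (P v)" if x: "x \<in> carrier G" and v: "v \<in> V" for x v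
  proof -
    \<comment> \<open>Left translation by \<open>x\<close> permutes \<open>G\<close>, which moves
      \<open>x\<close> from the argument to the outside of the sum.\<close>
    have "(\<Sum>g\<in>carrier G. \<rho> g (p (\<rho> (inv\<^bsub>G\<^esub> g) (\<rho> x v))))
        = (\<Sum>g\<in>carrier G. \<rho> (x \<otimes>\<^bsub>G\<^esub> g) (p (\<rho> (inv\<^bsub>G\<^esub> (x \<otimes>\<^bsub>G\<^esub> g)) (\<rho> x v))))"
      by (rule sum.reindex_bij_betw[symmetric])
        (use x in \<open>auto intro!: bij_betwI[where g = "\<lambda>g. inv\<^bsub>G\<^esub> x \<otimes>\<^bsub>G\<^esub> g"] simp: m_assoc[symmetric]\<close>)
    also have "\<dots> = (\<Sum>g\<in>carrier G. \<rho> x (\<rho> g (p (\<rho> (inv\<^bsub>G\<^esub> g) v))))"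
    proof (rule sum.cong[OF refl])
      fix g assume g: "g \<in> carrier G"
      have "\<rho> (inv\<^bsub>G\<^esub> (x \<otimes>\<^bsub>G\<^esub> g)) (\<rho> x v) = \<rho> (inv\<^bsub>G\<^esub> (x \<otimes>\<^bsub>G\<^esub> g) \<otimes>\<^bsub>G\<^esub> x) v"
        using g x v by (simp add: representation_mult[OF rep])
      also have "inv\<^bsub>G\<^esub> (x \<otimes>\<^bsub>G\<^esub> g) \<otimes>\<^bsub>G\<^esub> x = inv\<^bsub>G\<^esub> g"
        using g x by (simp add: inv_mult_group m_assoc)
      finally show "\<rho> (x \<otimes>\<^bsub>G\<^esub> g) (p (\<rho> (inv\<^bsub>G\<^esub> (x \<otimes>\<^bsub>G\<^esub> g)) (\<rho> x v)))
          = \<rho> x (\<rho> g (p (\<rho> (inv\<^bsub>G\<^esub> g) v)))"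
        using g x p(1) U(2) by (metis representation_mult[OF Urep])
    qed
    also have "\<dots> = \<rho> x (\<Sum>g\<in>carrier G. \<rho> g (p (\<rho> (inv\<^bsub>G\<^esub> g) v)))"
      using linear_on_space_sum[OF representation_linear[OF Urep x] U(1),
          where A = "carrier G" and f = "\<lambda>g. \<rho> g (p (\<rho> (inv\<^bsub>G\<^esub> g) v))"] term_in
      by simp
    finally have eq: "(\<Sum>g\<in>carrier G. \<rho> g (p (\<rho> (inv\<^bsub>G\<^esub> g) (\<rho> x v))))
        = \<rho> x (\<Sum>g\<in>carrier G. \<rho> g (p (\<rho> (inv\<^bsub>G\<^esub> g) v)))" .
    have "(\<Sum>g\<in>carrier G. \<rho> g (p (\<rho> (inv\<^bsub>G\<^esub> g) v))) \<in> U"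
      by (rule fvs.subspace_sum[OF U(1) term_in])
    from linear_on_space_scale[OF representation_linear[OF Urep x] this, of c]
    show ?thesis unfolding P_def eq by (rule sym)
  qed
  ultimately have "intertwines G V \<rho> U \<rho> P" by (auto simp: intertwines_def)
  moreover have "P u = u" if u: "u \<in> U" for u
  proof -
    have "\<rho> g (p (\<rho> (inv\<^bsub>G\<^esub> g) u)) = u" if g: "g \<in> carrier G" for g
    proof -
      have "\<rho> g (p (\<rho> (inv\<^bsub>G\<^esub> g) u)) = \<rho> g (\<rho> (inv\<^bsub>G\<^esub> g) u)"
        using p(2) representation_closed[OF Urep] g u by simp
      also have "\<dots> = u"
        using representation_mult[OF Urep] representation_one[OF Urep] g u
        by (metis inv_closed r_inv)
      finally show ?thesis .
    qed
    hence "(\<Sum>g\<in>carrier G. \<rho> g (p (\<rho> (inv\<^bsub>G\<^esub> g) u))) = (\<Sum>g\<in>carrier G. u)" by simp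
    also have "\<dots> = fscale (of_nat (card (carrier G))) u"
      by (simp add: fun_eq_iff fscale_def fvs.scale_sum_left[symmetric] sum_constant_scale)
    finally show ?thesis using card0 by (simp add: P_def c_def fscale_def fun_eq_iff)
  qed
  ultimately show ?thesis using that by blast
qed

text \<open>A nonzero vector can be detected in an irreducible quotient. Take \<open>M\<close>
  maximal among the subrepresentations avoiding \<open>w\<close>, and an invariant complement
  \<open>U\<close> of \<open>M\<close>. If \<open>U\<close> split into \<open>X\<close> and
  \<open>Y\<close>, then \<open>w\<close> would lie in both \<open>M + X\<close> and
  \<open>M + Y\<close> by maximality, hence in \<open>M\<close>.\<close>

lemma irreducible_quotient:
  assumes G: "group G" "finite (carrier G)" and rep: "representation G V \<rho>"
    and w: "w \<in> V" "w \<noteq> 0"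
  obtains U P where "subrepresentation G U V \<rho>" "irreducible_rep G U \<rho>"
    "intertwines G V \<rho> U \<rho> P" "P w \<noteq> 0"
proof -
  define \<A> where "\<A> = {M. subrepresentation G M V \<rho> \<and> w \<notin> M}"
  have V: "fvs.subspace V" using rep by (rule representation_subspace)
  have "{0} \<in> \<A>"
    using w V linear_on_space_0[OF representation_linear[OF rep] V]
    by (auto simp: \<A>_def subrepresentation_def fvs.subspace_0)
  moreover have "\<Union>\<C> \<in> \<A>" if C: "\<C> \<noteq> {}" "subset.chain \<A> \<C>" for \<C>
  proof -
    have sub: "fvs.subspace M" "M \<subseteq> V" "w \<notin> M" "\<And>g. g \<in> carrier G \<Longrightarrow> \<rho> g ` M \<subseteq> M" if "M \<in> \<C>" for M
      using C(2) that by (auto simp: subset.chain_def \<A>_def subrepresentation_def)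
    have "fvs.subspace (\<Union>\<C>)"
    proof (rule fvs.subspaceI)
      show "0 \<in> \<Union>\<C>" using C(1) sub(1) fvs.subspace_0 by blast
    next
      fix x y assume "x \<in> \<Union>\<C>" "y \<in> \<Union>\<C>"
      then obtain M N where MN: "M \<in> \<C>" "N \<in> \<C>" "x \<in> M" "y \<in> N" by blast
      hence "M \<subseteq> N \<or> N \<subseteq> M" using C(2) by (auto simp: subset.chain_def)
      thus "x + y \<in> \<Union>\<C>" using MN sub(1) fvs.subspace_add by blast
    next
      fix c x assume "x \<in> \<Union>\<C>"
      thus "fscale c x \<in> \<Union>\<C>" using sub(1) fvs.subspace_scale by blast
    qed
    moreover have "\<rho> g ` \<Union>\<C> \<subseteq> \<Union>\<C>" if "g \<in> carrier G" for g
      using sub(4)[OF _ that] by blast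
    ultimately show ?thesis
      using sub(2,3) unfolding \<A>_def subrepresentation_def by blast
  qed
  ultimately obtain M where M: "M \<in> \<A>" and max: "\<And>X. X \<in> \<A> \<Longrightarrow> M \<subseteq> X \<Longrightarrow> X = M"
    using subset_Zorn_nonempty[of \<A>] by blast
  have Msub: "subrepresentation G M V \<rho>" and wM: "w \<notin> M" using M by (auto simp: \<A>_def)
  have Ms: "fvs.subspace M" "M \<subseteq> V" using Msub by (auto simp: subrepresentation_def)
  have Mrep: "representation G M \<rho>" using rep Msub by (rule subrepresentation_imp_representation)
  obtain P0 where P0: "intertwines G V \<rho> M \<rho> P0" "\<And>u. u \<in> M \<Longrightarrow> P0 u = u"
    using invariant_projection[OF G rep Msub] by blast
  define U where "U = {v \<in> V. P0 v = 0}"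
  have Usub: "subrepresentation G U V \<rho>"
    unfolding U_def by (rule subrepresentation_kernel[OF rep Mrep P0(1)])
  have Us: "fvs.subspace U" "U \<subseteq> V" using Usub by (auto simp: subrepresentation_def)
  have Urep: "representation G U \<rho>" using rep Usub by (rule subrepresentation_imp_representation)
  have P0V: "P0 v \<in> M" if "v \<in> V" for v using P0(1) that by (auto simp: intertwines_def)
  have P0lin: "linear_on_space V P0" using P0(1) by (simp add: intertwines_def)
  define P where "P = (\<lambda>v. v - P0 v)"
  have PU: "P v \<in> U" if v: "v \<in> V" for v
  proof -
    have "P0 v \<in> V" using P0V[OF v] Ms by blast
    thus ?thesis
      using v P0V[OF v] P0(2) linear_on_space_diff[OF P0lin V v] fvs.subspace_diff[OF V v]
      by (simp add: U_def P_def)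
  qed
  have P: "intertwines G V \<rho> U \<rho> P"
    unfolding intertwines_def
  proof (intro conjI ballI)
    have "linear_on_space V (\<lambda>v. v)" by (simp add: linear_on_space_def)
    thus "linear_on_space V P" unfolding P_def using P0lin by (rule linear_on_space_diff_maps)
    show "P ` V \<subseteq> U" using PU by blast
    fix g v assume gv: "g \<in> carrier G" "v \<in> V"
    have "P0 v \<in> V" using P0V[OF gv(2)] Ms by blast
    thus "P (\<rho> g v) = \<rho> g (P v)"
      using P0(1) gv linear_on_space_diff[OF representation_linear[OF rep gv(1)] V gv(2)]
      by (simp add: P_def intertwines_def)
  qed
  have Pw: "P w \<noteq> 0" using wM P0V[OF w(1)] by (auto simp: P_def)
  \<comment> \<open>Maximality of \<open>M\<close>, in the form applied below both to
    \<open>X\<close> and to its complement \<open>Y\<close>.\<close>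
  have big: "w \<in> {m + x |m x. m \<in> M \<and> x \<in> X}" if X: "subrepresentation G X U \<rho>" "X \<noteq> {0}" for X
  proof (rule ccontr)
    let ?S = "{m + x |m x. m \<in> M \<and> x \<in> X}"
    assume nw: "w \<notin> ?S"
    have XV: "subrepresentation G X V \<rho>" using X(1) Usub by (rule subrepresentation_trans)
    have Xs: "fvs.subspace X" "X \<subseteq> V" "X \<subseteq> U" using X XV by (auto simp: subrepresentation_def)
    have "fvs.subspace ?S" using fvs.subspace_sums[OF Ms(1) Xs(1)] .
    moreover have "?S \<subseteq> V" using Ms Xs fvs.subspace_add[OF V] by blast
    moreover have "\<rho> g ` ?S \<subseteq> ?S" if g: "g \<in> carrier G" for g
    proof
      fix y assume "y \<in> \<rho> g ` ?S"
      then obtain m x where mx: "m \<in> M" "x \<in> X" "y = \<rho> g (m + x)" by blast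
      hence "y = \<rho> g m + \<rho> g x"
        using linear_on_space_add[OF representation_linear[OF rep g]] Ms(2) Xs(2) by blast
      moreover have "\<rho> g m \<in> M" "\<rho> g x \<in> X"
        using mx g Msub XV unfolding subrepresentation_def by blast+
      ultimately show "y \<in> ?S" by blast
    qed
    ultimately have "?S \<in> \<A>" using nw by (simp add: \<A>_def subrepresentation_def)
    moreover have "M \<subseteq> ?S"
    proof
      fix m assume "m \<in> M"
      hence "m + 0 \<in> ?S" using fvs.subspace_0[OF Xs(1)] by blast
      thus "m \<in> ?S" by (simp only: add_0_right)
    qed
    ultimately have "?S = M" by (rule max)
    moreover have "X \<subseteq> ?S"
    proof
      fix x assume "x \<in> X"
      hence "0 + x \<in> ?S" using fvs.subspace_0[OF Ms(1)] by blast
      thus "x \<in> ?S" by (simp only: add_0_left)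
    qed
    ultimately have XM: "X \<subseteq> M" by simp
    have "x = 0" if "x \<in> X" for x
    proof -
      have "P0 x = 0" using Xs(3) that by (auto simp: U_def)
      thus ?thesis using P0(2)[of x] XM that by auto
    qed
    thus False using X(2) fvs.subspace_0[OF Xs(1)] by blast
  qed
  have "irreducible_rep G U \<rho>"
    unfolding irreducible_rep_def
  proof (intro conjI allI impI)
    show "representation G U \<rho>" by fact
    show "U \<noteq> {0}" using Pw PU[OF w(1)] by blast
    fix X assume X: "subrepresentation G X U \<rho>"
    show "X = {0} \<or> X = U"
    proof (rule ccontr)
      assume nX: "\<not> (X = {0} \<or> X = U)"
      obtain Q where Q: "intertwines G U \<rho> X \<rho> Q" "\<And>u. u \<in> X \<Longrightarrow> Q u = u"
        using invariant_projection[OF G Urep X] by blast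
      have Xrep: "representation G X \<rho>" using Urep X by (rule subrepresentation_imp_representation)
      have Xs: "fvs.subspace X" "X \<subseteq> U" using X by (auto simp: subrepresentation_def)
      define Y where "Y = {v \<in> U. Q v = 0}"
      have Y: "subrepresentation G Y U \<rho>"
        unfolding Y_def by (rule subrepresentation_kernel[OF Urep Xrep Q(1)])
      have "Y \<noteq> {0}"
      proof
        assume Y0: "Y = {0}"
        have "v \<in> X" if v: "v \<in> U" for v
        proof -
          have Qv: "Q v \<in> X" using Q(1) v by (auto simp: intertwines_def)
          have "Q (v - Q v) = Q v - Q (Q v)"
            using linear_on_space_diff[of U Q v "Q v"] Q(1) Us v Qv Xs
            by (auto simp: intertwines_def)
          hence "v - Q v \<in> Y"
            using Q(2)[OF Qv] fvs.subspace_diff[OF Us(1) v] Qv Xs by (auto simp: Y_def)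
          thus "v \<in> X" using Y0 Qv by simp
        qed
        thus False using nX Xs by blast
      qed
      from big[OF Y this] obtain m2 y where my: "w = m2 + y" "m2 \<in> M" "y \<in> Y" by blast
      from nX big[OF X] obtain m1 x where mx: "w = m1 + x" "m1 \<in> M" "x \<in> X" by blast
      \<comment> \<open>The difference lies in \<open>M\<close> and in \<open>U\<close>, which meet
        in 0 only; so \<open>x = y\<close> lies in \<open>X\<close> and in \<open>Y\<close>, and
        vanishes.\<close>
      have "x - y = m2 - m1" using mx(1) my(1) by (simp add: algebra_simps)
      hence M0: "x - y \<in> M" using mx my fvs.subspace_diff[OF Ms(1)] by metis
      have yU: "y \<in> U" "x \<in> U" using my mx Xs by (auto simp: Y_def)
      hence "P0 (x - y) = 0" using fvs.subspace_diff[OF Us(1)] by (simp add: U_def)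
      hence "x = y" using P0(2)[OF M0] by simp
      hence "x = 0" using Q(2)[OF mx(3)] my(3) by (auto simp: Y_def)
      thus False using mx wM by simp
    qed
  qed
  thus ?thesis using that Usub P Pw by blast
qed

subsection \<open>Schur's lemma\<close>

text \<open>The vector \<open>p(T) v\<close>, written with iterates because \<open>T\<close> is
  linear on the representation space only.\<close>

definition poly_act :: "(('i \<Rightarrow> complex) \<Rightarrow> 'i \<Rightarrow> complex) \<Rightarrow> complex poly \<Rightarrow> ('i \<Rightarrow> complex) \<Rightarrow> 'i \<Rightarrow> complex"
  where "poly_act T p v = (\<Sum>i\<le>degree p. fscale (coeff p i) ((T ^^ i) v))"

lemma poly_act_le:
  assumes "degree p \<le> n"
  shows "poly_act T p v = (\<Sum>i\<le>n. fscale (coeff p i) ((T ^^ i) v))"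
  unfolding poly_act_def using assms
  by (intro sum.mono_neutral_left) (auto simp: coeff_eq_0)

lemma funpow_closed: "T ` V \<subseteq> V \<Longrightarrow> v \<in> V \<Longrightarrow> (T ^^ i) v \<in> V"
  by (induction i) auto

text \<open>Split off a root: if \<open>p = (X - z) q\<close>, then \<open>T - z\<close> kills
  \<open>q(T) v\<close>. Either this vector is an eigenvector, or \<open>q\<close> annihilates
  \<open>v\<close> and has smaller degree.\<close>

lemma eigenvector_of_annihilating_poly:
  assumes V: "fvs.subspace V" and T: "linear_on_space V T" "T ` V \<subseteq> V"
    and "p \<noteq> 0" "v \<in> V" "v \<noteq> 0" "poly_act T p v = 0"
  shows "\<exists>c. \<exists>u\<in>V. u \<noteq> 0 \<and> T u = fscale c u"
  using assms(4,7)
proof (induction "degree p" arbitrary: p)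
  case 0
  then obtain a where "p = [:a:]" "a \<noteq> 0" by (metis degree_0_id pCons_eq_0_iff)
  hence "fscale a v = 0" using 0 by (simp add: poly_act_def zero_fun_def)
  thus ?case using \<open>a \<noteq> 0\<close> \<open>v \<noteq> 0\<close> by simp
next
  case (Suc n)
  hence "\<not> constant (poly p)" by (simp add: constant_degree)
  then obtain z where "poly p z = 0" using fundamental_theorem_of_algebra by blast
  then obtain q where p: "p = [:- z, 1:] * q" by (metis dvdE poly_eq_0_iff_dvd)
  have q0: "q \<noteq> 0" using p Suc.prems by auto
  have dq: "degree q = n" using Suc.hyps(2) q0 unfolding p by (subst (asm) degree_mult_eq) auto
  let ?u = "poly_act T q v"
  have TV: "(T ^^ i) v \<in> V" for i using funpow_closed[OF T(2) assms(5)] .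
  have uV: "?u \<in> V" unfolding poly_act_def
    by (intro fvs.subspace_sum V fvs.subspace_scale TV)
  have "T ?u = (\<Sum>i\<le>n. fscale (coeff q i) ((T ^^ Suc i) v))"
    unfolding poly_act_def dq
    by (subst linear_on_space_sum[OF T(1) V])
      (auto simp: linear_on_space_scale[OF T(1) TV] TV V fvs.subspace_scale)
  also have "\<dots> = (\<Sum>i\<le>Suc n. fscale (coeff (pCons 0 q) i) ((T ^^ i) v))"
    by (subst sum.atMost_Suc_shift) simp
  finally have Tu: "T ?u = (\<Sum>i\<le>Suc n. fscale (coeff (pCons 0 q) i) ((T ^^ i) v))" .
  have "fscale z ?u = (\<Sum>i\<le>Suc n. fscale (coeff (smult z q) i) ((T ^^ i) v))"
    using poly_act_le[of q "Suc n" T v] dq by (simp add: fvs.scale_sum_right fvs.scale_right_distrib)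
  moreover have "coeff p i = coeff (pCons 0 q) i - coeff (smult z q) i" for i
    by (simp add: p)
  ultimately have "T ?u - fscale z ?u = poly_act T p v"
    using Tu poly_act_le[of p "Suc n" T v] Suc.hyps(2)
    by (simp only: sum_subtractf[symmetric] fvs.scale_left_diff_distrib)
  hence eig: "T ?u = fscale z ?u" using Suc.prems by simp
  show ?case
  proof (cases "?u = 0")
    case True
    thus ?thesis using Suc.hyps(1)[OF dq[symmetric] q0] by simp
  next
    case False
    thus ?thesis using eig uV by blast
  qed
qed

text \<open>The vectors \<open>v\<close>, \<open>T v\<close>, ... up to exponent
  \<open>card B\<close> are too many to be independent. Since dependence is a property of sets,
  coinciding iterates are treated separately; they give a difference of two monomials.\<close>

lemma annihilating_poly_exists:
  assumes "finite B" "T ` fvs.span B \<subseteq> fvs.span B" "v \<in> fvs.span B"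
  shows "\<exists>p. p \<noteq> 0 \<and> poly_act T p v = 0"
proof (cases "inj_on (\<lambda>i. (T ^^ i) v) {..card B}")
  case False
  then obtain i j where ij: "i < j" "(T ^^ i) v = (T ^^ j) v"
    unfolding inj_on_def by (metis nat_neq_iff)
  define p :: "complex poly" where "p = monom 1 j - monom 1 i"
  have "coeff p j = 1" using ij by (simp add: p_def)
  hence p0: "p \<noteq> 0" by auto
  have "degree p \<le> j" using ij unfolding p_def
    by (intro degree_diff_le) (auto intro: order_trans[OF degree_monom_le])
  hence "poly_act T p v = (\<Sum>k\<le>j. fscale (coeff p k) ((T ^^ k) v))" by (rule poly_act_le)
  also have "\<dots> = (\<Sum>k\<in>{i, j}. fscale (coeff p k) ((T ^^ k) v))"
    using ij by (intro sum.mono_neutral_right) (auto simp: p_def)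
  also have "\<dots> = 0"
    using ij by (simp add: p_def fvs.scale_minus_left)
  finally show ?thesis using p0 by blast
next
  case True
  define S where "S = (\<lambda>i. (T ^^ i) v) ` {..card B}"
  have S: "finite S" "card S = Suc (card B)" using True by (auto simp: S_def card_image)
  have "S \<subseteq> fvs.span B" using funpow_closed[OF assms(2,3)] by (auto simp: S_def)
  hence "fvs.dependent S" using fvs.independent_span_bound[OF assms(1)] S by fastforce
  then obtain c where c: "\<exists>x\<in>S. c x \<noteq> 0" "(\<Sum>x\<in>S. fscale (c x) x) = 0"
    using fvs.dependent_finite[OF S(1)] by blast
  define p where "p = (\<Sum>i\<le>card B. monom (c ((T ^^ i) v)) i)"
  have coeff: "coeff p i = (if i \<le> card B then c ((T ^^ i) v) else 0)" for i
    by (simp add: p_def coeff_sum)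
  have p0: "p \<noteq> 0"
  proof -
    obtain i where "i \<le> card B" "c ((T ^^ i) v) \<noteq> 0" using c(1) by (auto simp: S_def)
    hence "coeff p i \<noteq> 0" by (simp add: coeff)
    thus ?thesis by auto
  qed
  have "degree p \<le> card B" by (rule degree_le) (simp add: coeff)
  hence "poly_act T p v = (\<Sum>i\<le>card B. fscale (coeff p i) ((T ^^ i) v))" by (rule poly_act_le)
  also have "\<dots> = (\<Sum>i\<le>card B. fscale (c ((T ^^ i) v)) ((T ^^ i) v))" by (simp add: coeff)
  also have "\<dots> = (\<Sum>x\<in>S. fscale (c x) x)"
    unfolding S_def by (simp add: sum.reindex[OF True])
  finally show ?thesis using c(2) p0 by auto
qed

text \<open>For an eigenvalue \<open>c\<close> the kernel of \<open>T - c\<close> is a nonzero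
  subrepresentation, hence everything.\<close>

lemma schur_scalar:
  assumes irr: "irreducible_rep G V \<rho>" and T: "intertwines G V \<rho> V \<rho> T"
  shows "\<exists>c. \<forall>v\<in>V. T v = fscale c v"
proof -
  have rep: "representation G V \<rho>" and "V \<noteq> {0}" using irr by (auto simp: irreducible_rep_def)
  have V: "fvs.subspace V" using rep by (rule representation_subspace)
  have lin: "linear_on_space V T" "T ` V \<subseteq> V" using T by (auto simp: intertwines_def)
  obtain v where v: "v \<in> V" "v \<noteq> 0" using \<open>V \<noteq> {0}\<close> fvs.subspace_0[OF V] by blast
  obtain B where B: "finite B" "V = fvs.span B" using rep by (auto simp: representation_def)
  obtain p where "p \<noteq> 0" "poly_act T p v = 0"
    using annihilating_poly_exists[OF B(1)] lin(2) v(1) unfolding B(2) by blast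
  then obtain c u where u: "u \<in> V" "u \<noteq> 0" "T u = fscale c u"
    using eigenvector_of_annihilating_poly[OF V lin] v by blast
  define T' where "T' = (\<lambda>v. T v - fscale c v)"
  have "intertwines G V \<rho> V \<rho> T'"
    unfolding intertwines_def
  proof (intro conjI ballI)
    have "linear_on_space V (\<lambda>v. fscale c v)"
      by (simp add: linear_on_space_def fvs.scale_right_distrib fvs.scale_left_commute)
    with lin(1) show "linear_on_space V T'" unfolding T'_def by (rule linear_on_space_diff_maps)
    show "T' ` V \<subseteq> V"
      using lin(2) fvs.subspace_diff[OF V] fvs.subspace_scale[OF V] by (auto simp: T'_def)
    fix g v assume gv: "g \<in> carrier G" "v \<in> V"
    have "T v \<in> V" using lin(2) gv by blast
    thus "T' (\<rho> g v) = \<rho> g (T' v)"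
      using T gv linear_on_space_diff[OF representation_linear[OF rep gv(1)] V, of "T v" "fscale c v"]
        linear_on_space_scale[OF representation_linear[OF rep gv(1)] gv(2)] fvs.subspace_scale[OF V]
      by (simp add: T'_def intertwines_def)
  qed
  hence "subrepresentation G {v \<in> V. T' v = 0} V \<rho>" by (rule subrepresentation_kernel[OF rep rep])
  moreover have "u \<in> {v \<in> V. T' v = 0}" using u by (simp add: T'_def)
  ultimately have "{v \<in> V. T' v = 0} = V"
    using irr u(2) unfolding irreducible_rep_def by blast
  hence "T v = fscale c v" if "v \<in> V" for v using that by (auto simp: T'_def)
  thus ?thesis by blast
qed

lemma schur_bij:
  assumes V: "irreducible_rep G V \<rho>" and W: "irreducible_rep G W \<sigma>"
    and T: "intertwines G V \<rho> W \<sigma> T" and nz: "v \<in> V" "T v \<noteq> 0"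
  shows "bij_betw T V W"
proof -
  have reps: "representation G V \<rho>" "representation G W \<sigma>"
    using V W by (auto simp: irreducible_rep_def)
  have Vs: "fvs.subspace V" using reps(1) by (rule representation_subspace)
  have lin: "linear_on_space V T" using T by (simp add: intertwines_def)
  have "{v \<in> V. T v = 0} = {0}"
    using V nz subrepresentation_kernel[OF reps T] unfolding irreducible_rep_def by blast
  hence "inj_on T V"
    using linear_on_space_diff[OF lin Vs] fvs.subspace_diff[OF Vs]
    by (intro inj_onI) (metis (mono_tags, lifting) eq_iff_diff_eq_0 mem_Collect_eq singletonD)
  moreover have "T ` V = W"
    using W nz subrepresentation_image[OF reps T] unfolding irreducible_rep_def by blast
  ultimately show ?thesis by (simp add: bij_betw_def)
qed

lemma intertwines_inv_into:
  assumes V: "representation G V \<rho>" and S: "intertwines G V \<rho> W \<sigma> S" and bij: "bij_betw S V W"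
  shows "intertwines G W \<sigma> V \<rho> (inv_into V S)"
  unfolding intertwines_def linear_on_space_def
proof (intro conjI ballI allI)
  note S' = bij_betw_apply[OF bij_betw_inv_into[OF bij]]
  note SS' = bij_betw_inv_into_right[OF bij] and S'S = bij_betw_inv_into_left[OF bij]
  have sub: "fvs.subspace V" using V by (rule representation_subspace)
  have lin: "linear_on_space V S" using S by (simp add: intertwines_def)
  let ?S' = "inv_into V S"
  {
    fix x y assume xy: "x \<in> W" "y \<in> W"
    have "S (?S' x + ?S' y) = x + y"
      unfolding linear_on_space_add[OF lin S'[OF xy(1)] S'[OF xy(2)]] SS'[OF xy(1)] SS'[OF xy(2)] ..
    thus "?S' (x + y) = ?S' x + ?S' y"
      using S'S[OF fvs.subspace_add[OF sub S'[OF xy(1)] S'[OF xy(2)]]] by simp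
  next
    fix c x assume x: "x \<in> W"
    have "S (fscale c (?S' x)) = fscale c x"
      unfolding linear_on_space_scale[OF lin S'[OF x]] SS'[OF x] ..
    thus "?S' (fscale c x) = fscale c (?S' x)"
      using S'S[OF fvs.subspace_scale[OF sub S'[OF x], of c]] by simp
  next
    show "?S' ` W \<subseteq> V" using S' by blast
  next
    fix g x assume gx: "g \<in> carrier G" "x \<in> W"
    have "S (\<rho> g (?S' x)) = \<sigma> g x"
      using S gx(1) S'[OF gx(2)] SS'[OF gx(2)] by (simp add: intertwines_def)
    thus "?S' (\<sigma> g x) = \<rho> g (?S' x)"
      using S'S[OF representation_closed[OF V gx(1) S'[OF gx(2)]]] by simp
  }
qed

text \<open>\<open>S\<close> is bijective by Schur's lemma, so \<open>T\<close> composed with its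
  inverse is an endomorphism of \<open>W\<close>, which is a scalar.\<close>

lemma intertwines_proportional:
  assumes V: "irreducible_rep G V \<rho>" and W: "irreducible_rep G W \<sigma>"
    and S: "intertwines G V \<rho> W \<sigma> S" and T: "intertwines G V \<rho> W \<sigma> T"
    and nz: "v \<in> V" "S v \<noteq> 0"
  shows "\<exists>c. \<forall>v\<in>V. T v = fscale c (S v)"
proof -
  have bij: "bij_betw S V W" by (rule schur_bij[where T = S and v = v, OF V W S nz])
  have rep: "representation G V \<rho>" using V by (simp add: irreducible_rep_def)
  from schur_scalar[OF W intertwines_comp[OF intertwines_inv_into[OF rep S bij] T]]
  obtain c where c: "\<forall>w\<in>W. T (inv_into V S w) = fscale c w" ..
  have "T v = fscale c (S v)" if "v \<in> V" for v
    using c bij_betw_apply[OF bij that] bij_betw_inv_into_left[OF bij that] by force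
  thus ?thesis by blast
qed

lemma isomorphic_reps_of_bij_betw:
  assumes U: "representation G U \<rho>"
    and A: "intertwines G U \<rho> V \<sigma> A" "bij_betw A U V" and B: "intertwines G U \<rho> W \<tau> B" "bij_betw B U W"
  shows "isomorphic_reps G V \<sigma> W \<tau>"
  using intertwines_comp[OF intertwines_inv_into[OF U A] B(1)]
    bij_betw_trans[OF bij_betw_inv_into[OF A(2)] B(2), unfolded comp_def]
  unfolding isomorphic_reps_def intertwines_def by blast

subsection \<open>Frobenius reciprocity\<close>

text \<open>Components are unique, so those of a sum, a multiple or a translate must be the ones
  computed termwise; this makes the coordinate maps intertwiners.\<close>

lemma internal_direct_sum_projections:
  assumes ids: "internal_direct_sum V \<W>" and V: "representation G V \<rho>"
    and W: "\<And>W. W \<in> \<W> \<Longrightarrow> representation G W \<rho>"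
  obtains p where "\<And>W. W \<in> \<W> \<Longrightarrow> intertwines G V \<rho> W \<rho> (p W)"
    "\<And>v. v \<in> V \<Longrightarrow> v = (\<Sum>W\<in>\<W>. p W v)"
proof -
  have Ws: "fvs.subspace W" "W \<subseteq> V" if "W \<in> \<W>" for W
    using ids that by (auto simp: internal_direct_sum_def)
  have Vs: "fvs.subspace V" using V by (rule representation_subspace)
  have ex1: "\<exists>!u. u \<in> (\<Pi>\<^sub>E W\<in>\<W>. W) \<and> v = (\<Sum>W\<in>\<W>. u W)" if "v \<in> V" for v
    using ids that unfolding internal_direct_sum_def by blast
  define d where "d = (\<lambda>v. THE u. u \<in> (\<Pi>\<^sub>E W\<in>\<W>. W) \<and> v = (\<Sum>W\<in>\<W>. u W))"
  have d: "d v \<in> (\<Pi>\<^sub>E W\<in>\<W>. W)" "v = (\<Sum>W\<in>\<W>. d v W)" if "v \<in> V" for v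
    using theI'[OF ex1[OF that]] unfolding d_def by auto
  have dW: "d v W \<in> W" if "v \<in> V" "W \<in> \<W>" for v W using d(1)[OF that(1)] that(2) by blast
  have uniq: "d v W = u W"
    if "v \<in> V" "W \<in> \<W>" "v = (\<Sum>W\<in>\<W>. u W)" "\<And>W. W \<in> \<W> \<Longrightarrow> u W \<in> W" for v W u
  proof -
    have "restrict u \<W> \<in> (\<Pi>\<^sub>E W\<in>\<W>. W)" using that(4) by auto
    moreover have "v = (\<Sum>W\<in>\<W>. restrict u \<W> W)" using that(3) by simp
    ultimately have "d v = restrict u \<W>" using ex1[OF that(1)] d[OF that(1)] by blast
    thus ?thesis using that(2) by simp
  qed
  have "intertwines G V \<rho> W \<rho> (\<lambda>v. d v W)" if W': "W \<in> \<W>" for W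
    unfolding intertwines_def linear_on_space_def
  proof (intro conjI ballI allI)
    fix x y assume xy: "x \<in> V" "y \<in> V"
    have "x + y = (\<Sum>W\<in>\<W>. d x W + d y W)"
      using d(2)[OF xy(1)] d(2)[OF xy(2)] by (metis sum.distrib)
    thus "d (x + y) W = d x W + d y W"
      using uniq[OF fvs.subspace_add[OF Vs xy] W', of "\<lambda>W. d x W + d y W"] dW xy Ws(1) fvs.subspace_add
      by blast
  next
    fix c x assume x: "x \<in> V"
    have "fscale c x = (\<Sum>W\<in>\<W>. fscale c (d x W))"
      using d(2)[OF x] by (metis fvs.scale_sum_right)
    thus "d (fscale c x) W = fscale c (d x W)"
      using uniq[OF fvs.subspace_scale[OF Vs x] W', of c "\<lambda>W. fscale c (d x W)"] dW x Ws(1)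
        fvs.subspace_scale by blast
  next
    show "(\<lambda>v. d v W) ` V \<subseteq> W" using dW W' by blast
  next
    fix g x assume gx: "g \<in> carrier G" "x \<in> V"
    have "\<rho> g x = \<rho> g (\<Sum>W\<in>\<W>. d x W)" using d(2)[OF gx(2)] by simp
    also have "\<dots> = (\<Sum>W\<in>\<W>. \<rho> g (d x W))"
      using dW[OF gx(2)] Ws(2)
      by (intro linear_on_space_sum[OF representation_linear[OF V gx(1)] Vs, where f = "d x"]) blast
    finally show "d (\<rho> g x) W = \<rho> g (d x W)"
      using uniq[OF representation_closed[OF V gx] W', of "\<lambda>W. \<rho> g (d x W)"] dW gx
        representation_closed[OF W] by blast
  qed
  thus ?thesis using that[of "\<lambda>W v. d v W"] d(2) by blast
qed

text \<open>The \<open>K\<close>-maps from \<open>W\<close> to \<open>V\<close> correspond to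
  \<open>G\<close>-maps from \<open>W\<close> into the induced representation. Only one summand
  there can be isomorphic to \<open>W\<close>, so all these maps land in it and are proportional by
  Schur's lemma.\<close>

lemma frobenius_multiplicity_free:
  fixes W :: "('i \<Rightarrow> complex) set" and V :: "('j \<Rightarrow> complex) set"
  assumes G: "group G" "finite (carrier G)" and K: "subgroup K G"
    and W: "irreducible_rep G W \<rho>" and V: "representation (G\<lparr>carrier := K\<rparr>) V \<sigma>"
    and mf: "multiplicity_free G (ind_space G K V \<sigma>) (ind_action G)"
    and P: "intertwines (G\<lparr>carrier := K\<rparr>) W \<rho> V \<sigma> P"
    and Q: "intertwines (G\<lparr>carrier := K\<rparr>) W \<rho> V \<sigma> Q"
    and nz: "w \<in> W" "P w \<noteq> 0"
  shows "\<exists>c. \<forall>w\<in>W. Q w = fscale c (P w)"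
proof -
  interpret group G by fact
  interpret K: subgroup K G by fact
  let ?I = "ind_space G K V \<sigma>"
  have Irep: "representation G ?I (ind_action G)" using representation_ind[OF G K V] .
  have Wrep: "representation G W \<rho>" using W by (simp add: irreducible_rep_def)
  \<comment> \<open>The Frobenius correspondence: a \<open>K\<close>-map \<open>R\<close> becomes a
    \<open>G\<close>-map, and evaluation at the identity recovers \<open>R\<close>.\<close>
  define \<Phi> where "\<Phi> = (\<lambda>(R :: ('i \<Rightarrow> complex) \<Rightarrow> 'j \<Rightarrow> complex) w (g, i).
    if g \<in> carrier G then R (\<rho> g w) i else 0)"
  have \<Phi>: "intertwines G W \<rho> ?I (ind_action G) (\<Phi> R)"
    if R: "intertwines (G\<lparr>carrier := K\<rparr>) W \<rho> V \<sigma> R" for R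
    unfolding intertwines_def
  proof (intro conjI ballI)
    have Rlin: "linear_on_space W R" using R by (simp add: intertwines_def)
    show "linear_on_space W (\<Phi> R)"
      unfolding linear_on_space_def
    proof (intro conjI ballI allI)
      fix x y assume xy: "x \<in> W" "y \<in> W"
      have "R (\<rho> g (x + y)) = R (\<rho> g x) + R (\<rho> g y)" if "g \<in> carrier G" for g
        using linear_on_space_add[OF Rlin] linear_on_space_add[OF representation_linear[OF Wrep that]]
          representation_closed[OF Wrep that] xy by simp
      thus "\<Phi> R (x + y) = \<Phi> R x + \<Phi> R y" by (auto simp: \<Phi>_def fun_eq_iff)
    next
      fix c x assume x: "x \<in> W"
      have "R (\<rho> g (fscale c x)) = fscale c (R (\<rho> g x))" if "g \<in> carrier G" for g
        using linear_on_space_scale[OF Rlin] linear_on_space_scale[OF representation_linear[OF Wrep that]]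
          representation_closed[OF Wrep that] x by simp
      thus "\<Phi> R (fscale c x) = fscale c (\<Phi> R x)" by (auto simp: \<Phi>_def fun_eq_iff fscale_def)
    qed
    have cur: "curry (\<Phi> R w) g = (if g \<in> carrier G then R (\<rho> g w) else 0)" for w g
      by (auto simp: \<Phi>_def curry_def fun_eq_iff)
    show "\<Phi> R ` W \<subseteq> ?I"
    proof
      fix f assume "f \<in> \<Phi> R ` W"
      then obtain w where w: "w \<in> W" "f = \<Phi> R w" by blast
      have "R (\<rho> g w) \<in> V" if "g \<in> carrier G" for g
        using R representation_closed[OF Wrep that w(1)] by (auto simp: intertwines_def)
      moreover have "R (\<rho> (k \<otimes>\<^bsub>G\<^esub> g) w) = \<sigma> k (R (\<rho> g w))" if "g \<in> carrier G" "k \<in> K" for g k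
        using R representation_closed[OF Wrep that(1) w(1)]
          representation_mult[OF Wrep K.mem_carrier[OF that(2)] that(1) w(1)] that(2)
        by (simp add: intertwines_def)
      ultimately show "f \<in> ?I"
        using K.mem_carrier by (simp add: ind_space_def w(2) cur)
    qed
    fix x w assume xw: "x \<in> carrier G" "w \<in> W"
    show "\<Phi> R (\<rho> x w) = ind_action G x (\<Phi> R w)"
    proof
      fix z :: "'a \<times> 'j"
      obtain g i where z: "z = (g, i)" by force
      show "\<Phi> R (\<rho> x w) z = ind_action G x (\<Phi> R w) z"
      proof (cases "g \<in> carrier G")
        case True
        from representation_mult[OF Wrep True xw, symmetric] True xw(1) show ?thesis
          by (simp add: z \<Phi>_def ind_action_def)
      qed (simp add: z \<Phi>_def ind_action_def)
    qed
  qed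
  obtain \<W> where \<W>: "internal_direct_sum ?I \<W> \<and> (\<forall>X\<in>\<W>. irreducible_rep G X (ind_action G)) \<and>
      (\<forall>X\<in>\<W>. \<forall>Y\<in>\<W>. X \<noteq> Y \<longrightarrow> \<not> isomorphic_reps G X (ind_action G) Y (ind_action G))"
    using mf unfolding multiplicity_free_def by (elim exE)
  note ids = conjunct1[OF \<W>] and irr = bspec[OF conjunct1[OF conjunct2[OF \<W>]]]
    and noniso = mp[OF bspec[OF bspec[OF conjunct2[OF conjunct2[OF \<W>]]]]]
  have irr_rep: "representation G X (ind_action G)" if "X \<in> \<W>" for X
    using irr[OF that] by (simp add: irreducible_rep_def)
  obtain p where p: "\<And>X. X \<in> \<W> \<Longrightarrow> intertwines G ?I (ind_action G) X (ind_action G) (p X)"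
    "\<And>v. v \<in> ?I \<Longrightarrow> v = (\<Sum>X\<in>\<W>. p X v)"
    using internal_direct_sum_projections[OF ids Irep irr_rep] by blast
  have \<Phi>I: "\<Phi> R x \<in> ?I" if "intertwines (G\<lparr>carrier := K\<rparr>) W \<rho> V \<sigma> R" "x \<in> W" for R x
    using \<Phi>[OF that(1)] that(2) by (auto simp: intertwines_def)
  have ev: "curry (\<Phi> R x) \<one>\<^bsub>G\<^esub> = R x" if "x \<in> W" for R x
    using representation_one[OF Wrep that] by (simp add: \<Phi>_def curry_def)
  have "\<Phi> P w \<noteq> 0" using ev[OF nz(1), of P] nz(2) by (auto simp: curry_def zero_fun_def)
  then obtain X where X: "X \<in> \<W>" "p X (\<Phi> P w) \<noteq> 0"
    using p(2)[OF \<Phi>I[OF P nz(1)]] by (metis sum.neutral)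
  have comp: "intertwines G W \<rho> Y (ind_action G) (\<lambda>x. p Y (\<Phi> R x))"
    if "intertwines (G\<lparr>carrier := K\<rparr>) W \<rho> V \<sigma> R" "Y \<in> \<W>" for R Y
    by (rule intertwines_comp[OF \<Phi>[OF that(1)] p(1)[OF that(2)]])
  \<comment> \<open>A second summand hit from \<open>W\<close> would be isomorphic to
    \<open>W\<close>, hence to \<open>X\<close>.\<close>
  have other: "p Y (\<Phi> R x) = 0"
    if R: "intertwines (G\<lparr>carrier := K\<rparr>) W \<rho> V \<sigma> R" and Y: "Y \<in> \<W>" "Y \<noteq> X" and x: "x \<in> W" for R Y x
  proof (rule ccontr)
    assume n0: "p Y (\<Phi> R x) \<noteq> 0"
    have A: "bij_betw (\<lambda>x. p X (\<Phi> P x)) W X"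
      by (rule schur_bij[where T = "\<lambda>x. p X (\<Phi> P x)", OF W irr[OF X(1)] comp[OF P X(1)] nz(1) X(2)])
    have B: "bij_betw (\<lambda>x. p Y (\<Phi> R x)) W Y"
      by (rule schur_bij[where T = "\<lambda>x. p Y (\<Phi> R x)", OF W irr[OF Y(1)] comp[OF R Y(1)] x n0])
    show False
      using isomorphic_reps_of_bij_betw[OF Wrep comp[OF P X(1)] A comp[OF R Y(1)] B]
        noniso[OF X(1) Y(1)] Y(2) by simp
  qed
  have \<Phi>X: "\<Phi> R x = p X (\<Phi> R x)" if R: "intertwines (G\<lparr>carrier := K\<rparr>) W \<rho> V \<sigma> R" and x: "x \<in> W" for R x
  proof -
    have "finite \<W>" using ids by (simp add: internal_direct_sum_def)
    hence "(\<Sum>Y\<in>\<W>. p Y (\<Phi> R x)) = p X (\<Phi> R x)"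
      using other[OF R _ _ x] X(1) by (subst sum.remove[of _ X]) auto
    thus ?thesis using p(2)[OF \<Phi>I[OF R x]] by simp
  qed
  obtain c where c: "\<forall>x\<in>W. p X (\<Phi> Q x) = fscale c (p X (\<Phi> P x))"
    using intertwines_proportional[where S = "\<lambda>x. p X (\<Phi> P x)" and T = "\<lambda>x. p X (\<Phi> Q x)",
        OF W irr[OF X(1)] comp[OF P X(1)] comp[OF Q X(1)] nz(1) X(2)] ..
  have "Q x = fscale c (P x)" if x: "x \<in> W" for x
  proof -
    have "\<Phi> Q x = fscale c (\<Phi> P x)" using c \<Phi>X[OF P x] \<Phi>X[OF Q x] x by metis
    hence "curry (\<Phi> Q x) \<one>\<^bsub>G\<^esub> = fscale c (curry (\<Phi> P x) \<one>\<^bsub>G\<^esub>)"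
      by (simp add: curry_def fscale_def fun_eq_iff)
    thus ?thesis using ev[OF x] by simp
  qed
  thus ?thesis by blast
qed

subsection \<open>Conjugacy sums over a strong Gelfand subgroup\<close>

text \<open>The action of an element of the group algebra that commutes with \<open>K\<close>.
  Summing over \<open>K\<close>, and not over the set of conjugates, makes reindexing by
  translations immediate.\<close>

definition conj_sum ::
    "('g, 'm) monoid_scheme \<Rightarrow> 'g set \<Rightarrow> ('g \<Rightarrow> ('i \<Rightarrow> complex) \<Rightarrow> 'i \<Rightarrow> complex)
      \<Rightarrow> 'g \<Rightarrow> ('i \<Rightarrow> complex) \<Rightarrow> 'i \<Rightarrow> complex"
  where "conj_sum G K \<rho> x w = (\<Sum>a\<in>K. \<rho> (a \<otimes>\<^bsub>G\<^esub> x \<otimes>\<^bsub>G\<^esub> inv\<^bsub>G\<^esub> a) w)"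

lemma restrict_representation:
  assumes "subgroup K G" "representation G V \<rho>"
  shows "representation (G\<lparr>carrier := K\<rparr>) V \<rho>"
  using assms(2) subgroup.mem_carrier[OF assms(1)] unfolding representation_def by simp

lemma conj_sum_linear_closed:
  assumes "group G" and K: "subgroup K G" and rep: "representation G W \<rho>" and x: "x \<in> carrier G"
  shows "linear_on_space W (conj_sum G K \<rho> x)" "conj_sum G K \<rho> x ` W \<subseteq> W"
proof -
  interpret group G by fact
  interpret K: subgroup K G by fact
  have W: "fvs.subspace W" using rep by (rule representation_subspace)
  have car: "a \<otimes>\<^bsub>G\<^esub> x \<otimes>\<^bsub>G\<^esub> inv\<^bsub>G\<^esub> a \<in> carrier G" if "a \<in> K" for a using that x by simp
  show "linear_on_space W (conj_sum G K \<rho> x)"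
    using linear_on_space_add[OF representation_linear[OF rep car]]
      linear_on_space_scale[OF representation_linear[OF rep car]]
    by (simp add: linear_on_space_def conj_sum_def sum.distrib[symmetric] fvs.scale_sum_right
        cong: sum.cong)
  show "conj_sum G K \<rho> x ` W \<subseteq> W"
    using representation_closed[OF rep car] by (auto simp: conj_sum_def intro: fvs.subspace_sum[OF W])
qed

lemma conj_sum_intertwines:
  assumes "group G" and K: "subgroup K G" and rep: "representation G W \<rho>" and x: "x \<in> carrier G"
  shows "intertwines (G\<lparr>carrier := K\<rparr>) W \<rho> W \<rho> (conj_sum G K \<rho> x)"
  unfolding intertwines_def
proof (intro conjI ballI)
  interpret group G by fact
  interpret K: subgroup K G by fact
  have W: "fvs.subspace W" using rep by (rule representation_subspace)
  have car: "a \<otimes>\<^bsub>G\<^esub> x \<otimes>\<^bsub>G\<^esub> inv\<^bsub>G\<^esub> a \<in> carrier G" if "a \<in> K" for a using that x by simp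
  note conj_sum_linear_closed[OF assms]
  thus "linear_on_space W (conj_sum G K \<rho> x)" "conj_sum G K \<rho> x ` W \<subseteq> W" by blast+
  fix k w assume "k \<in> carrier (G\<lparr>carrier := K\<rparr>)" and w: "w \<in> W"
  hence k: "k \<in> K" by simp
  have "conj_sum G K \<rho> x (\<rho> k w)
      = (\<Sum>a\<in>K. \<rho> ((k \<otimes>\<^bsub>G\<^esub> a) \<otimes>\<^bsub>G\<^esub> x \<otimes>\<^bsub>G\<^esub> inv\<^bsub>G\<^esub> (k \<otimes>\<^bsub>G\<^esub> a)) (\<rho> k w))"
    unfolding conj_sum_def
    by (rule sum.reindex_bij_betw[symmetric])
      (use k in \<open>auto intro!: bij_betwI[where g = "\<lambda>g. inv\<^bsub>G\<^esub> k \<otimes>\<^bsub>G\<^esub> g"] simp: m_assoc[symmetric]\<close>)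
  also have "\<dots> = (\<Sum>a\<in>K. \<rho> k (\<rho> (a \<otimes>\<^bsub>G\<^esub> x \<otimes>\<^bsub>G\<^esub> inv\<^bsub>G\<^esub> a) w))"
  proof (rule sum.cong[OF refl])
    fix a assume a: "a \<in> K"
    have "(k \<otimes>\<^bsub>G\<^esub> a) \<otimes>\<^bsub>G\<^esub> x \<otimes>\<^bsub>G\<^esub> inv\<^bsub>G\<^esub> (k \<otimes>\<^bsub>G\<^esub> a) \<otimes>\<^bsub>G\<^esub> k = k \<otimes>\<^bsub>G\<^esub> (a \<otimes>\<^bsub>G\<^esub> x \<otimes>\<^bsub>G\<^esub> inv\<^bsub>G\<^esub> a)"
      using a k x by (simp add: inv_mult_group m_assoc)
    moreover have "\<rho> ((k \<otimes>\<^bsub>G\<^esub> a) \<otimes>\<^bsub>G\<^esub> x \<otimes>\<^bsub>G\<^esub> inv\<^bsub>G\<^esub> (k \<otimes>\<^bsub>G\<^esub> a)) (\<rho> k w)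
        = \<rho> ((k \<otimes>\<^bsub>G\<^esub> a) \<otimes>\<^bsub>G\<^esub> x \<otimes>\<^bsub>G\<^esub> inv\<^bsub>G\<^esub> (k \<otimes>\<^bsub>G\<^esub> a) \<otimes>\<^bsub>G\<^esub> k) w"
      using representation_mult[OF rep car[of "k \<otimes>\<^bsub>G\<^esub> a"] _ w, of k] a k by simp
    ultimately show "\<rho> ((k \<otimes>\<^bsub>G\<^esub> a) \<otimes>\<^bsub>G\<^esub> x \<otimes>\<^bsub>G\<^esub> inv\<^bsub>G\<^esub> (k \<otimes>\<^bsub>G\<^esub> a)) (\<rho> k w)
        = \<rho> k (\<rho> (a \<otimes>\<^bsub>G\<^esub> x \<otimes>\<^bsub>G\<^esub> inv\<^bsub>G\<^esub> a) w)"
      using representation_mult[OF rep _ car[OF a] w, of k] k by simp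
  qed
  also have "\<dots> = \<rho> k (conj_sum G K \<rho> x w)"
    unfolding conj_sum_def using representation_closed[OF rep car w] k
    by (intro linear_on_space_sum[OF representation_linear[OF rep] W, symmetric]) auto
  finally show "conj_sum G K \<rho> x (\<rho> k w) = \<rho> k (conj_sum G K \<rho> x w)" .
qed

text \<open>A nonzero commutator would survive under some \<open>K\<close>-map \<open>P\<close> onto
  an irreducible \<open>U\<close>. But \<open>P\<close> composed with either conjugacy sum is again
  a \<open>K\<close>-map, hence a multiple of \<open>P\<close>, and the two scalars commute.\<close>

lemma conj_sums_commute_irreducible:
  fixes W :: "(nat \<Rightarrow> complex) set"
  assumes G: "group G" "finite (carrier G)" and K: "strong_gelfand_subgroup K G"
    and W: "irreducible_rep G W \<rho>" and xy: "x \<in> carrier G" "y \<in> carrier G" and w: "w \<in> W"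
  shows "conj_sum G K \<rho> x (conj_sum G K \<rho> y w) = conj_sum G K \<rho> y (conj_sum G K \<rho> x w)"
proof (rule ccontr)
  let ?K = "G\<lparr>carrier := K\<rparr>" and ?X = "conj_sum G K \<rho> x" and ?Y = "conj_sum G K \<rho> y"
  assume ne: "?X (?Y w) \<noteq> ?Y (?X w)"
  have KG: "subgroup K G" using K by (simp add: strong_gelfand_subgroup_def)
  have rep: "representation G W \<rho>" using W by (simp add: irreducible_rep_def)
  have Ws: "fvs.subspace W" using rep by (rule representation_subspace)
  have repK: "representation ?K W \<rho>" by (rule restrict_representation[OF KG rep])
  have gK: "group ?K" using group.subgroup_imp_group[OF G(1) KG] .
  have fK: "finite (carrier ?K)" using G(2) subgroup.subset[OF KG] by (auto intro: finite_subset)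
  note X = conj_sum_intertwines[OF G(1) KG rep xy(1)]
  note Y = conj_sum_intertwines[OF G(1) KG rep xy(2)]
  have XW: "?X v \<in> W" "?Y v \<in> W" if "v \<in> W" for v using X Y that by (auto simp: intertwines_def)
  have dW: "?X (?Y w) - ?Y (?X w) \<in> W" using XW w fvs.subspace_diff[OF Ws] by blast
  have d0: "?X (?Y w) - ?Y (?X w) \<noteq> 0" using ne by simp
  obtain U P where "subrepresentation ?K U W \<rho>" and U: "irreducible_rep ?K U \<rho>"
    and P: "intertwines ?K W \<rho> U \<rho> P" and nz: "P (?X (?Y w) - ?Y (?X w)) \<noteq> 0"
    by (rule irreducible_quotient[OF gK fK repK dW d0])
  have Urep: "representation ?K U \<rho>" using U by (simp add: irreducible_rep_def)
  have mf: "multiplicity_free G (ind_space G K U \<rho>) (ind_action G)"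
    using K U unfolding strong_gelfand_subgroup_def by blast
  obtain c where c: "\<And>v. v \<in> W \<Longrightarrow> P (?X v) = fscale c (P v)"
    using frobenius_multiplicity_free[where Q = "\<lambda>v. P (?X v)" and P = P,
        OF G KG W Urep mf P intertwines_comp[OF X P] dW nz] by blast
  obtain d where d: "\<And>v. v \<in> W \<Longrightarrow> P (?Y v) = fscale d (P v)"
    using frobenius_multiplicity_free[where Q = "\<lambda>v. P (?Y v)" and P = P,
        OF G KG W Urep mf P intertwines_comp[OF Y P] dW nz] by blast
  have "P (?X (?Y w)) = P (?Y (?X w))"
    using c d XW w by (simp add: fvs.scale_left_commute)
  moreover have "P (?X (?Y w) - ?Y (?X w)) = P (?X (?Y w)) - P (?Y (?X w))"
    using P XW w by (intro linear_on_space_diff[OF _ Ws]) (auto simp: intertwines_def)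
  ultimately show False using nz by simp
qed

text \<open>A nonzero commutator would stay nonzero in an irreducible quotient of \<open>V\<close>,
  where the preceding lemma applies.\<close>

lemma conj_sums_commute:
  fixes V :: "(nat \<Rightarrow> complex) set"
  assumes G: "group G" "finite (carrier G)" and K: "strong_gelfand_subgroup K G"
    and rep: "representation G V \<rho>" and xy: "x \<in> carrier G" "y \<in> carrier G" and v: "v \<in> V"
  shows "conj_sum G K \<rho> x (conj_sum G K \<rho> y v) = conj_sum G K \<rho> y (conj_sum G K \<rho> x v)"
proof (rule ccontr)
  interpret group G by fact
  let ?X = "conj_sum G K \<rho> x" and ?Y = "conj_sum G K \<rho> y"
  assume ne: "?X (?Y v) \<noteq> ?Y (?X v)"
  have KG: "subgroup K G" using K by (simp add: strong_gelfand_subgroup_def)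
  interpret K: subgroup K G by fact
  have Vs: "fvs.subspace V" using rep by (rule representation_subspace)
  have VV: "?X v \<in> V" "?Y v \<in> V" if "v \<in> V" for v
    using conj_sum_linear_closed(2)[OF G(1) KG rep] xy that by blast+
  have dV: "?X (?Y v) - ?Y (?X v) \<in> V" using VV v fvs.subspace_diff[OF Vs] by blast
  have d0: "?X (?Y v) - ?Y (?X v) \<noteq> 0" using ne by simp
  obtain W Q where "subrepresentation G W V \<rho>" and W: "irreducible_rep G W \<rho>"
    and Q: "intertwines G V \<rho> W \<rho> Q" and nz: "Q (?X (?Y v) - ?Y (?X v)) \<noteq> 0"
    by (rule irreducible_quotient[OF G rep dV d0])
  have lin: "linear_on_space V Q" using Q by (simp add: intertwines_def)
  have QS: "Q (conj_sum G K \<rho> z u) = conj_sum G K \<rho> z (Q u)" if z: "z \<in> carrier G" and u: "u \<in> V" for z u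
  proof -
    have car: "a \<otimes>\<^bsub>G\<^esub> z \<otimes>\<^bsub>G\<^esub> inv\<^bsub>G\<^esub> a \<in> carrier G" if "a \<in> K" for a using that z by simp
    have "Q (conj_sum G K \<rho> z u) = (\<Sum>a\<in>K. Q (\<rho> (a \<otimes>\<^bsub>G\<^esub> z \<otimes>\<^bsub>G\<^esub> inv\<^bsub>G\<^esub> a) u))"
      unfolding conj_sum_def
      by (rule linear_on_space_sum[OF lin Vs]) (rule representation_closed[OF rep car u])
    also have "\<dots> = conj_sum G K \<rho> z (Q u)"
      unfolding conj_sum_def
      using Q u car by (intro sum.cong refl) (simp add: intertwines_def)
    finally show ?thesis .
  qed
  have "Q (?X (?Y v) - ?Y (?X v)) = Q (?X (?Y v)) - Q (?Y (?X v))"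
    using VV v by (intro linear_on_space_diff[OF lin Vs]) auto
  also have "\<dots> = ?X (?Y (Q v)) - ?Y (?X (Q v))"
    using VV v xy by (simp add: QS)
  also have "\<dots> = 0"
  proof -
    have "Q v \<in> W" using Q v by (auto simp: intertwines_def)
    from conj_sums_commute_irreducible[OF G K W xy this] show ?thesis by simp
  qed
  finally show False using nz by simp
qed

text \<open>The two products agree in the group algebra; \<open>F\<close> is an arbitrary linear
  functional testing this. The equality is read off from the right regular representation.\<close>

theorem strong_gelfand_conj_sums:
  fixes F :: "'g \<Rightarrow> complex" and G :: "('g, 'm) monoid_scheme"
  assumes G: "group G" "finite (carrier G)" and K: "strong_gelfand_subgroup K G"
    and xy: "x \<in> carrier G" "y \<in> carrier G"
  shows "(\<Sum>a\<in>K. \<Sum>b\<in>K. F ((a \<otimes>\<^bsub>G\<^esub> x \<otimes>\<^bsub>G\<^esub> inv\<^bsub>G\<^esub> a) \<otimes>\<^bsub>G\<^esub> (b \<otimes>\<^bsub>G\<^esub> y \<otimes>\<^bsub>G\<^esub> inv\<^bsub>G\<^esub> b)))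
    = (\<Sum>a\<in>K. \<Sum>b\<in>K. F ((b \<otimes>\<^bsub>G\<^esub> y \<otimes>\<^bsub>G\<^esub> inv\<^bsub>G\<^esub> b) \<otimes>\<^bsub>G\<^esub> (a \<otimes>\<^bsub>G\<^esub> x \<otimes>\<^bsub>G\<^esub> inv\<^bsub>G\<^esub> a)))"
proof -
  interpret group G by fact
  have KG: "subgroup K G" using K by (simp add: strong_gelfand_subgroup_def)
  interpret K: subgroup K G by fact
  \<comment> \<open>\<open>strong_gelfand_subgroup\<close> quantifies over functions on
    \<open>nat\<close>, so the regular representation is transported there along an
    injection.\<close>
  obtain h :: "'g \<Rightarrow> nat" where h: "inj_on h (carrier G)"
    using finite_imp_inj_to_nat_seg[OF G(2)] by blast
  define e where "e = inv_into (carrier G) h"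
  have eh: "e (h g) = g" if "g \<in> carrier G" for g using h that by (simp add: e_def)
  let ?H = "h ` carrier G"
  define V where "V = {f :: nat \<Rightarrow> complex. \<forall>i. i \<notin> ?H \<longrightarrow> f i = 0}"
  define \<rho> where "\<rho> = (\<lambda>g (f :: nat \<Rightarrow> complex) i. if i \<in> ?H then f (h (e i \<otimes>\<^bsub>G\<^esub> g)) else 0)"
  have rep: "representation G V \<rho>"
    unfolding representation_def
  proof (intro conjI ballI)
    define B where "B = (\<lambda>j i. if i = j then 1 else 0 :: complex) ` ?H"
    have Vs: "fvs.subspace V"
      by (rule fvs.subspaceI) (auto simp: V_def fscale_def)
    have "f \<in> fvs.span B" if f: "f \<in> V" for f
    proof -
      have "f = (\<Sum>j\<in>?H. fscale (f j) (\<lambda>i. if i = j then 1 else 0))"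
      proof
        fix i
        have app: "(\<Sum>j\<in>A. g j) i = (\<Sum>j\<in>A. g j i)" for A :: "nat set" and g :: "nat \<Rightarrow> nat \<Rightarrow> complex"
          by (induction A rule: infinite_finite_induct) auto
        have "(\<Sum>j\<in>?H. fscale (f j) (\<lambda>i. if i = j then 1 else 0)) i = (\<Sum>j\<in>?H. if i = j then f j else 0)"
          unfolding app by (intro sum.cong) (auto simp: fscale_def)
        also have "\<dots> = f i" using f G(2) by (auto simp: V_def)
        finally show "f i = (\<Sum>j\<in>?H. fscale (f j) (\<lambda>i. if i = j then 1 else 0)) i" by simp
      qed
      also have "\<dots> \<in> fvs.span B"
        by (intro fvs.span_sum fvs.span_scale fvs.span_base) (auto simp: B_def)
      finally show ?thesis .
    qed
    moreover have "fvs.span B \<subseteq> V"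
      by (intro fvs.span_minimal Vs) (auto simp: B_def V_def)
    ultimately have "V = fvs.span B" by blast
    moreover have "finite B" using G(2) by (simp add: B_def)
    ultimately show "\<exists>B. finite B \<and> V = fvs.span B" by blast
  next
    fix g show "\<rho> g ` V \<subseteq> V" by (auto simp: V_def \<rho>_def)
  next
    fix g show "linear_on_space V (\<rho> g)"
      by (auto simp: linear_on_space_def \<rho>_def fun_eq_iff fscale_def)
  next
    fix f assume "f \<in> V"
    thus "\<rho> \<one>\<^bsub>G\<^esub> f = f" by (auto simp: V_def \<rho>_def fun_eq_iff eh)
  next
    fix g k f assume gk: "g \<in> carrier G" "k \<in> carrier G" "f \<in> V"
    show "\<rho> (g \<otimes>\<^bsub>G\<^esub> k) f = \<rho> g (\<rho> k f)"
    proof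
      fix i show "\<rho> (g \<otimes>\<^bsub>G\<^esub> k) f i = \<rho> g (\<rho> k f) i"
      proof (cases "i \<in> ?H")
        case True
        then obtain c where c: "c \<in> carrier G" "i = h c" by blast
        thus ?thesis using gk by (simp add: \<rho>_def eh m_assoc)
      qed (simp add: \<rho>_def)
    qed
  qed
  define f where "f = (\<lambda>i. if i \<in> ?H then F (e i) else 0)"
  have fV: "f \<in> V" by (simp add: f_def V_def)
  have Vs: "fvs.subspace V" using rep by (rule representation_subspace)
  \<comment> \<open>Evaluating a right translate of \<open>F\<close> at the identity gives the value
    of \<open>F\<close> at the translating element.\<close>
  have ev: "\<rho> g f (h \<one>\<^bsub>G\<^esub>) = F g" if "g \<in> carrier G" for g
    using that by (simp add: \<rho>_def f_def eh)
  have app: "(\<Sum>j\<in>A. g j) i = (\<Sum>j\<in>A. g j i)" for A :: "'g set" and g :: "'g \<Rightarrow> nat \<Rightarrow> complex" and i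
    by (induction A rule: infinite_finite_induct) auto
  have expand: "conj_sum G K \<rho> s (conj_sum G K \<rho> t f) (h \<one>\<^bsub>G\<^esub>)
      = (\<Sum>a\<in>K. \<Sum>b\<in>K. F ((a \<otimes>\<^bsub>G\<^esub> s \<otimes>\<^bsub>G\<^esub> inv\<^bsub>G\<^esub> a) \<otimes>\<^bsub>G\<^esub> (b \<otimes>\<^bsub>G\<^esub> t \<otimes>\<^bsub>G\<^esub> inv\<^bsub>G\<^esub> b)))"
    if st: "s \<in> carrier G" "t \<in> carrier G" for s t
  proof -
    have car: "a \<otimes>\<^bsub>G\<^esub> s \<otimes>\<^bsub>G\<^esub> inv\<^bsub>G\<^esub> a \<in> carrier G" "a \<otimes>\<^bsub>G\<^esub> t \<otimes>\<^bsub>G\<^esub> inv\<^bsub>G\<^esub> a \<in> carrier G"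
      if "a \<in> K" for a using that st by simp_all
    have "conj_sum G K \<rho> s (conj_sum G K \<rho> t f)
        = (\<Sum>a\<in>K. \<Sum>b\<in>K. \<rho> ((a \<otimes>\<^bsub>G\<^esub> s \<otimes>\<^bsub>G\<^esub> inv\<^bsub>G\<^esub> a) \<otimes>\<^bsub>G\<^esub> (b \<otimes>\<^bsub>G\<^esub> t \<otimes>\<^bsub>G\<^esub> inv\<^bsub>G\<^esub> b)) f)"
      unfolding conj_sum_def
    proof (rule sum.cong[OF refl])
      fix a assume a: "a \<in> K"
      have "\<rho> (a \<otimes>\<^bsub>G\<^esub> s \<otimes>\<^bsub>G\<^esub> inv\<^bsub>G\<^esub> a) (\<Sum>b\<in>K. \<rho> (b \<otimes>\<^bsub>G\<^esub> t \<otimes>\<^bsub>G\<^esub> inv\<^bsub>G\<^esub> b) f)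
          = (\<Sum>b\<in>K. \<rho> (a \<otimes>\<^bsub>G\<^esub> s \<otimes>\<^bsub>G\<^esub> inv\<^bsub>G\<^esub> a) (\<rho> (b \<otimes>\<^bsub>G\<^esub> t \<otimes>\<^bsub>G\<^esub> inv\<^bsub>G\<^esub> b) f))"
        by (rule linear_on_space_sum[OF representation_linear[OF rep car(1)[OF a]] Vs])
          (rule representation_closed[OF rep car(2) fV])
      thus "\<rho> (a \<otimes>\<^bsub>G\<^esub> s \<otimes>\<^bsub>G\<^esub> inv\<^bsub>G\<^esub> a) (\<Sum>b\<in>K. \<rho> (b \<otimes>\<^bsub>G\<^esub> t \<otimes>\<^bsub>G\<^esub> inv\<^bsub>G\<^esub> b) f)
          = (\<Sum>b\<in>K. \<rho> ((a \<otimes>\<^bsub>G\<^esub> s \<otimes>\<^bsub>G\<^esub> inv\<^bsub>G\<^esub> a) \<otimes>\<^bsub>G\<^esub> (b \<otimes>\<^bsub>G\<^esub> t \<otimes>\<^bsub>G\<^esub> inv\<^bsub>G\<^esub> b)) f)"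
        using representation_mult[OF rep car(1)[OF a] car(2) fV] by simp
    qed
    thus ?thesis using car by (simp add: app ev cong: sum.cong)
  qed
  show ?thesis
    unfolding expand[OF xy, symmetric] conj_sums_commute[OF G K rep xy fV] expand[OF xy(2) xy(1)]
    by (rule sum.swap)
qed

section \<open>Characters of the normal subgroup of sign changes\<close>

lemma carrier_hyperoctahedral:
  "(f, \<sigma>) \<in> carrier (hyperoctahedral n) \<longleftrightarrow> f \<in> F_pow n \<and> \<sigma> permutes {1..n}"
  by (simp add: hyperoctahedral_def sym_group_def)

lemma hyperoctahedral_cases:
  assumes "x \<in> carrier (hyperoctahedral n)"
  obtains f \<sigma> where "x = (f, \<sigma>)" "f \<in> F_pow n" "\<sigma> permutes {1..n}"
  using assms by (cases x) (simp only: carrier_hyperoctahedral)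

lemma mult_hyperoctahedral:
  "(f, \<sigma>) \<otimes>\<^bsub>hyperoctahedral n\<^esub> (g, \<tau>) = (f + (g \<circ> inv' \<sigma>), \<sigma> \<circ> \<tau>)"
  by (simp add: hyperoctahedral_def sym_group_def)

lemma one_hyperoctahedral: "\<one>\<^bsub>hyperoctahedral n\<^esub> = (0, id)"
  by (simp add: hyperoctahedral_def sym_group_def)

lemma F_pow_comp: "f \<in> F_pow n \<Longrightarrow> \<sigma> permutes {1..n} \<Longrightarrow> f \<circ> \<sigma> \<in> F_pow n"
  by (auto simp: F_pow_def permutes_not_in simp del: atLeastAtMost_iff)

lemma F_pow_add: "f \<in> F_pow n \<Longrightarrow> g \<in> F_pow n \<Longrightarrow> f + g \<in> F_pow n"
  by (simp add: F_pow_def)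

lemma F_pow_0: "0 \<in> F_pow n"
  by (simp add: F_pow_def)

lemma bit_fun_add_self: "f + f = (0 :: 'a \<Rightarrow> bit)"
  by (simp add: fun_eq_iff)

lemma fun_add_comp: "(f + g) \<circ> h = (f \<circ> h) + (g \<circ> h)"
  by (simp add: fun_eq_iff)

lemma inv_hyperoctahedral:
  assumes "f \<in> F_pow n" "\<sigma> permutes {1..n}"
  shows "inv\<^bsub>hyperoctahedral n\<^esub> (f, \<sigma>) = (f \<circ> \<sigma>, inv' \<sigma>)"
proof (rule group.inv_equality[OF group_hyperoctahedral])
  show "(f \<circ> \<sigma>, inv' \<sigma>) \<otimes>\<^bsub>hyperoctahedral n\<^esub> (f, \<sigma>) = \<one>\<^bsub>hyperoctahedral n\<^esub>"
    using assms
    by (simp add: mult_hyperoctahedral one_hyperoctahedral permutes_inv_inv bit_fun_add_self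
        permutes_inv_o)
qed (use assms in \<open>simp_all add: carrier_hyperoctahedral F_pow_comp permutes_inv\<close>)

abbreviation conj_hyp where
  "conj_hyp n a x \<equiv> a \<otimes>\<^bsub>hyperoctahedral n\<^esub> x \<otimes>\<^bsub>hyperoctahedral n\<^esub> inv\<^bsub>hyperoctahedral n\<^esub> a"

lemma conj_hyperoctahedral:
  assumes "p \<in> F_pow n" "\<alpha> permutes {1..n}" "\<sigma> permutes {1..n}"
  shows "conj_hyp n (p, \<alpha>) (f, \<sigma>)
    = (p + (f \<circ> inv' \<alpha>) + (p \<circ> inv' (\<alpha> \<circ> \<sigma> \<circ> inv' \<alpha>)), \<alpha> \<circ> \<sigma> \<circ> inv' \<alpha>)"
proof -
  have b: "bij \<alpha>" "bij \<sigma>" using assms by (auto intro: permutes_bij)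
  have "inv' (\<alpha> \<circ> \<sigma> \<circ> inv' \<alpha>) = \<alpha> \<circ> inv' (\<alpha> \<circ> \<sigma>)"
    using b by (simp add: o_inv_distrib bij_comp bij_imp_bij_inv inv_inv_eq)
  thus ?thesis
    using assms by (simp add: mult_hyperoctahedral inv_hyperoctahedral comp_assoc)
qed

lemma finite_F_pow: "finite (F_pow n)"
proof -
  have "F_pow n = {f. \<forall>i. (i \<in> {1..n} \<longrightarrow> f i \<in> UNIV) \<and> (i \<notin> {1..n} \<longrightarrow> f i = 0)}"
    by (auto simp: F_pow_def)
  moreover have "(UNIV :: bit set) = {0, 1}" by auto
  hence "finite (UNIV :: bit set)" by (metis finite.emptyI finite_insert)
  ultimately show ?thesis by (simp only: finite_set_of_finite_funs finite_atLeastAtMost)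
qed

lemma finite_carrier_hyperoctahedral: "finite (carrier (hyperoctahedral n))"
  by (simp add: hyperoctahedral_def sym_group_def finite_F_pow finite_permutations)

section \<open>The linear characters of \<open>F^n\<close>, indexed by the subsets
  \<open>S\<close>\<close>

definition chi :: "nat set \<Rightarrow> (nat \<Rightarrow> bit) \<Rightarrow> complex"
  where "chi S f = (\<Prod>i\<in>S. if f i = 1 then -1 else 1)"

lemma chi_add: "chi S (f + g) = chi S f * chi S g"
proof -
  have "(if a + b = 1 then -1 else 1) = (if a = 1 then -1 else 1) * (if b = 1 then -1 else 1 :: complex)"
    for a b :: bit by (cases a; cases b) auto
  thus ?thesis by (simp add: chi_def prod.distrib[symmetric])
qed

lemma chi_zero [simp]: "chi S 0 = 1"
  by (simp add: chi_def)

lemma chi_square: "chi S f * chi S f = 1"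
  by (simp add: chi_add[symmetric] bit_fun_add_self)

lemma chi_nonzero: "chi S f \<noteq> 0"
  using chi_square[of S f] by auto

lemma chi_comp:
  assumes "\<alpha> permutes A"
  shows "chi S (f \<circ> \<alpha>) = chi (\<alpha> ` S) f"
  unfolding chi_def using permutes_inj_on[OF assms] by (simp add: prod.reindex)

lemma chi_union: "finite S \<Longrightarrow> finite T \<Longrightarrow> S \<inter> T = {} \<Longrightarrow> chi (S \<union> T) f = chi S f * chi T f"
  by (simp add: chi_def prod.union_disjoint)

text \<open>Orthogonality of characters: translation by the unit vector at a point where
  \<open>S\<close> and \<open>T\<close> differ negates the sum.\<close>

lemma chi_sum:
  assumes S: "S \<subseteq> {1..n}" and T: "T \<subseteq> {1..n}"
  shows "(\<Sum>f\<in>F_pow n. chi S f * chi T f) = (if S = T then of_nat (card (F_pow n)) else 0)"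
proof (cases "S = T")
  case True
  thus ?thesis by (simp add: chi_square)
next
  case False
  then obtain i where i: "i \<in> S \<longleftrightarrow> i \<notin> T" by blast
  hence iin: "i \<in> {1..n}" using S T by blast
  define e where "e = (\<lambda>j. if j = i then 1 else 0 :: bit)"
  have e: "e \<in> F_pow n" using iin by (auto simp: F_pow_def e_def)
  have fin: "finite S" "finite T" using S T by (auto intro: finite_subset)
  have chie: "chi R e = (if i \<in> R then -1 else 1)" if "finite R" for R
  proof -
    have "chi R e = (\<Prod>j\<in>R. if j = i then -1 else 1)"
      unfolding chi_def e_def by (intro prod.cong) auto
    thus ?thesis using that by (simp add: prod.delta)
  qed
  have prod: "chi S e * chi T e = -1" using i by (auto simp: chie fin)
  let ?s = "\<Sum>f\<in>F_pow n. chi S f * chi T f"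
  have "?s = (\<Sum>f\<in>F_pow n. chi S (f + e) * chi T (f + e))"
    by (rule sum.reindex_bij_betw[symmetric], rule bij_betwI[where g = "\<lambda>f. f + e"])
      (auto simp: F_pow_add e add.assoc bit_fun_add_self)
  also have "\<dots> = (\<Sum>f\<in>F_pow n. (chi S e * chi T e) * (chi S f * chi T f))"
    by (simp add: chi_add mult_ac)
  also have "\<dots> = - ?s" by (simp add: prod sum_negf)
  finally show ?thesis using False by simp
qed

section \<open>Passage to the stabiliser of a character\<close>

text \<open>Weighting the conjugacy sums with a character of the sign changes isolates the pairs of
  conjugators that stabilise this character.\<close>

lemma conj_sums_weighted:
  fixes \<pi>0 :: "nat \<Rightarrow> nat"
  assumes K: "K \<subseteq> carrier (hyperoctahedral n)"
    and f: "f \<in> F_pow n" "\<sigma> permutes {1..n}" and g: "g \<in> F_pow n" "\<tau> permutes {1..n}"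
    and S: "S \<subseteq> {1..n}"
  defines "F \<equiv> \<lambda>(h, \<pi>). if \<pi> = \<pi>0 then chi S h else 0"
  shows "(\<Sum>u\<in>F_pow n. \<Sum>v\<in>F_pow n. chi S u * chi S v * (\<Sum>a\<in>K. \<Sum>b\<in>K.
      F (conj_hyp n a (f + u, \<sigma>) \<otimes>\<^bsub>hyperoctahedral n\<^esub> conj_hyp n b (g + v, \<tau>))))
    = of_nat (card (F_pow n)) ^ 2 * (\<Sum>a\<in>K. \<Sum>b\<in>K.
      if snd a ` S = S \<and> (snd (conj_hyp n a (f, \<sigma>)) \<circ> snd b) ` S = S
          \<and> snd (conj_hyp n a (f, \<sigma>) \<otimes>\<^bsub>hyperoctahedral n\<^esub> conj_hyp n b (g, \<tau>)) = \<pi>0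
        then chi S (fst (conj_hyp n a (f, \<sigma>) \<otimes>\<^bsub>hyperoctahedral n\<^esub> conj_hyp n b (g, \<tau>))) else 0)"
proof -
  let ?F = "F_pow n" and ?N = "of_nat (card (F_pow n)) :: complex"
  let ?z = "\<lambda>a b. conj_hyp n a (f, \<sigma>) \<otimes>\<^bsub>hyperoctahedral n\<^esub> conj_hyp n b (g, \<tau>)"
  let ?c = "\<lambda>a b. if snd (?z a b) = \<pi>0 then chi S (fst (?z a b)) else 0"
  let ?A = "\<lambda>a. inv' (snd a) ` S" and ?B = "\<lambda>a b. inv' (snd (conj_hyp n a (f, \<sigma>)) \<circ> snd b) ` S"
  have perm: "snd a permutes {1..n}" "snd (conj_hyp n a (f, \<sigma>)) permutes {1..n}" if aK: "a \<in> K" for a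
  proof -
    obtain p \<alpha> where a: "a = (p, \<alpha>)" "p \<in> F_pow n" "\<alpha> permutes {1..n}"
      by (rule hyperoctahedral_cases[OF subsetD[OF K aK]])
    thus "snd a permutes {1..n}" "snd (conj_hyp n a (f, \<sigma>)) permutes {1..n}"
      using f(2) by (simp_all add: conj_hyperoctahedral permutes_compose permutes_inv)
  qed
  \<comment> \<open>Changing \<open>f\<close> by \<open>u\<close> and \<open>g\<close> by
    \<open>v\<close> multiplies the weight by characters of \<open>u\<close> and \<open>v\<close> on
    sets moved by the conjugators. Orthogonality in \<open>u\<close> and \<open>v\<close> then
    selects the pairs for which these sets are \<open>S\<close> itself.\<close>
  have step: "F (conj_hyp n a (f + u, \<sigma>) \<otimes>\<^bsub>hyperoctahedral n\<^esub> conj_hyp n b (g + v, \<tau>))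
      = ?c a b * (chi (?A a) u * chi (?B a b) v)" if ab: "a \<in> K" "b \<in> K" for a b u v
  proof -
    obtain p \<alpha> where a: "a = (p, \<alpha>)" "p \<in> F_pow n" "\<alpha> permutes {1..n}"
      by (rule hyperoctahedral_cases[OF subsetD[OF K ab(1)]])
    obtain q \<beta> where b: "b = (q, \<beta>)" "q \<in> F_pow n" "\<beta> permutes {1..n}"
      by (rule hyperoctahedral_cases[OF subsetD[OF K ab(2)]])
    let ?s = "\<alpha> \<circ> \<sigma> \<circ> inv' \<alpha>" and ?t = "\<beta> \<circ> \<tau> \<circ> inv' \<beta>"
    have s: "?s permutes {1..n}" using a f by (simp add: permutes_compose permutes_inv)
    have t: "?s \<circ> \<beta> permutes {1..n}" using s b by (simp add: permutes_compose)
    have inv_st: "inv' \<beta> \<circ> inv' ?s = inv' (?s \<circ> \<beta>)"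
      using s b by (simp add: o_inv_distrib permutes_bij)
    have 1: "conj_hyp n a (f + u, \<sigma>) \<otimes>\<^bsub>hyperoctahedral n\<^esub> conj_hyp n b (g + v, \<tau>)
        = (fst (?z a b) + ((u \<circ> inv' \<alpha>) + (v \<circ> inv' (?s \<circ> \<beta>))), snd (?z a b))"
    proof -
      have "?z a b = (p + (f \<circ> inv' \<alpha>) + (p \<circ> inv' ?s), ?s) \<otimes>\<^bsub>hyperoctahedral n\<^esub>
          (q + (g \<circ> inv' \<beta>) + (q \<circ> inv' ?t), ?t)"
        by (simp only: a(1) b(1) conj_hyperoctahedral[OF a(2,3) f(2)] conj_hyperoctahedral[OF b(2,3) g(2)])
      moreover have "conj_hyp n a (f + u, \<sigma>) \<otimes>\<^bsub>hyperoctahedral n\<^esub> conj_hyp n b (g + v, \<tau>)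
          = (p + ((f + u) \<circ> inv' \<alpha>) + (p \<circ> inv' ?s), ?s) \<otimes>\<^bsub>hyperoctahedral n\<^esub>
            (q + ((g + v) \<circ> inv' \<beta>) + (q \<circ> inv' ?t), ?t)"
        by (simp only: a(1) b(1) conj_hyperoctahedral[OF a(2,3) f(2)] conj_hyperoctahedral[OF b(2,3) g(2)])
      ultimately show ?thesis
        unfolding inv_st[symmetric]
        by (simp only: mult_hyperoctahedral fst_conv snd_conv fun_add_comp comp_assoc add_ac)
    qed
    have 2: "snd (conj_hyp n a (f, \<sigma>)) = ?s" unfolding a(1) conj_hyperoctahedral[OF a(2,3) f(2)] by simp
    have 3: "chi S (u \<circ> inv' \<alpha>) = chi (?A a) u" "chi S (v \<circ> inv' (?s \<circ> \<beta>)) = chi (?B a b) v"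
      unfolding 2 using chi_comp[OF permutes_inv[OF a(3)]] chi_comp[OF permutes_inv[OF t]] a b by simp_all
    show ?thesis unfolding 1 F_def by (simp add: chi_add 3)
  qed
  have "(\<Sum>u\<in>?F. \<Sum>v\<in>?F. chi S u * chi S v * (\<Sum>a\<in>K. \<Sum>b\<in>K.
        F (conj_hyp n a (f + u, \<sigma>) \<otimes>\<^bsub>hyperoctahedral n\<^esub> conj_hyp n b (g + v, \<tau>))))
      = (\<Sum>u\<in>?F. \<Sum>v\<in>?F. \<Sum>a\<in>K. \<Sum>b\<in>K. ?c a b * ((chi S u * chi (?A a) u) * (chi S v * chi (?B a b) v)))"
    by (simp add: sum_distrib_left step mult_ac cong: sum.cong)
  also have "\<dots> = (\<Sum>a\<in>K. \<Sum>b\<in>K. \<Sum>u\<in>?F. \<Sum>v\<in>?F. ?c a b * ((chi S u * chi (?A a) u) * (chi S v * chi (?B a b) v)))"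
    by (simp only: sum.swap[of _ K ?F])
  also have "\<dots> = (\<Sum>a\<in>K. \<Sum>b\<in>K. ?c a b *
      ((\<Sum>u\<in>?F. chi S u * chi (?A a) u) * (\<Sum>v\<in>?F. chi S v * chi (?B a b) v)))"
    unfolding sum_product unfolding sum_distrib_left ..
  also have "\<dots> = (\<Sum>a\<in>K. \<Sum>b\<in>K. ?N ^ 2 *
      (if snd a ` S = S \<and> (snd (conj_hyp n a (f, \<sigma>)) \<circ> snd b) ` S = S \<and> snd (?z a b) = \<pi>0
        then chi S (fst (?z a b)) else 0))"
  proof (intro sum.cong refl)
    fix a b assume ab: "a \<in> K" "b \<in> K"
    have eq: "inv' \<pi> ` S \<subseteq> {1..n}" "S = inv' \<pi> ` S \<longleftrightarrow> \<pi> ` S = S" if "\<pi> permutes {1..n}" for \<pi>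
    proof -
      show "inv' \<pi> ` S \<subseteq> {1..n}"
        using S permutes_image[OF permutes_inv[OF that]] by blast
      show "S = inv' \<pi> ` S \<longleftrightarrow> \<pi> ` S = S"
        using permutes_inv_o[OF that] by (metis image_comp image_id id_apply)
    qed
    have t: "snd (conj_hyp n a (f, \<sigma>)) \<circ> snd b permutes {1..n}"
      using perm ab by (intro permutes_compose)
    note eqs = eq[OF perm(1)[OF ab(1)]] eq[OF t]
    show "?c a b * ((\<Sum>u\<in>?F. chi S u * chi (?A a) u) * (\<Sum>v\<in>?F. chi S v * chi (?B a b) v))
      = ?N ^ 2 * (if snd a ` S = S \<and> (snd (conj_hyp n a (f, \<sigma>)) \<circ> snd b) ` S = S \<and> snd (?z a b) = \<pi>0
        then chi S (fst (?z a b)) else 0)"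
      unfolding chi_sum[OF S eqs(1)] chi_sum[OF S eqs(3)] eqs(2,4)
      by (simp add: power2_eq_square)
  qed
  finally show ?thesis by (simp only: sum_distrib_left)
qed

text \<open>Up to a nonzero factor, the weighted sum in the order \<open>x\<close>, \<open>y\<close>
  is \<open>c\<close> times the number of admissible pairs: constancy of the weight excludes
  cancellation, and the given pair makes the count positive. Without admissible pairs in the other
  order, the sum there would be zero.\<close>

theorem strong_gelfand_stabiliser:
  assumes sg: "strong_gelfand_subgroup K (hyperoctahedral n)"
    and x: "x \<in> carrier (hyperoctahedral n)" and y: "y \<in> carrier (hyperoctahedral n)"
    and S: "S \<subseteq> {1..n}" and c: "c \<noteq> 0"
    and const: "\<And>a b. a \<in> K \<Longrightarrow> b \<in> K \<Longrightarrow> snd a ` S = S \<Longrightarrow> (snd (conj_hyp n a x) \<circ> snd b) ` S = S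
      \<Longrightarrow> snd (conj_hyp n a x \<otimes>\<^bsub>hyperoctahedral n\<^esub> conj_hyp n b y) = \<pi>
      \<Longrightarrow> chi S (fst (conj_hyp n a x \<otimes>\<^bsub>hyperoctahedral n\<^esub> conj_hyp n b y)) = c"
    and ex: "a \<in> K" "b \<in> K" "snd a ` S = S" "(snd (conj_hyp n a x) \<circ> snd b) ` S = S"
      "snd (conj_hyp n a x \<otimes>\<^bsub>hyperoctahedral n\<^esub> conj_hyp n b y) = \<pi>"
  shows "\<exists>a\<in>K. \<exists>b\<in>K. snd b ` S = S \<and> (snd (conj_hyp n b y) \<circ> snd a) ` S = S
    \<and> snd (conj_hyp n b y \<otimes>\<^bsub>hyperoctahedral n\<^esub> conj_hyp n a x) = \<pi>"
proof (rule ccontr)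
  let ?H = "hyperoctahedral n" and ?F = "F_pow n"
  assume none: "\<not> ?thesis"
  obtain f \<sigma> where f: "x = (f, \<sigma>)" "f \<in> F_pow n" "\<sigma> permutes {1..n}"
    using x by (rule hyperoctahedral_cases)
  obtain g \<tau> where g: "y = (g, \<tau>)" "g \<in> F_pow n" "\<tau> permutes {1..n}"
    using y by (rule hyperoctahedral_cases)
  have KG: "subgroup K ?H" using sg by (simp add: strong_gelfand_subgroup_def)
  have KH: "K \<subseteq> carrier ?H" using subgroup.subset[OF KG] .
  have finK: "finite K" using KH finite_carrier_hyperoctahedral finite_subset by blast
  define Fn where "Fn = (\<lambda>(h, \<rho>). if \<rho> = \<pi> then chi S h else 0)"
  define L where "L = (\<lambda>a b. snd a ` S = S \<and> (snd (conj_hyp n a x) \<circ> snd b) ` S = S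
      \<and> snd (conj_hyp n a x \<otimes>\<^bsub>?H\<^esub> conj_hyp n b y) = \<pi>)"
  have "(\<Sum>u\<in>?F. \<Sum>v\<in>?F. chi S u * chi S v * (\<Sum>a\<in>K. \<Sum>b\<in>K.
        Fn (conj_hyp n a (f + u, \<sigma>) \<otimes>\<^bsub>?H\<^esub> conj_hyp n b (g + v, \<tau>))))
      = (\<Sum>u\<in>?F. \<Sum>v\<in>?F. chi S u * chi S v * (\<Sum>a\<in>K. \<Sum>b\<in>K.
        Fn (conj_hyp n b (g + v, \<tau>) \<otimes>\<^bsub>?H\<^esub> conj_hyp n a (f + u, \<sigma>))))"
  proof (rule sum.cong[OF refl], rule sum.cong[OF refl], rule arg_cong2[where f = "(*)", OF refl])
    fix u v assume "u \<in> ?F" "v \<in> ?F"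
    hence "(f + u, \<sigma>) \<in> carrier ?H" "(g + v, \<tau>) \<in> carrier ?H"
      using f g by (simp_all only: carrier_hyperoctahedral F_pow_add)
    from strong_gelfand_conj_sums[OF group_hyperoctahedral finite_carrier_hyperoctahedral sg this, of Fn]
    show "(\<Sum>a\<in>K. \<Sum>b\<in>K. Fn (conj_hyp n a (f + u, \<sigma>) \<otimes>\<^bsub>?H\<^esub> conj_hyp n b (g + v, \<tau>)))
      = (\<Sum>a\<in>K. \<Sum>b\<in>K. Fn (conj_hyp n b (g + v, \<tau>) \<otimes>\<^bsub>?H\<^esub> conj_hyp n a (f + u, \<sigma>)))" .
  qed
  \<comment> \<open>Exchanging both pairs of summations gives the form of
    \<open>conj_sums_weighted\<close> with the roles of \<open>x\<close> and \<open>y\<close>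
    interchanged.\<close>
  also have "\<dots> = (\<Sum>v\<in>?F. \<Sum>u\<in>?F. chi S v * chi S u * (\<Sum>b\<in>K. \<Sum>a\<in>K.
        Fn (conj_hyp n b (g + v, \<tau>) \<otimes>\<^bsub>?H\<^esub> conj_hyp n a (f + u, \<sigma>))))"
    by (subst sum.swap, subst sum.swap[of _ K K]) (simp add: mult_ac)
  also have "\<dots> = of_nat (card ?F) ^ 2 * (\<Sum>b\<in>K. \<Sum>a\<in>K. 0)"
    unfolding Fn_def conj_sums_weighted[OF KH g(2,3) f(2,3) S]
    using none by (intro arg_cong2[where f = "(*)"] sum.cong refl if_not_P) (auto simp: f(1) g(1))
  finally have "of_nat (card ?F) ^ 2 * (\<Sum>a\<in>K. \<Sum>b\<in>K. if L a b
      then chi S (fst (conj_hyp n a x \<otimes>\<^bsub>?H\<^esub> conj_hyp n b y)) else 0) = 0"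
    unfolding Fn_def conj_sums_weighted[OF KH f(2,3) g(2,3) S] L_def f(1) g(1) by simp
  moreover have "?F \<noteq> {}" using F_pow_0 by blast
  hence "card ?F \<noteq> 0" using finite_F_pow by simp
  ultimately have "(\<Sum>a\<in>K. \<Sum>b\<in>K. if L a b
      then chi S (fst (conj_hyp n a x \<otimes>\<^bsub>?H\<^esub> conj_hyp n b y)) else 0) = 0" by simp
  also have "(\<Sum>a\<in>K. \<Sum>b\<in>K. if L a b
        then chi S (fst (conj_hyp n a x \<otimes>\<^bsub>?H\<^esub> conj_hyp n b y)) else 0)
      = (\<Sum>a\<in>K. \<Sum>b\<in>K. c * of_nat (of_bool (L a b)))"
    using const by (intro sum.cong refl) (auto simp: L_def)
  also have "\<dots> = c * of_nat (\<Sum>a\<in>K. \<Sum>b\<in>K. of_bool (L a b))"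
    by (simp add: sum_distrib_left)
  finally have "(\<Sum>a\<in>K. \<Sum>b\<in>K. of_bool (L a b) :: nat) = 0"
    using c by (simp only: mult_eq_0_iff of_nat_eq_0_iff simp_thms)
  moreover have "L a b" using ex(3-5) by (simp add: L_def)
  ultimately show False using ex(1,2) finK by (auto simp: sum_eq_0_iff)
qed

section \<open>Subgroups lying over the alternating group\<close>

definition parity :: "nat \<Rightarrow> (nat \<Rightarrow> bit) \<Rightarrow> bit"
  where "parity n f = (\<Sum>i\<in>{1..n}. f i)"

definition sign_changes :: "((nat \<Rightarrow> bit) \<times> (nat \<Rightarrow> nat)) set \<Rightarrow> (nat \<Rightarrow> bit) set"
  where "sign_changes K = {f. (f, id) \<in> K}"

definition pair_vector :: "nat \<Rightarrow> nat \<Rightarrow> nat \<Rightarrow> bit"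
  where "pair_vector i j = (\<lambda>k. if k = i \<or> k = j then 1 else 0)"

lemma parity_add: "parity n (f + g) = parity n f + parity n g"
  unfolding parity_def plus_fun_apply sum.distrib ..

lemma parity_comp: "\<sigma> permutes {1..n} \<Longrightarrow> parity n (f \<circ> \<sigma>) = parity n f"
  using sum.permute[of \<sigma> "{1..n}" f] by (simp add: parity_def)

lemma parity_comp_inv: "\<sigma> permutes {1..n} \<Longrightarrow> parity n (f \<circ> inv' \<sigma>) = parity n f"
  by (intro parity_comp permutes_inv)

lemma of_nat_bit: "(of_nat k :: bit) = of_bool (odd k)"
  by (induction k) auto

lemma parity_eq_card:
  assumes "f \<in> F_pow n"
  shows "parity n f = of_bool (odd (card {i. f i = 1}))"
proof -
  have "{i. f i = 1} = {1..n} \<inter> {i. f i = 1}"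
    using assms by (auto simp: F_pow_def simp del: atLeastAtMost_iff)
  moreover have "parity n f = (\<Sum>i\<in>{1..n}. of_bool (f i = 1))"
    unfolding parity_def by (intro sum.cong) (auto simp: of_bool_def)
  ultimately show ?thesis
    by (simp only: sum_of_bool_eq finite_atLeastAtMost of_nat_bit)
qed

lemma stembridge_subgroup_iff:
  "(f, \<sigma>) \<in> stembridge_subgroup n \<longleftrightarrow> f \<in> F_pow n \<and> \<sigma> \<in> carrier (alt_group n) \<and> parity n f = 0"
proof -
  have sgn: "(-1 :: complex) ^ k = 1 \<longleftrightarrow> even k" for k
    by (cases "even k") auto
  have "(f, \<sigma>) \<in> stembridge_subgroup n \<longleftrightarrow> f \<in> F_pow n \<and> \<sigma> permutes {1..n} \<and> evenperm \<sigma>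
      \<and> even (card {i. f i = 1})"
    unfolding stembridge_subgroup_def kernel_def complex_units_def eps_char_def delta_char_def
    by (simp add: carrier_hyperoctahedral sign_def sgn) blast
  moreover have "parity n f = 0 \<longleftrightarrow> even (card {i. f i = 1})" if "f \<in> F_pow n"
    unfolding parity_eq_card[OF that] by simp
  ultimately show ?thesis unfolding alt_group_carrier by blast
qed

section \<open>Three-cycles as generators of the alternating group\<close>

lemma cycle3_apply:
  assumes "distinct [i, j, k]"
  shows "cycle_of_list [i, j, k] i = j" "cycle_of_list [i, j, k] j = k" "cycle_of_list [i, j, k] k = i"
    "x \<notin> {i, j, k} \<Longrightarrow> cycle_of_list [i, j, k] x = x"
  using assms by (auto simp: transpose_def)

lemma cycle3_alt:
  assumes "distinct [i, j, k]" "{i, j, k} \<subseteq> {1..n}"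
  shows "cycle_of_list [i, j, k] \<in> carrier (alt_group n)"
proof -
  have "cycle_of_list [i, j, k] \<in> three_cycles n"
    using assms by (auto intro!: exI[of _ "[i, j, k]"])
  thus ?thesis using three_cycles_incl by blast
qed

lemma alt_group_comp: "\<sigma> \<in> carrier (alt_group n) \<Longrightarrow> \<tau> \<in> carrier (alt_group n) \<Longrightarrow> \<sigma> \<circ> \<tau> \<in> carrier (alt_group n)"
  using group.is_monoid[OF alt_group_is_group, THEN monoid.m_closed, unfolded alt_group_mult] .

text \<open>The intermediate permutations are known to be even, so that in applications they can be
  lifted to \<open>K\<close>.\<close>

lemma alt_group_induct [consumes 1, case_names id cycle inv comp]:
  assumes \<sigma>: "\<sigma> \<in> carrier (alt_group n)" and id: "P id"
    and cycle: "\<And>i j k. distinct [i, j, k] \<Longrightarrow> {i, j, k} \<subseteq> {1..n} \<Longrightarrow> P (cycle_of_list [i, j, k])"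
    and inv: "\<And>\<sigma>. \<sigma> \<in> carrier (alt_group n) \<Longrightarrow> P \<sigma> \<Longrightarrow> P (inv' \<sigma>)"
    and comp: "\<And>\<sigma> \<tau>. \<sigma> \<in> carrier (alt_group n) \<Longrightarrow> \<tau> \<in> carrier (alt_group n) \<Longrightarrow> P \<sigma> \<Longrightarrow> P \<tau> \<Longrightarrow> P (\<sigma> \<circ> \<tau>)"
  shows "P \<sigma>"
proof -
  have cyc: "P \<tau>" if \<tau>: "\<tau> \<in> three_cycles n" for \<tau>
  proof -
    obtain cs where cs: "\<tau> = cycle_of_list cs" "distinct cs" "length cs = 3" "set cs \<subseteq> {1..n}"
      using \<tau> by blast
    then obtain i j k where "cs = [i, j, k]" using stupid_lemma by metis
    thus ?thesis using cs cycle by simp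
  qed
  have "\<sigma> \<in> generate (alt_group n) (three_cycles n)"
    using \<sigma> alt_group_carrier_as_three_cycles by blast
  thus ?thesis
  proof (induction rule: generate.induct)
    case one
    show ?case unfolding alt_group_one by (rule id)
  next
    case (incl h)
    thus ?case by (rule cyc)
  next
    case (inv h)
    hence "h \<in> carrier (alt_group n)" using three_cycles_incl by blast
    thus ?case using assms(4) cyc[OF inv] alt_group_inv_equality by simp
  next
    case (eng h1 h2)
    show ?case
      unfolding alt_group_mult
      by (rule comp) (use eng in \<open>simp_all only: alt_group_carrier_as_three_cycles[symmetric]\<close>)
  qed
qed

lemma sum_123: "(\<Sum>i\<in>{1, 2, 3 :: nat}. h i) = (h 1 + h 2 + h 3 :: 'a :: comm_monoid_add)"
  by (simp add: add_ac)

lemma bit_fun_cancel: "(f + g) + (g + h) = f + (h :: 'a \<Rightarrow> bit)"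
  by (metis add.assoc add_0_left bit_fun_add_self)

lemma zero_comp_fun: "(0 :: 'b \<Rightarrow> 'c :: zero) \<circ> f = 0"
  by (simp add: fun_eq_iff)

section \<open>Sign changes as a module under the even permutations\<close>

locale over_alternating =
  fixes n :: nat and K :: "((nat \<Rightarrow> bit) \<times> (nat \<Rightarrow> nat)) set"
  assumes n3: "n \<ge> 3" and sub: "subgroup K (hyperoctahedral n)"
    and snd_K: "snd ` K = carrier (alt_group n)"
begin

lemma K_closed: "x \<in> K \<Longrightarrow> y \<in> K \<Longrightarrow> x \<otimes>\<^bsub>hyperoctahedral n\<^esub> y \<in> K"
  using sub by (rule subgroup.m_closed)

lemma K_inv: "x \<in> K \<Longrightarrow> inv\<^bsub>hyperoctahedral n\<^esub> x \<in> K"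
  using sub by (rule subgroup.m_inv_closed)

lemma K_D:
  assumes "(f, \<sigma>) \<in> K"
  shows "f \<in> F_pow n" "\<sigma> permutes {1..n}" "\<sigma> \<in> carrier (alt_group n)"
proof -
  have "(f, \<sigma>) \<in> carrier (hyperoctahedral n)" using assms subgroup.subset[OF sub] by blast
  thus "f \<in> F_pow n" "\<sigma> permutes {1..n}" by (simp_all add: carrier_hyperoctahedral)
  show "\<sigma> \<in> carrier (alt_group n)" using assms snd_K by force
qed

lemma K_lift: "\<sigma> \<in> carrier (alt_group n) \<Longrightarrow> \<exists>f. (f, \<sigma>) \<in> K"
  using snd_K by force

lemma alt_permutes: "\<sigma> \<in> carrier (alt_group n) \<Longrightarrow> \<sigma> permutes {1..n}"
  by (simp add: alt_group_carrier)

lemma zero_sign_changes: "0 \<in> sign_changes K"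
  using subgroup.one_closed[OF sub] by (simp add: sign_changes_def one_hyperoctahedral)

lemma sign_changes_mult: "f \<in> sign_changes K \<Longrightarrow> (g, \<sigma>) \<in> K \<Longrightarrow> (f + g, \<sigma>) \<in> K"
  using K_closed[of "(f, id)" "(g, \<sigma>)"] by (simp add: sign_changes_def mult_hyperoctahedral)

lemma sign_changes_add: "f \<in> sign_changes K \<Longrightarrow> g \<in> sign_changes K \<Longrightarrow> f + g \<in> sign_changes K"
  using sign_changes_mult[of f g id] by (simp add: sign_changes_def)

text \<open>In characteristic 2 the sum of two lifts is their difference: lifts of the same
  permutation differ by a sign change in \<open>K\<close>.\<close>

lemma sign_changes_quotient:
  assumes "(f, \<sigma>) \<in> K" "(g, \<sigma>) \<in> K"
  shows "f + g \<in> sign_changes K"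
proof -
  note g = K_D(1,2)[OF assms(2)]
  have "(f, \<sigma>) \<otimes>\<^bsub>hyperoctahedral n\<^esub> inv\<^bsub>hyperoctahedral n\<^esub> (g, \<sigma>) \<in> K"
    using assms K_closed K_inv by blast
  moreover have "g \<circ> \<sigma> \<circ> inv' \<sigma> = g" using g by (simp add: comp_assoc permutes_inv_o)
  ultimately show ?thesis
    using g by (simp add: inv_hyperoctahedral mult_hyperoctahedral sign_changes_def permutes_inv_o)
qed

text \<open>Conjugate by any lift of the inverse of \<open>\<alpha>\<close>; its sign part
  \<open>p\<close> occurs twice and cancels.\<close>

lemma sign_changes_comp:
  assumes f: "f \<in> sign_changes K" and \<alpha>: "\<alpha> \<in> carrier (alt_group n)"
  shows "f \<circ> \<alpha> \<in> sign_changes K"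
proof -
  have "inv' \<alpha> \<in> carrier (alt_group n)" using \<alpha> by (rule alt_group_inv_closed)
  then obtain p where p: "(p, inv' \<alpha>) \<in> K" using K_lift by blast
  note P = K_D(1,2)[OF p]
  have "conj_hyp n (p, inv' \<alpha>) (f, id) \<in> K"
    using p f K_closed K_inv by (simp add: sign_changes_def)
  moreover have "inv' (inv' \<alpha>) = \<alpha>" using alt_permutes[OF \<alpha>] by (rule permutes_inv_inv)
  moreover have "inv' \<alpha> \<circ> \<alpha> = id" using alt_permutes[OF \<alpha>] by (simp add: permutes_inv_o)
  ultimately have "(p + (f \<circ> \<alpha>) + p, id) \<in> K"
    using conj_hyperoctahedral[OF P permutes_id, of f] by simp
  moreover have "p + (f \<circ> \<alpha>) + p = f \<circ> \<alpha>" by (simp add: fun_eq_iff)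
  ultimately show ?thesis by (simp add: sign_changes_def)
qed

lemma pair_vector_comp:
  assumes "distinct [i, j, k]"
  shows "pair_vector i j \<circ> cycle_of_list [i, j, k] = pair_vector i k"
proof
  fix x
  consider "x = i" | "x = j" | "x = k" | "x \<notin> {i, j, k}" by blast
  thus "(pair_vector i j \<circ> cycle_of_list [i, j, k]) x = pair_vector i k x"
    using assms cycle3_apply[OF assms] by cases (auto simp: pair_vector_def)
qed

lemma pair_vector_move:
  assumes "pair_vector i j \<in> sign_changes K" "distinct [i, j, k]" "{i, j, k} \<subseteq> {1..n}"
  shows "pair_vector i k \<in> sign_changes K"
  using sign_changes_comp[OF assms(1) cycle3_alt[OF assms(2,3)]] pair_vector_comp[OF assms(2)] by simp

text \<open>Three-cycles replace one endpoint of a pair at a time, which is enough to reach every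
  pair.\<close>

lemma pair_vector_all:
  assumes ij: "pair_vector i j \<in> sign_changes K" "i \<noteq> j" "{i, j} \<subseteq> {1..n}"
    and st: "s \<noteq> t" "{s, t} \<subseteq> {1..n}"
  shows "pair_vector s t \<in> sign_changes K"
proof -
  have sym: "pair_vector a b = pair_vector b a" for a b by (auto simp: pair_vector_def)
  have move: "pair_vector a c \<in> sign_changes K"
    if "pair_vector a b \<in> sign_changes K" "a \<noteq> b" "a \<noteq> c" "{a, b, c} \<subseteq> {1..n}" for a b c
    using pair_vector_move[of a b c] that by (cases "b = c") auto
  show ?thesis
  proof (cases "s = i")
    case True
    thus ?thesis using move[of i j t] ij st by simp
  next
    case False
    hence "pair_vector s i \<in> sign_changes K" using move[of i j s] ij st sym by simp
    thus ?thesis using move[of s i t] False ij st by simp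
  qed
qed

text \<open>Even vectors are sums of pair vectors: adding a pair inside the support removes two of
  its points.\<close>

lemma even_sign_changes:
  assumes pairs: "\<And>s t. s \<noteq> t \<Longrightarrow> {s, t} \<subseteq> {1..n} \<Longrightarrow> pair_vector s t \<in> sign_changes K"
    and f: "f \<in> F_pow n" "parity n f = 0"
  shows "f \<in> sign_changes K"
  using f
proof (induction "card {i. f i = 1}" arbitrary: f rule: less_induct)
  case less
  have supp: "{i. f i = 1} \<subseteq> {1..n}" using less.prems(1) by (fastforce simp: F_pow_def)
  hence fin: "finite {i. f i = 1}" by (rule finite_subset) simp
  show ?case
  proof (cases "{i. f i = 1} = {}")
    case True
    hence "f = 0" by (auto simp: fun_eq_iff)
    thus ?thesis using zero_sign_changes by simp
  next
    case False
    then obtain i where i: "f i = 1" by blast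
    have "even (card {i. f i = 1})" using less.prems parity_eq_card[of f n] by simp
    hence "card {i. f i = 1} \<noteq> 1" by (metis odd_one)
    hence "{i. f i = 1} \<noteq> {i}" by (metis is_singletonI is_singleton_altdef)
    then obtain j where j: "f j = 1" "j \<noteq> i" using i by blast
    define g where "g = f + pair_vector i j"
    have pv: "pair_vector i j \<in> sign_changes K" by (rule pairs) (use i j supp in auto)
    hence pvF: "pair_vector i j \<in> F_pow n" using K_D(1) by (auto simp: sign_changes_def)
    have "{k. g k = 1} = {k. f k = 1} - {i, j}"
      using i j by (auto simp: g_def pair_vector_def split: if_splits)
    hence "card {k. g k = 1} < card {k. f k = 1}"
      using i fin by (metis (mono_tags, lifting) Diff_iff Diff_subset insertI1 mem_Collect_eq
          psubsetI psubset_card_mono)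
    moreover have "g \<in> F_pow n" using less.prems(1) pvF by (simp add: g_def F_pow_add)
    moreover have "parity n (pair_vector i j) = 0"
    proof -
      have "{k. pair_vector i j k = 1} = {i, j}" by (auto simp: pair_vector_def)
      thus ?thesis using parity_eq_card[OF pvF] j(2) by simp
    qed
    hence "parity n g = 0" using less.prems(2) by (simp add: g_def parity_add)
    ultimately have "g \<in> sign_changes K" by (rule less.hyps)
    from sign_changes_add[OF this pv] show ?thesis
      by (simp add: g_def add.assoc bit_fun_add_self)
  qed
qed

text \<open>A nonconstant sign change, compared with its translate by one three-cycle, yields a pair
  vector; one pair vector yields all, and these span the even vectors.\<close>

lemma sign_changes_dichotomy:
  "sign_changes K \<subseteq> diag_F n \<or> (\<forall>f\<in>F_pow n. parity n f = 0 \<longrightarrow> f \<in> sign_changes K)"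
proof (cases "sign_changes K \<subseteq> diag_F n")
  case False
  then obtain f where f: "f \<in> sign_changes K" "f \<notin> diag_F n" by blast
  moreover have "f \<in> F_pow n" using f(1) K_D(1) by (auto simp: sign_changes_def)
  ultimately obtain i j where ij: "i \<in> {1..n}" "j \<in> {1..n}" "f i \<noteq> f j"
    unfolding diag_F_def by blast
  have "\<not> {1..n} \<subseteq> {i, j}"
  proof
    assume "{1..n} \<subseteq> {i, j}"
    hence "card {1..n} \<le> card {i, j}" by (intro card_mono) auto
    thus False using n3 card_insert_le_m1[of 2 "{j}" i] by simp
  qed
  then obtain k where k: "k \<in> {1..n}" "k \<noteq> i" "k \<noteq> j" by blast
  have d: "distinct [i, j, k]" using ij k by auto
  let ?c = "cycle_of_list [i, j, k]"
  have c: "?c \<in> carrier (alt_group n)" using cycle3_alt[OF d] ij k by simp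
  \<comment> \<open>\<open>g\<close> is supported on \<open>i\<close>, \<open>j\<close>,
    \<open>k\<close>; its three values add up to 0 and the value at \<open>i\<close> is 1, so
    exactly one of the other two is 1.\<close>
  define g where "g = f + (f \<circ> ?c)"
  have g: "g \<in> sign_changes K" unfolding g_def by (intro sign_changes_add sign_changes_comp f(1) c)
  have gv: "g i = f i + f j" "g j = f j + f k" "g k = f k + f i" "\<And>x. x \<notin> {i, j, k} \<Longrightarrow> g x = 0"
    using cycle3_apply[OF d] by (simp_all add: g_def)
  have neq: "a + b = 1" if "a \<noteq> b" for a b :: bit using that by (cases a; cases b) auto
  have "pair_vector i j \<in> sign_changes K \<or> pair_vector i k \<in> sign_changes K"
  proof (cases "f k = f i")
    case True
    have "g x = pair_vector i j x" for x
    proof (cases "x \<in> {i, j, k}")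
      case x: True
      have "g i = 1" using gv(1) neq[OF ij(3)] by (rule trans)
      moreover have "g j = 1" using gv(2) neq[OF ij(3)[symmetric]] unfolding True by (rule trans)
      moreover have "g k = 0" using gv(3) True by simp
      ultimately show ?thesis using x d by (auto simp: pair_vector_def)
    qed (simp add: gv(4) pair_vector_def)
    hence "g = pair_vector i j" ..
    thus ?thesis using g by simp
  next
    case False
    have kj: "f k = f j" using False ij(3) by (cases "f i"; cases "f j"; cases "f k") simp_all
    have "g x = pair_vector i k x" for x
    proof (cases "x \<in> {i, j, k}")
      case x: True
      have "g i = 1" using gv(1) neq[OF ij(3)] by (rule trans)
      moreover have "g j = 0" using gv(2) kj by simp
      moreover have "g k = 1" using gv(3) neq[OF False] by (rule trans)
      ultimately show ?thesis using x d by (auto simp: pair_vector_def)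
    qed (simp add: gv(4) pair_vector_def)
    hence "g = pair_vector i k" ..
    thus ?thesis using g by simp
  qed
  then obtain a b where "pair_vector a b \<in> sign_changes K" "a \<noteq> b" "{a, b} \<subseteq> {1..n}"
    using ij k by blast
  note pairs = pair_vector_all[OF this]
  have "\<forall>f\<in>F_pow n. parity n f = 0 \<longrightarrow> f \<in> sign_changes K"
    using even_sign_changes[OF pairs] by simp
  thus ?thesis ..
qed simp

lemma K_eq_if_same_sign_changes:
  assumes "\<And>f. f \<in> F_pow n \<Longrightarrow> f \<in> sign_changes K"
  shows "K = wreath_alt n"
proof
  show "K \<subseteq> wreath_alt n" using K_D(1,3) unfolding wreath_alt_def by (intro subrelI SigmaI)
  show "wreath_alt n \<subseteq> K"
  proof (clarsimp simp: wreath_alt_def)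
    fix f \<sigma> assume f: "f \<in> F_pow n" and "\<sigma> \<in> carrier (alt_group n)"
    then obtain g where g: "(g, \<sigma>) \<in> K" using K_lift by blast
    have "f + g \<in> sign_changes K" by (rule assms[OF F_pow_add[OF f K_D(1)[OF g]]])
    from sign_changes_mult[OF this g] show "(f, \<sigma>) \<in> K"
      by (simp add: add.assoc bit_fun_add_self)
  qed
qed

text \<open>When all sign changes in \<open>K\<close> are even, parity depends only on the
  permutation and is a homomorphism from the alternating group to a group of order 2. Such a
  homomorphism is trivial on the generators, because three-cycles have odd order.\<close>

lemma even_K:
  assumes even: "\<And>f. f \<in> sign_changes K \<Longrightarrow> parity n f = 0" and K: "(f, \<sigma>) \<in> K"
  shows "parity n f = 0"
proof -
  have "\<forall>f. (f, \<sigma>) \<in> K \<longrightarrow> parity n f = 0" using K_D(3)[OF K]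
  proof (induction rule: alt_group_induct)
    case id
    thus ?case using even unfolding sign_changes_def by blast
  next
    case (cycle i j k)
    let ?c = "cycle_of_list [i, j, k]"
    show ?case
    proof (intro allI impI)
      fix f assume f: "(f, ?c) \<in> K"
      note F = K_D(1,2)[OF f]
      have "?c \<circ> ?c \<circ> ?c = id"
      proof
        fix x
        consider "x = i" | "x = j" | "x = k" | "x \<notin> {i, j, k}" by blast
        thus "(?c \<circ> ?c \<circ> ?c) x = id x"
          using cycle3_apply[OF cycle(1)] by cases (simp_all del: cycle_of_list.simps)
      qed
      moreover have "(f, ?c) \<otimes>\<^bsub>hyperoctahedral n\<^esub> (f, ?c) \<otimes>\<^bsub>hyperoctahedral n\<^esub> (f, ?c) \<in> K"
        using f K_closed by blast
      ultimately have "f + (f \<circ> inv' ?c) + (f \<circ> inv' (?c \<circ> ?c)) \<in> sign_changes K"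
        by (simp add: mult_hyperoctahedral sign_changes_def del: cycle_of_list.simps)
      hence "parity n (f + (f \<circ> inv' ?c) + (f \<circ> inv' (?c \<circ> ?c))) = 0" by (rule even)
      hence "parity n f + parity n f + parity n f = 0"
        unfolding parity_add parity_comp_inv[OF F(2)] parity_comp_inv[OF permutes_compose[OF F(2) F(2)]] .
      thus "parity n f = 0" by (cases "parity n f") simp_all
    qed
  next
    case (inv \<sigma>)
    show ?case
    proof (intro allI impI)
      fix f assume f: "(f, inv' \<sigma>) \<in> K"
      note F = K_D(1,2)[OF f]
      have "(f \<circ> inv' \<sigma>, \<sigma>) \<in> K"
        using K_inv[OF f] inv_hyperoctahedral[OF F] permutes_inv_inv[OF alt_permutes[OF inv(1)]] by simp
      hence "parity n (f \<circ> inv' \<sigma>) = 0" using inv(2) by blast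
      thus "parity n f = 0" using parity_comp[OF F(2)] by simp
    qed
  next
    case (comp \<sigma> \<tau>)
    show ?case
    proof (intro allI impI)
      fix f assume f: "(f, \<sigma> \<circ> \<tau>) \<in> K"
      obtain g where g: "(g, \<sigma>) \<in> K" using K_lift[OF comp(1)] ..
      obtain h where h: "(h, \<tau>) \<in> K" using K_lift[OF comp(2)] ..
      have "(g + (h \<circ> inv' \<sigma>), \<sigma> \<circ> \<tau>) \<in> K"
        using K_closed[OF g h] by (simp add: mult_hyperoctahedral)
      from even[OF sign_changes_quotient[OF f this]]
      have "parity n f + (parity n g + parity n h) = 0"
        unfolding parity_add parity_comp_inv[OF alt_permutes[OF comp(1)]] .
      thus "parity n f = 0" using comp(3,4) g h by simp
    qed
  qed
  thus ?thesis using K by blast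
qed

text \<open>Once all even sign changes are present, a single odd one gives all of
  \<open>F^n\<close>; if there is none, \<open>even_K\<close> bounds \<open>K\<close> from
  above.\<close>

lemma trichotomy:
  "sign_changes K \<subseteq> diag_F n \<or> K = wreath_alt n \<or> K = stembridge_subgroup n"
proof (cases "sign_changes K \<subseteq> diag_F n")
  case False
  hence ev: "\<And>f. f \<in> F_pow n \<Longrightarrow> parity n f = 0 \<Longrightarrow> f \<in> sign_changes K"
    using sign_changes_dichotomy by blast
  have "K = wreath_alt n \<or> K = stembridge_subgroup n"
  proof (cases "\<forall>f\<in>sign_changes K. parity n f = 0")
    case True
    have "x \<in> K \<longleftrightarrow> x \<in> stembridge_subgroup n" for x
    proof -
      obtain f \<sigma> where x: "x = (f, \<sigma>)" by force
      have "(f, \<sigma>) \<in> K" if f: "f \<in> F_pow n" "parity n f = 0" "\<sigma> \<in> carrier (alt_group n)"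
      proof -
        obtain g where g: "(g, \<sigma>) \<in> K" using K_lift[OF f(3)] ..
        have "parity n g = 0" by (rule even_K[OF _ g]) (use True in blast)
        hence "parity n (f + g) = 0" unfolding parity_add f(2) by simp
        hence "f + g \<in> sign_changes K" by (rule ev[OF F_pow_add[OF f(1) K_D(1)[OF g]]])
        from sign_changes_mult[OF this g] show ?thesis by (simp add: add.assoc bit_fun_add_self)
      qed
      moreover have "f \<in> F_pow n \<and> \<sigma> \<in> carrier (alt_group n) \<and> parity n f = 0" if "(f, \<sigma>) \<in> K"
        using K_D(1,3)[OF that] even_K[rule_format, OF _ that] True by simp
      ultimately show ?thesis unfolding x stembridge_subgroup_iff by blast
    qed
    thus ?thesis by blast
  next
    case False
    then obtain m where m: "m \<in> sign_changes K" "parity n m \<noteq> 0" by blast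
    have mF: "m \<in> F_pow n" using m K_D(1) by (auto simp: sign_changes_def)
    have "f \<in> sign_changes K" if f: "f \<in> F_pow n" for f
    proof (cases "parity n f = 0")
      case True
      thus ?thesis using ev f by blast
    next
      case odd: False
      hence "parity n (f + m) = 0"
        using m(2) unfolding parity_add by (cases "parity n f"; cases "parity n m") simp_all
      hence "f + m \<in> sign_changes K" by (rule ev[OF F_pow_add[OF f mF]])
      from sign_changes_add[OF this m(1)] show ?thesis by (simp add: add.assoc bit_fun_add_self)
    qed
    thus ?thesis by (intro disjI1 K_eq_if_same_sign_changes)
  qed
  thus ?thesis by simp
qed simp

text \<open>An even lift \<open>(f, c)\<close> of the three-cycle is conjugate to
  \<open>(0, c)\<close> by a sign change, because every even vector has the form
  \<open>g + (g \<circ> inv' c)\<close>. As \<open>c\<close> generates \<open>A_3\<close>, the same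
  \<open>g\<close> straightens all of \<open>K\<close>.\<close>

lemma conjugate_of_diagonal:
  assumes n: "n = 3" and diag: "sign_changes K \<subseteq> diag_F n"
  shows "conjugate_in (hyperoctahedral n) (diag_alt 3) K \<or> conjugate_in (hyperoctahedral n) (alt_copy 3) K"
proof -
  let ?H = "hyperoctahedral n" and ?c = "cycle_of_list [1, 2, 3 :: nat]"
  have d: "distinct [1, 2, 3 :: nat]" by simp
  have set3: "{1..n} = {1, 2, 3}" using n by auto
  have c: "?c \<in> carrier (alt_group n)" by (rule cycle3_alt[OF d]) (simp add: n)
  have cv: "?c 1 = 2" "?c 2 = 3" "?c 3 = 1" using cycle3_apply[OF d] by auto
  have cp: "?c permutes {1..n}" using c by (rule alt_permutes)
  have ci: "inv' ?c 2 = 1" "inv' ?c 3 = 2" "inv' ?c 1 = 3"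
    using cv permutes_inv_eq[OF cp] by simp_all
  define ones where "ones = (\<lambda>i. if i \<in> {1..n} then 1 else 0 :: bit)"
  have diag_eq: "f = 0 \<or> f = ones" if f: "f \<in> diag_F n" for f
  proof -
    have one_in: "1 \<in> {1..n}" using n by simp
    have "\<forall>i\<in>{1..n}. \<forall>j\<in>{1..n}. f i = f j" "f \<in> F_pow n"
      using f unfolding diag_F_def by blast+
    hence f1: "f i = f 1" if "i \<in> {1..n}" for i using one_in that by blast
    have f0: "f i = 0" if "i \<notin> {1..n}" for i
      using \<open>f \<in> F_pow n\<close> that unfolding F_pow_def by blast
    show ?thesis
    proof (cases "f 1 = 0")
      case True
      hence "f i = 0" for i using f0 f1 by (cases "i \<in> {1..n}") metis+
      thus ?thesis by (simp add: fun_eq_iff)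
    next
      case False
      hence "f 1 = 1" by (simp only: bit_not_zero_iff)
      hence "f i = ones i" for i unfolding ones_def using f0 f1 by (cases "i \<in> {1..n}") metis+
      hence "f = ones" ..
      thus ?thesis ..
    qed
  qed
  have par3: "parity n f = f 1 + f 2 + f 3" for f
    unfolding parity_def set3 by (rule sum_123)
  obtain f0 where f0: "(f0, ?c) \<in> K" using K_lift c by blast
  \<comment> \<open>If the vector \<open>ones\<close> is available, it corrects the parity, since 3
    is odd. Otherwise the cube of the lift is a sign change in \<open>K\<close> and hence trivial,
    and its value at 1 is the parity of \<open>f0\<close>.\<close>
  have "\<exists>f. (f, ?c) \<in> K \<and> parity n f = 0"
  proof (cases "ones \<in> sign_changes K")
    case True
    have "ones 1 = 1" "ones 2 = 1" "ones 3 = 1" by (simp_all add: ones_def n)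
    hence p1: "parity n ones = 1" unfolding par3 by simp
    have "parity n f0 = 0 \<or> parity n (ones + f0) = 0"
      unfolding parity_add p1 by (cases "parity n f0") simp_all
    thus ?thesis using f0 sign_changes_mult[OF True f0] by blast
  next
    case False
    let ?s = "f0 + (f0 \<circ> inv' ?c) + (f0 \<circ> inv' (?c \<circ> ?c))"
    have "?c \<circ> ?c \<circ> ?c = id"
    proof
      fix x :: nat
      consider "x = 1" | "x = 2" | "x = 3" | "x \<notin> {1, 2, 3}" by blast
      thus "(?c \<circ> ?c \<circ> ?c) x = id x"
        using cycle3_apply[OF d] by cases (simp_all del: cycle_of_list.simps)
    qed
    moreover have "(f0, ?c) \<otimes>\<^bsub>?H\<^esub> (f0, ?c) \<otimes>\<^bsub>?H\<^esub> (f0, ?c) \<in> K" using f0 K_closed by blast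
    ultimately have s: "?s \<in> sign_changes K"
      by (simp add: mult_hyperoctahedral sign_changes_def del: cycle_of_list.simps)
    hence "?s = 0" using False diag diag_eq by blast
    hence "?s 1 = 0" by (simp only: zero_fun_apply)
    moreover have "inv' (?c \<circ> ?c) = inv' ?c \<circ> inv' ?c" using cp by (simp only: o_inv_distrib permutes_bij)
    ultimately have "f0 1 + f0 3 + f0 2 = 0"
      using ci by (simp only: plus_fun_apply comp_apply)
    hence "parity n f0 = 0" unfolding par3 by (simp only: add_ac)
    thus ?thesis using f0 by blast
  qed
  then obtain f where f: "(f, ?c) \<in> K" "parity n f = 0" by blast
  \<comment> \<open>Solves \<open>g i + g (inv' c i) = f i\<close>, normalised by
    \<open>g 1 = 0\<close>: the equations at 2 and 3 determine \<open>g\<close>, and the one at 1 is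
    the parity condition on \<open>f\<close>.\<close>
  define g where "g = (\<lambda>i :: nat. if i = 2 then f 2 else if i = 3 then f 2 + f 3 else 0 :: bit)"
  have gF: "g \<in> F_pow n" by (auto simp: F_pow_def g_def n)
  let ?x = "(g, id) :: (nat \<Rightarrow> bit) \<times> (nat \<Rightarrow> nat)"
  have x: "?x \<in> carrier ?H" using gF by (simp add: carrier_hyperoctahedral permutes_id)
  have cx: "conj_hyp n ?x (h, \<sigma>) = (g + h + (g \<circ> inv' \<sigma>), \<sigma>)" if "\<sigma> permutes {1..n}" for h \<sigma>
    using conj_hyperoctahedral[OF gF permutes_id that] by simp
  have fc: "conj_hyp n ?x (0, ?c) = (f, ?c)"
  proof -
    have "g i + g (inv' ?c i) = f i" for i
    proof -
      consider "i = 1" | "i = 2" | "i = 3" | "i \<notin> {1..n}" using set3 by blast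
      thus ?thesis
      proof cases
        case 1
        have "f 1 + f 2 + f 3 = 0" using f(2) unfolding par3 .
        hence "f 1 = f 2 + f 3" by (cases "f 1"; cases "f 2"; cases "f 3") simp_all
        moreover have "g 1 = 0" "g 3 = f 2 + f 3" by (simp_all add: g_def)
        ultimately show ?thesis unfolding 1 ci by simp
      next
        case 2
        have "g 1 = 0" "g 2 = f 2" by (simp_all add: g_def)
        thus ?thesis unfolding 2 ci by simp
      next
        case 3
        have "g 2 = f 2" "g 3 = f 2 + f 3" by (simp_all add: g_def)
        hence "g 3 + g 2 = f 3" by (cases "f 2"; cases "f 3") simp_all
        thus ?thesis unfolding 3 ci .
      next
        case 4
        hence "inv' ?c i = i" by (intro permutes_not_in[OF permutes_inv[OF cp]])
        moreover have "f i = 0" using K_D(1)[OF f(1)] 4 unfolding F_pow_def by blast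
        moreover have "g i = 0" using gF 4 unfolding F_pow_def by blast
        ultimately show ?thesis by (simp only: add_0_left)
      qed
    qed
    thus ?thesis unfolding cx[OF cp] by (simp add: fun_eq_iff del: cycle_of_list.simps)
  qed
  interpret H: group ?H by (rule group_hyperoctahedral)
  have mult_x: "conj_hyp n ?x (0, \<sigma>) \<otimes>\<^bsub>?H\<^esub> conj_hyp n ?x (0, \<tau>) = conj_hyp n ?x (0, \<sigma> \<circ> \<tau>)"
    if "\<sigma> permutes {1..n}" "\<tau> permutes {1..n}" for \<sigma> \<tau>
  proof -
    have st: "\<sigma> \<circ> \<tau> permutes {1..n}" using that by (simp add: permutes_compose)
    have "inv' (\<sigma> \<circ> \<tau>) = inv' \<tau> \<circ> inv' \<sigma>" using that by (simp add: o_inv_distrib permutes_bij)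
    thus ?thesis
      unfolding cx[OF that(1)] cx[OF that(2)] cx[OF st]
      by (simp only: mult_hyperoctahedral fun_add_comp comp_assoc add_0_right zero_comp_fun
          bit_fun_cancel)
  qed
  have cx1: "conj_hyp n ?x (0, id) = \<one>\<^bsub>?H\<^esub>"
    unfolding cx[OF permutes_id] one_hyperoctahedral
    by (simp only: inv_id comp_id add_0_right bit_fun_add_self)
  have all: "conj_hyp n ?x (0, \<sigma>) \<in> K" if "\<sigma> \<in> carrier (alt_group n)" for \<sigma>
    using that
  proof (induction rule: alt_group_induct)
    case id
    show ?case unfolding cx1 by (rule subgroup.one_closed[OF sub])
  next
    case (cycle i j k)
    have cc: "conj_hyp n ?x (0, ?c) \<in> K" using f(1) fc by simp
    have "cycle_of_list [i, j, k] = ?c \<or> cycle_of_list [i, j, k] = ?c \<circ> ?c"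
    proof -
      have "[i, j, k] \<in> {[1,2,3], [2,3,1], [3,1,2], [1,3,2], [2,1,3], [3,2,1]}"
        using cycle unfolding set3 by auto
      moreover have "cycle_of_list [2, 3, 1] = ?c" "cycle_of_list [3, 1, 2] = ?c"
        "cycle_of_list [1, 3, 2] = ?c \<circ> ?c" "cycle_of_list [2, 1, 3] = ?c \<circ> ?c"
        "cycle_of_list [3, 2, 1] = ?c \<circ> ?c"
        by (simp_all add: fun_eq_iff transpose_def)
      ultimately show ?thesis by (auto simp del: cycle_of_list.simps)
    qed
    thus ?case using cc K_closed[OF cc cc, unfolded mult_x[OF cp cp]] by (elim disjE) (simp_all only:)
  next
    case (inv \<sigma>)
    note p = alt_permutes[OF inv(1)]
    have car: "conj_hyp n ?x (0, \<tau>) \<in> carrier ?H" if "\<tau> permutes {1..n}" for \<tau>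
    proof -
      have "(0, \<tau>) \<in> carrier ?H" using that F_pow_0 carrier_hyperoctahedral by blast
      with x show ?thesis by (intro H.m_closed H.inv_closed)
    qed
    have "conj_hyp n ?x (0, inv' \<sigma>) \<otimes>\<^bsub>?H\<^esub> conj_hyp n ?x (0, \<sigma>) = \<one>\<^bsub>?H\<^esub>"
      unfolding mult_x[OF permutes_inv[OF p] p] permutes_inv_o(2)[OF p] by (rule cx1)
    from H.inv_equality[OF this car[OF p] car[OF permutes_inv[OF p]]]
    have "conj_hyp n ?x (0, inv' \<sigma>) = inv\<^bsub>?H\<^esub> conj_hyp n ?x (0, \<sigma>)" by (rule sym)
    thus ?case using K_inv[OF inv(2)] by (simp only:)
  next
    case (comp \<sigma> \<tau>)
    show ?case
      using K_closed[OF comp(3,4)]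
      unfolding mult_x[OF alt_permutes[OF comp(1)] alt_permutes[OF comp(2)]] .
  qed
  \<comment> \<open>Conjugation by a sign change only adds
    \<open>g + (g \<circ> inv' \<sigma>)\<close> to the sign part over \<open>\<sigma>\<close>, and
    this vector is the sign part of an element of \<open>K\<close> over
    \<open>\<sigma>\<close>.\<close>
  have K_eq: "K = (\<lambda>h. conj_hyp n ?x h) ` (sign_changes K \<times> carrier (alt_group n))"
  proof (intro equalityI subsetI)
    fix y assume y: "y \<in> K"
    obtain h \<sigma> where hs: "y = (h, \<sigma>)" by force
    note h = K_D(2,3)[OF y[unfolded hs]]
    let ?m = "h + (g + (g \<circ> inv' \<sigma>))"
    have "?m \<in> sign_changes K"
      using sign_changes_quotient[OF y[unfolded hs]] all[OF h(2)] cx[OF h(1), of 0] by simp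
    moreover have "conj_hyp n ?x (?m, \<sigma>) = y"
      unfolding cx[OF h(1)] hs by (simp add: fun_eq_iff) 
    ultimately show "y \<in> (\<lambda>h. conj_hyp n ?x h) ` (sign_changes K \<times> carrier (alt_group n))"
      using h(2) by (metis (no_types, lifting) SigmaI image_eqI)
  next
    fix y assume "y \<in> (\<lambda>h. conj_hyp n ?x h) ` (sign_changes K \<times> carrier (alt_group n))"
    then obtain m \<sigma> where m: "m \<in> sign_changes K" "\<sigma> \<in> carrier (alt_group n)" "y = conj_hyp n ?x (m, \<sigma>)"
      by blast
    note p = alt_permutes[OF m(2)]
    have "(m + (g + 0 + (g \<circ> inv' \<sigma>)), \<sigma>) \<in> K"
      using sign_changes_mult[OF m(1)] all[OF m(2)] unfolding cx[OF p] .
    moreover have "m + (g + 0 + (g \<circ> inv' \<sigma>)) = g + m + (g \<circ> inv' \<sigma>)"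
      by (simp only: add_0_right add_0_left add_ac)
    ultimately show "y \<in> K" unfolding m(3) cx[OF p] by (simp only:)
  qed
  have "sign_changes K = diag_F n \<or> sign_changes K = {0}"
    using diag diag_eq zero_sign_changes by blast
  hence "sign_changes K \<times> carrier (alt_group n) = diag_alt 3
      \<or> sign_changes K \<times> carrier (alt_group n) = alt_copy 3"
    by (auto simp: diag_alt_def alt_copy_def n)
  thus ?thesis using K_eq x unfolding conjugate_in_def by metis
qed

end

section \<open>Subgroups with few sign changes\<close>

lemma chi_diag:
  assumes "f \<in> diag_F n" "S \<subseteq> {1..n}" "even (card S)"
  shows "chi S f = 1"
proof (cases "S = {}")
  case True
  thus ?thesis by (simp add: chi_def)
next
  case False
  then obtain j where j: "j \<in> S" by blast
  have "f i = f j" if "i \<in> S" for i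
    using assms(1,2) that j unfolding diag_F_def by blast
  hence "chi S f = (\<Prod>i\<in>S. if f j = 1 then -1 else 1)" unfolding chi_def by simp
  thus ?thesis using assms(3) by simp
qed

text \<open>Elements of \<open>K\<close> over the same permutation differ by a constant vector, on
  which \<open>chi S\<close> is 1 because \<open>card S\<close> is even. So the weight is constant
  over \<open>\<sigma> \<circ> \<tau>\<close>, and the one obvious way to write this permutation in
  one order produces another in the opposite order.\<close>

lemma (in over_alternating) stabiliser_factorisation:
  assumes sg: "strong_gelfand_subgroup K (hyperoctahedral n)"
    and diag: "sign_changes K \<subseteq> diag_F n"
    and S: "S \<subseteq> {1..n}" "even (card S)"
    and \<sigma>: "\<sigma> \<in> carrier (alt_group n)" and \<tau>: "\<tau> \<in> carrier (alt_group n)"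
  shows "\<exists>\<alpha>\<in>carrier (alt_group n). \<exists>\<beta>\<in>carrier (alt_group n). \<alpha> ` S = S \<and> \<beta> ` S = S
    \<and> (\<beta> \<circ> \<tau> \<circ> inv' \<beta>) \<circ> (\<alpha> \<circ> \<sigma> \<circ> inv' \<alpha>) = \<sigma> \<circ> \<tau>"
proof -
  let ?H = "hyperoctahedral n"
  interpret H: group ?H by (rule group_hyperoctahedral)
  obtain f where k: "(f, \<sigma>) \<in> K" using K_lift[OF \<sigma>] ..
  obtain g where l: "(g, \<tau>) \<in> K" using K_lift[OF \<tau>] ..
  let ?k = "(f, \<sigma>)" and ?l = "(g, \<tau>)"
  have sub': "K \<subseteq> carrier ?H" using subgroup.subset[OF sub] .
  have kH: "?k \<in> carrier ?H" and lH: "?l \<in> carrier ?H" using k l sub' by blast+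
  note perm = alt_permutes[OF \<sigma>] alt_permutes[OF \<tau>]
  have snd_conj: "snd (conj_hyp n a (h, \<pi>)) = snd a \<circ> \<pi> \<circ> inv' (snd a)"
    if "a \<in> K" "\<pi> permutes {1..n}" for a h \<pi>
  proof -
    obtain p \<alpha> where a: "a = (p, \<alpha>)" by force
    note A = K_D(1,2)[OF that(1)[unfolded a]]
    show ?thesis unfolding a conj_hyperoctahedral[OF A that(2)] by simp
  qed
  have snd_mult: "snd (x \<otimes>\<^bsub>?H\<^esub> y) = snd x \<circ> snd y" for x y
    by (cases x; cases y) (simp add: mult_hyperoctahedral)
  have "\<exists>a\<in>K. \<exists>b\<in>K. snd b ` S = S \<and> (snd (conj_hyp n b ?k) \<circ> snd a) ` S = S
    \<and> snd (conj_hyp n b ?k \<otimes>\<^bsub>?H\<^esub> conj_hyp n a ?l) = \<sigma> \<circ> \<tau>"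
  proof (rule strong_gelfand_stabiliser[OF sg lH kH S(1) chi_nonzero])
    fix a b assume ab: "a \<in> K" "b \<in> K"
      and s: "snd (conj_hyp n a ?l \<otimes>\<^bsub>?H\<^esub> conj_hyp n b ?k) = \<sigma> \<circ> \<tau>"
    let ?z = "conj_hyp n a ?l \<otimes>\<^bsub>?H\<^esub> conj_hyp n b ?k"
    have "?z \<in> K" using ab k l by (intro K_closed K_inv)
    hence z: "(fst ?z, \<sigma> \<circ> \<tau>) \<in> K" unfolding s[symmetric] prod.collapse .
    have "?k \<otimes>\<^bsub>?H\<^esub> ?l \<in> K" using k l by (rule K_closed)
    hence w: "(fst (?k \<otimes>\<^bsub>?H\<^esub> ?l), \<sigma> \<circ> \<tau>) \<in> K" by (simp add: mult_hyperoctahedral)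
    have "chi S (fst ?z + fst (?k \<otimes>\<^bsub>?H\<^esub> ?l)) = 1"
      using chi_diag[OF subsetD[OF diag sign_changes_quotient[OF z w]] S] .
    hence "chi S (fst ?z) * chi S (fst (?k \<otimes>\<^bsub>?H\<^esub> ?l)) = chi S (fst (?k \<otimes>\<^bsub>?H\<^esub> ?l)) * chi S (fst (?k \<otimes>\<^bsub>?H\<^esub> ?l))"
      unfolding chi_add chi_square .
    thus "chi S (fst ?z) = chi S (fst (?k \<otimes>\<^bsub>?H\<^esub> ?l))" using chi_nonzero by simp
  next
    show "\<one>\<^bsub>?H\<^esub> \<in> K" using sub by (rule subgroup.one_closed)
    show "inv\<^bsub>?H\<^esub> ?l \<in> K" using l by (rule K_inv)
    show "snd \<one>\<^bsub>?H\<^esub> ` S = S" by (simp add: one_hyperoctahedral)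
    have 1: "conj_hyp n \<one>\<^bsub>?H\<^esub> ?l = ?l" using lH by (simp del: One_nat_def)
    show "(snd (conj_hyp n \<one>\<^bsub>?H\<^esub> ?l) \<circ> snd (inv\<^bsub>?H\<^esub> ?l)) ` S = S"
      unfolding 1 inv_hyperoctahedral[OF K_D(1,2)[OF l]] by (simp add: permutes_inv_o[OF perm(2)])
    \<comment> \<open>The witnesses come from \<open>l (inv l k l) = k l\<close>: conjugate
      \<open>l\<close> by the identity and \<open>k\<close> by the inverse of
      \<open>l\<close>.\<close>
    have "conj_hyp n \<one>\<^bsub>?H\<^esub> ?l \<otimes>\<^bsub>?H\<^esub> conj_hyp n (inv\<^bsub>?H\<^esub> ?l) ?k = ?k \<otimes>\<^bsub>?H\<^esub> ?l"
      unfolding 1 using kH lH by (simp add: H.m_assoc[symmetric] del: One_nat_def)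
    thus "snd (conj_hyp n \<one>\<^bsub>?H\<^esub> ?l \<otimes>\<^bsub>?H\<^esub> conj_hyp n (inv\<^bsub>?H\<^esub> ?l) ?k) = \<sigma> \<circ> \<tau>"
      by (simp add: snd_mult)
  qed
  then obtain a b where ab: "a \<in> K" "b \<in> K" "snd b ` S = S" "(snd (conj_hyp n b ?k) \<circ> snd a) ` S = S"
    "snd (conj_hyp n b ?k \<otimes>\<^bsub>?H\<^esub> conj_hyp n a ?l) = \<sigma> \<circ> \<tau>" by blast
  define \<alpha> where "\<alpha> = snd b"
  define s where "s = \<alpha> \<circ> \<sigma> \<circ> inv' \<alpha>"
  define \<gamma> where "\<gamma> = snd a"
  have in_alt: "\<alpha> \<in> carrier (alt_group n)" "\<gamma> \<in> carrier (alt_group n)"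
    using ab(1,2) snd_K unfolding \<alpha>_def \<gamma>_def by blast+
  interpret A: group "alt_group n" by (rule alt_group_is_group)
  have s_alt: "s \<in> carrier (alt_group n)" unfolding s_def
    using A.m_closed[OF A.m_closed[OF in_alt(1) \<sigma>] A.inv_closed[OF in_alt(1)]]
    by (simp add: alt_group_mult alt_group_inv_equality[OF in_alt(1)])
  have sg_alt: "s \<circ> \<gamma> \<in> carrier (alt_group n)"
    using A.m_closed[OF s_alt in_alt(2)] by (simp add: alt_group_mult)
  have bij: "bij s" "bij \<gamma>" using alt_permutes[OF s_alt] alt_permutes[OF in_alt(2)] permutes_bij by blast+
  have eqs: "s \<circ> (\<gamma> \<circ> \<tau> \<circ> inv' \<gamma>) = \<sigma> \<circ> \<tau>" "(s \<circ> \<gamma>) ` S = S"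
    using ab(4,5)
    unfolding snd_mult[of "conj_hyp n b ?k" "conj_hyp n a ?l"] snd_conj[OF ab(1) perm(2)] snd_conj[OF ab(2) perm(1)]
    unfolding s_def \<alpha>_def \<gamma>_def by simp_all
  \<comment> \<open>Moving \<open>s\<close> to the right past the conjugate of \<open>\<tau>\<close>
    turns its conjugator \<open>\<gamma>\<close> into \<open>s \<circ> \<gamma>\<close>, and it is
    this permutation that is known to preserve \<open>S\<close>.\<close>
  have "((s \<circ> \<gamma>) \<circ> \<tau> \<circ> inv' (s \<circ> \<gamma>)) \<circ> s = s \<circ> (\<gamma> \<circ> \<tau> \<circ> inv' \<gamma>)"
    using bij by (simp add: o_inv_distrib fun_eq_iff inv_f_f bij_is_inj)
  hence "((s \<circ> \<gamma>) \<circ> \<tau> \<circ> inv' (s \<circ> \<gamma>)) \<circ> (\<alpha> \<circ> \<sigma> \<circ> inv' \<alpha>) = \<sigma> \<circ> \<tau>"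
    unfolding eqs(1) s_def[symmetric] .
  thus ?thesis using in_alt(1) sg_alt ab(3) eqs(2) unfolding \<alpha>_def[symmetric] by blast
qed

subsection \<open>The sign of a permutation given by its list of values\<close>

text \<open>The list contains the values in reverse order, so that the length of the list is the
  argument of its first entry.\<close>

fun even_values :: "nat list \<Rightarrow> bool"
  where "even_values [] = True"
  | "even_values (x # xs) = (if x = Suc (length xs) then even_values xs
      else \<not> even_values (map (transpose x (Suc (length xs))) xs))"

text \<open>Composing with the transposition of \<open>\<alpha> (Suc n)\<close> and
  \<open>Suc n\<close> makes \<open>Suc n\<close> a fixed point, and changes the sign unless it was
  one already.\<close>

lemma evenperm_even_values:
  "\<alpha> permutes {1..n} \<Longrightarrow> evenperm \<alpha> \<longleftrightarrow> even_values (map \<alpha> (rev [1..<Suc n]))"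
proof (induction n arbitrary: \<alpha>)
  case 0
  thus ?case by simp
next
  case (Suc n)
  let ?t = "transpose (\<alpha> (Suc n)) (Suc n)"
  have in_range: "\<alpha> (Suc n) \<in> {1..Suc n}"
    using permutes_in_image[OF Suc.prems, of "Suc n"] by simp
  have "?t \<circ> \<alpha> permutes {1..Suc n}"
    by (rule permutes_compose[OF Suc.prems permutes_swap_id]) (use in_range in auto)
  hence p: "?t \<circ> \<alpha> permutes {1..n}"
    by (rule permutes_superset) (auto simp: le_Suc_eq)
  have "permutation \<alpha>" using Suc.prems permutation_permutes by blast
  hence "evenperm (?t \<circ> \<alpha>) \<longleftrightarrow> (\<alpha> (Suc n) = Suc n) = evenperm \<alpha>"
    by (subst evenperm_comp) (simp_all add: evenperm_swap permutation_swap_id)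
  hence iff: "even_values (map ?t (map \<alpha> (rev [1..<Suc n]))) \<longleftrightarrow> (\<alpha> (Suc n) = Suc n) = evenperm \<alpha>"
    using Suc.IH[OF p] unfolding map_map by blast
  define L where "L = map \<alpha> (rev [1..<Suc n])"
  have L: "map \<alpha> (rev [1..<Suc (Suc n)]) = \<alpha> (Suc n) # L" "length L = n"
    by (simp_all add: L_def)
  have "?t = id" if "\<alpha> (Suc n) = Suc n" using that by (simp add: fun_eq_iff)
  thus ?case
    using iff unfolding L L_def[symmetric] by (cases "\<alpha> (Suc n) = Suc n") (simp_all add: L)
qed

subsection \<open>Pairs of permutations without a factorisation in the stabiliser\<close>

lemma permutes_values_in:
  assumes "\<alpha> permutes {1..n}" "\<alpha> ` S = S" "i \<in> {1..n}"
  shows "i \<in> S \<Longrightarrow> \<alpha> i \<in> S" "i \<notin> S \<Longrightarrow> \<alpha> i \<in> {1..n} - S"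
proof -
  show "i \<in> S \<Longrightarrow> \<alpha> i \<in> S" using assms(2) by blast
  show "\<alpha> i \<in> {1..n} - S" if "i \<notin> S"
    using assms that permutes_in_image[OF assms(1), of i] inj_image_mem_iff[OF permutes_inj[OF assms(1)], of i S]
    by simp
qed

text \<open>For \<open>n \<le> 6\<close> and \<open>S = {1, 2}\<close>, odd \<open>\<beta>\<close> do give factorisations, so that the sign of \<open>\<beta>\<close> has to
  be tracked; for larger \<open>n\<close> no \<open>\<beta>\<close> does.\<close>

definition no_factorisation :: "nat \<Rightarrow> nat set \<Rightarrow> (nat \<Rightarrow> nat) \<Rightarrow> (nat \<Rightarrow> nat) \<Rightarrow> bool"
  where "no_factorisation n S \<sigma> \<tau> \<longleftrightarrow> S \<subseteq> {1..n} \<and> even (card S)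
    \<and> \<sigma> \<in> carrier (alt_group n) \<and> \<tau> \<in> carrier (alt_group n)
    \<and> (\<forall>\<alpha>\<in>carrier (alt_group n). \<forall>\<beta>\<in>carrier (alt_group n). \<alpha> ` S = S \<longrightarrow> \<beta> ` S = S
      \<longrightarrow> (\<beta> \<circ> \<tau> \<circ> inv' \<beta>) \<circ> (\<alpha> \<circ> \<sigma> \<circ> inv' \<alpha>) \<noteq> \<sigma> \<circ> \<tau>)"

section \<open>Explicit pairs for \<open>n = 4\<close>, 5, 6 and uniformly from 7 on\<close>

lemma no_factorisation_4: "no_factorisation 4 {1, 2} (cycle_of_list [2, 4, 3]) (cycle_of_list [1, 2, 4])"
  unfolding no_factorisation_def
proof (intro conjI ballI impI notI)
  let ?\<sigma> = "cycle_of_list [2, 4, 3 :: nat]" and ?\<tau> = "cycle_of_list [1, 2, 4 :: nat]"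
  show "?\<sigma> \<in> carrier (alt_group 4)" "?\<tau> \<in> carrier (alt_group 4)" by (rule cycle3_alt; simp)+
  fix \<alpha> \<beta> :: "nat \<Rightarrow> nat"
  assume alt: "\<alpha> \<in> carrier (alt_group 4)" "\<beta> \<in> carrier (alt_group 4)"
    and stab: "\<alpha> ` {1, 2} = {1, 2}" "\<beta> ` {1, 2} = {1, 2}"
    and eq: "(\<beta> \<circ> ?\<tau> \<circ> inv' \<beta>) \<circ> (\<alpha> \<circ> ?\<sigma> \<circ> inv' \<alpha>) = ?\<sigma> \<circ> ?\<tau>"
  have perm: "\<alpha> permutes {1..4}" "\<beta> permutes {1..4}" and "evenperm \<beta>"
    using alt by (simp_all add: alt_group_carrier)
  moreover have "rev [1..<Suc 4] = [4, 3, 2, 1]" by (simp add: upt_rec)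
  ultimately have ev: "even_values [\<beta> 4, \<beta> 3, \<beta> 2, \<beta> 1]"
    using evenperm_even_values[OF perm(2)] by (simp only: list.map)
  \<comment> \<open>A conjugate of a cycle is the cycle of the images, which reduces the claim to a
    finite check of values.\<close>
  have "cycle_of_list (map \<beta> [1, 2, 4]) \<circ> cycle_of_list (map \<alpha> [2, 4, 3]) = ?\<sigma> \<circ> ?\<tau>"
    using eq conjugation_of_cycle[of "[1, 2, 4]" \<beta>] conjugation_of_cycle[of "[2, 4, 3]" \<alpha>]
      perm[THEN permutes_bij] by simp
  hence eq': "cycle_of_list [\<beta> 1, \<beta> 2, \<beta> 4] (cycle_of_list [\<alpha> 2, \<alpha> 4, \<alpha> 3] x) = ?\<sigma> (?\<tau> x)" for x
    by (simp add: fun_eq_iff)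
  have inj: "\<alpha> i = \<alpha> j \<longleftrightarrow> i = j" "\<beta> i = \<beta> j \<longleftrightarrow> i = j" for i j
    using perm[THEN permutes_inj] by (simp_all add: inj_eq)
  have rest: "{1..4} - {1, 2} = {3, 4 :: nat}" by auto
  note val_in = permutes_values_in[OF perm(1) stab(1), unfolded rest]
    permutes_values_in[OF perm(2) stab(2), unfolded rest]
  have "\<beta> 1 \<in> {1, 2}" "\<beta> 2 \<in> {1, 2}" "\<beta> 3 \<in> {3, 4}" "\<beta> 4 \<in> {3, 4}"
    "\<alpha> 2 \<in> {1, 2}" "\<alpha> 3 \<in> {3, 4}" "\<alpha> 4 \<in> {3, 4}"
    by (rule val_in; simp)+
  moreover have "\<beta> 1 \<noteq> \<beta> 2" "\<beta> 3 \<noteq> \<beta> 4" "\<alpha> 3 \<noteq> \<alpha> 4"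
    unfolding inj by simp_all
  ultimately show False
    using eq'[of 1] eq'[of 2] eq'[of 3] eq'[of 4] ev
    unfolding insert_iff empty_iff simp_thms
    by (elim disjE) (simp_all add: transpose_def)
qed auto

text \<open>The tuples are the possible values of \<open>\<beta>\<close> and
  \<open>\<alpha>\<close>. All five values of \<open>\<beta>\<close> appear, since its sign is read
  from the whole list; of \<open>\<alpha>\<close> only those on the points of the cycle
  \<open>1 2 3\<close>. The guards stand between the quantifiers to prune the evaluation
  early.\<close>

lemma no_factorisation_values_5:
  "\<forall>b1\<in>{1, 2 :: nat}. \<forall>b2\<in>{1, 2}. b1 \<noteq> b2 \<longrightarrow> (\<forall>b3\<in>{3, 4, 5}. (\<forall>b4\<in>{3, 4, 5}. b4 \<noteq> b3 \<longrightarrow> (\<forall>b5\<in>{3, 4, 5}. b5 \<noteq> b3 \<longrightarrow> b5 \<noteq> b4 \<longrightarrow> even_values [b5, b4, b3, b2, b1] \<longrightarrow>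
    (\<forall>a1\<in>{1, 2}. (\<forall>a2\<in>{1, 2}. a1 \<noteq> a2 \<longrightarrow> (\<forall>a3\<in>{3, 4, 5}. 
      \<exists>x\<in>{1, 2, 3, 4, 5}. cycle_of_list [b1, b4, b3] (cycle_of_list [a1, a2, a3] x)
        \<noteq> cycle_of_list [1, 2, 3] (cycle_of_list [1, 4, 3] x)))))))"
  by code_simp

lemma no_factorisation_5: "no_factorisation 5 {1, 2} (cycle_of_list [1, 2, 3]) (cycle_of_list [1, 4, 3])"
  unfolding no_factorisation_def
proof (intro conjI ballI impI notI)
  let ?\<sigma> = "cycle_of_list [1, 2, 3 :: nat]" and ?\<tau> = "cycle_of_list [1, 4, 3 :: nat]"
  show "?\<sigma> \<in> carrier (alt_group 5)" by (rule cycle3_alt; simp)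
  show "?\<tau> \<in> carrier (alt_group 5)" by (rule cycle3_alt; simp)
  fix \<alpha> \<beta> :: "nat \<Rightarrow> nat"
  assume alt: "\<alpha> \<in> carrier (alt_group 5)" "\<beta> \<in> carrier (alt_group 5)"
    and stab: "\<alpha> ` {1, 2} = {1, 2}" "\<beta> ` {1, 2} = {1, 2}"
    and eq: "(\<beta> \<circ> (?\<tau>) \<circ> inv' \<beta>) \<circ> (\<alpha> \<circ> ?\<sigma> \<circ> inv' \<alpha>) = ?\<sigma> \<circ> (?\<tau>)"
  have perm: "\<alpha> permutes {1..5}" "\<beta> permutes {1..5}" and "evenperm \<beta>"
    using alt by (simp_all add: alt_group_carrier)
  moreover have "rev [1..<Suc 5] = [5, 4, 3, 2, 1]" by (simp add: upt_rec)
  ultimately have ev: "even_values [\<beta> 5, \<beta> 4, \<beta> 3, \<beta> 2, \<beta> 1]"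
    using evenperm_even_values[OF perm(2)] by (simp only: list.map)
  have "cycle_of_list (map \<beta> [1, 4, 3]) \<circ> cycle_of_list (map \<alpha> [1, 2, 3]) = ?\<sigma> \<circ> ?\<tau>"
    using eq conjugation_of_cycle[of "[1, 4, 3]" \<beta>] conjugation_of_cycle[of "[1, 2, 3]" \<alpha>]
      perm[THEN permutes_bij] by simp
  hence eq': "cycle_of_list [\<beta> 1, \<beta> 4, \<beta> 3] (cycle_of_list [\<alpha> 1, \<alpha> 2, \<alpha> 3] x)
      = ?\<sigma> (cycle_of_list [1, 4, 3] x)" for x
    by (simp add: fun_eq_iff)
  have inj: "\<alpha> i = \<alpha> j \<longleftrightarrow> i = j" "\<beta> i = \<beta> j \<longleftrightarrow> i = j" for i j
    using perm[THEN permutes_inj] by (simp_all add: inj_eq)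
  have rest: "{1..5} - {1, 2} = {3, 4, 5 :: nat}" by auto
  note val_in = permutes_values_in[OF perm(1) stab(1), unfolded rest]
    permutes_values_in[OF perm(2) stab(2), unfolded rest]
  have "\<beta> 1 \<in> {1, 2}" "\<beta> 2 \<in> {1, 2}" "\<beta> 3 \<in> {3, 4, 5}" "\<beta> 4 \<in> {3, 4, 5}" "\<beta> 5 \<in> {3, 4, 5}"
    by (rule val_in; simp)+
  moreover have "\<beta> 1 \<noteq> \<beta> 2" "\<beta> 4 \<noteq> \<beta> 3" "\<beta> 5 \<noteq> \<beta> 3" "\<beta> 5 \<noteq> \<beta> 4"
    unfolding inj by simp_all
  moreover have "\<alpha> 1 \<in> {1, 2}" "\<alpha> 2 \<in> {1, 2}" "\<alpha> 3 \<in> {3, 4, 5}"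
    by (rule val_in; simp)+
  moreover have "\<alpha> 1 \<noteq> \<alpha> 2" unfolding inj by simp_all
  ultimately have "\<exists>x\<in>{1, 2, 3, 4, 5}. cycle_of_list [\<beta> 1, \<beta> 4, \<beta> 3] (cycle_of_list [\<alpha> 1, \<alpha> 2, \<alpha> 3] x)
      \<noteq> cycle_of_list [1, 2, 3] (cycle_of_list [1, 4, 3] x)"
    using ev by (intro no_factorisation_values_5[rule_format])
  thus False using eq' by simp
qed auto

text \<open>The pairs are the points outside \<open>S = {1, 2}\<close> with their images under the
  product \<open>\<sigma> \<circ> \<tau>\<close> of \<open>no_factorisation_6\<close>. A conjugate
  of the cycle \<open>1 2 3\<close> by a stabilising \<open>\<alpha>\<close> moves only one point
  outside \<open>S\<close>, namely \<open>a3 = \<alpha> 3\<close>; at the others the conjugate of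
  \<open>\<tau>\<close> alone would have to give the right image.\<close>

lemma no_factorisation_values_6:
  "\<forall>b1\<in>{1, 2 :: nat}. \<forall>b2\<in>{1, 2}. b1 \<noteq> b2 \<longrightarrow> (\<forall>b3\<in>{3, 4, 5, 6}. \<forall>b4\<in>{3, 4, 5, 6}. b4 \<noteq> b3 \<longrightarrow>
    (\<forall>b5\<in>{3, 4, 5, 6}. b5 \<noteq> b3 \<longrightarrow> b5 \<noteq> b4 \<longrightarrow> (\<forall>b6\<in>{3, 4, 5, 6}. b6 \<noteq> b3 \<longrightarrow> b6 \<noteq> b4 \<longrightarrow> b6 \<noteq> b5 \<longrightarrow>
      even_values [b6, b5, b4, b3, b2, b1] \<longrightarrow>
      (\<forall>a3\<in>{3, 4, 5, 6}. \<exists>(x, y)\<in>{(3, 5), (4, 2), (5, 6), (6, 1)}. x \<noteq> a3 \<and>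
        cycle_of_list [b1, b2, b4] (cycle_of_list [b3, b5, b6] x) \<noteq> y))))"
  by code_simp

lemma no_factorisation_6: "no_factorisation 6 {1, 2} (cycle_of_list [1, 2, 3]) (cycle_of_list [1, 2, 4] \<circ> cycle_of_list [3, 5, 6])"
  unfolding no_factorisation_def
proof (intro conjI ballI impI notI)
  let ?\<sigma> = "cycle_of_list [1, 2, 3 :: nat]" and ?\<tau> = "cycle_of_list [1, 2, 4 :: nat] \<circ> cycle_of_list [3, 5, 6 :: nat]"
  show "?\<sigma> \<in> carrier (alt_group 6)" by (rule cycle3_alt; simp)
  have "cycle_of_list [1, 2, 4 :: nat] \<in> carrier (alt_group 6)" "cycle_of_list [3, 5, 6 :: nat] \<in> carrier (alt_group 6)"
    by (rule cycle3_alt; simp)+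
  thus "?\<tau> \<in> carrier (alt_group 6)"
    by (rule alt_group_comp)
  fix \<alpha> \<beta> :: "nat \<Rightarrow> nat"
  assume alt: "\<alpha> \<in> carrier (alt_group 6)" "\<beta> \<in> carrier (alt_group 6)"
    and stab: "\<alpha> ` {1, 2} = {1, 2}" "\<beta> ` {1, 2} = {1, 2}"
    and eq: "(\<beta> \<circ> (?\<tau>) \<circ> inv' \<beta>) \<circ> (\<alpha> \<circ> ?\<sigma> \<circ> inv' \<alpha>) = ?\<sigma> \<circ> (?\<tau>)"
  have perm: "\<alpha> permutes {1..6}" "\<beta> permutes {1..6}" and "evenperm \<beta>"
    using alt by (simp_all add: alt_group_carrier)
  moreover have "rev [1..<Suc 6] = [6, 5, 4, 3, 2, 1]" by (simp add: upt_rec)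
  ultimately have ev: "even_values [\<beta> 6, \<beta> 5, \<beta> 4, \<beta> 3, \<beta> 2, \<beta> 1]"
    using evenperm_even_values[OF perm(2)] by (simp only: list.map)
  have "\<beta> \<circ> (cycle_of_list [1, 2, 4] \<circ> cycle_of_list [3, 5, 6]) \<circ> inv' \<beta>
      = (\<beta> \<circ> cycle_of_list [1, 2, 4] \<circ> inv' \<beta>) \<circ> (\<beta> \<circ> cycle_of_list [3, 5, 6] \<circ> inv' \<beta>)"
    using permutes_bij[OF perm(2)] by (simp add: fun_eq_iff inv_f_f bij_is_inj)
  also have "\<dots> = cycle_of_list (map \<beta> [1, 2, 4]) \<circ> cycle_of_list (map \<beta> [3, 5, 6])"
    using conjugation_of_cycle[of "[1, 2, 4]" \<beta>] conjugation_of_cycle[of "[3, 5, 6]" \<beta>]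
      permutes_bij[OF perm(2)] by simp
  finally have "(cycle_of_list (map \<beta> [1, 2, 4]) \<circ> cycle_of_list (map \<beta> [3, 5, 6])) \<circ> cycle_of_list (map \<alpha> [1, 2, 3]) = ?\<sigma> \<circ> (?\<tau>)"
    using eq conjugation_of_cycle[of "[1, 2, 3]" \<alpha>] permutes_bij[OF perm(1)] by simp
  hence eq': "cycle_of_list [\<beta> 1, \<beta> 2, \<beta> 4] (cycle_of_list [\<beta> 3, \<beta> 5, \<beta> 6] (cycle_of_list [\<alpha> 1, \<alpha> 2, \<alpha> 3] x))
      = ?\<sigma> (cycle_of_list [1, 2, 4] (cycle_of_list [3, 5, 6] x))" for x
    by (simp add: fun_eq_iff)
  have inj: "\<alpha> i = \<alpha> j \<longleftrightarrow> i = j" "\<beta> i = \<beta> j \<longleftrightarrow> i = j" for i j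
    using perm[THEN permutes_inj] by (simp_all add: inj_eq)
  have rest: "{1..6} - {1, 2} = {3, 4, 5, 6 :: nat}" by auto
  note val_in = permutes_values_in[OF perm(1) stab(1), unfolded rest]
    permutes_values_in[OF perm(2) stab(2), unfolded rest]
  have "\<beta> 1 \<in> {1, 2}" "\<beta> 2 \<in> {1, 2}" "\<beta> 3 \<in> {3, 4, 5, 6}" "\<beta> 4 \<in> {3, 4, 5, 6}" "\<beta> 5 \<in> {3, 4, 5, 6}" "\<beta> 6 \<in> {3, 4, 5, 6}"
    by (rule val_in; simp)+
  moreover have "\<beta> 1 \<noteq> \<beta> 2" "\<beta> 4 \<noteq> \<beta> 3" "\<beta> 5 \<noteq> \<beta> 3" "\<beta> 5 \<noteq> \<beta> 4" "\<beta> 6 \<noteq> \<beta> 3" "\<beta> 6 \<noteq> \<beta> 4" "\<beta> 6 \<noteq> \<beta> 5"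
    unfolding inj by simp_all
  moreover have \<alpha>3: "\<alpha> 3 \<in> {3, 4, 5, 6}" by (rule val_in; simp)
  ultimately have "\<exists>(x, y)\<in>{(3, 5), (4, 2), (5, 6), (6, 1)}. x \<noteq> \<alpha> 3 \<and>
      cycle_of_list [\<beta> 1, \<beta> 2, \<beta> 4] (cycle_of_list [\<beta> 3, \<beta> 5, \<beta> 6] x) \<noteq> y"
    using ev by (intro no_factorisation_values_6[rule_format])
  then obtain x y where xy: "(x, y) \<in> {(3, 5), (4, 2), (5, 6), (6, 1 :: nat)}" "x \<noteq> \<alpha> 3"
      "cycle_of_list [\<beta> 1, \<beta> 2, \<beta> 4] (cycle_of_list [\<beta> 3, \<beta> 5, \<beta> 6] x) \<noteq> y"
    by (elim bexE) (simp only: split_beta, metis prod.collapse)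
  have "\<alpha> 1 \<in> {1, 2}" "\<alpha> 2 \<in> {1, 2}" by (rule val_in; simp)+
  hence "x \<notin> {\<alpha> 1, \<alpha> 2, \<alpha> 3}" using xy(1,2) by auto
  hence "cycle_of_list [\<alpha> 1, \<alpha> 2, \<alpha> 3] x = x" by (intro id_outside_supp) simp
  with eq'[of x] xy(3) have "cycle_of_list [1, 2, 3] (cycle_of_list [1, 2, 4] (cycle_of_list [3, 5, 6] x)) \<noteq> y"
    by (simp del: cycle_of_list.simps)
  thus False using xy(1) by (auto simp: transpose_def)
qed auto

text \<open>Colour the points by membership in \<open>{3, 5, 6, 7}\<close>. If a three-cycle \<open>b1 b6 b7\<close> and a
  five-cycle multiply to \<open>1 2 3 4 5 6 7\<close>, then the five-cycle runs through consecutive points, and no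
  five consecutive points form the same coloured necklace as \<open>2 3 4 5 6\<close> while the three-cycle
  has the colours of \<open>1 6 7\<close>.\<close>

definition unrotate :: "nat \<Rightarrow> nat \<Rightarrow> nat \<Rightarrow> nat \<Rightarrow> nat"
  where "unrotate b1 b6 b7 x = (if x = b6 then b1 else if x = b7 then b6 else if x = b1 then b7 else x)"

definition next7 :: "nat \<Rightarrow> nat"
  where "next7 i = (if i = 7 then 1 else Suc i)"

lemma no_necklace:
  "\<forall>b1\<in>{1, 2, 4}. \<forall>b6\<in>{3, 5, 6, 7}. \<forall>b7\<in>{3, 5, 6, 7}. b6 \<noteq> b7 \<longrightarrow>
    (\<forall>a2\<in>{1, 2, 4}. \<forall>a3\<in>{3, 5, 6, 7}. unrotate b1 b6 b7 (next7 a2) = a3 \<longrightarrow>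
    (\<forall>a4\<in>{1, 2, 4}. unrotate b1 b6 b7 (next7 a3) = a4 \<longrightarrow>
    (\<forall>a5\<in>{3, 5, 6, 7}. unrotate b1 b6 b7 (next7 a4) = a5 \<longrightarrow>
    (\<forall>a6\<in>{3, 5, 6, 7}. unrotate b1 b6 b7 (next7 a5) = a6 \<longrightarrow>
      unrotate b1 b6 b7 (next7 a6) \<noteq> a2))))"
  by code_simp

text \<open>The product is a seven-cycle on \<open>{1..7}\<close>, and supports of sizes 5 and 3
  leave no room for points beyond 7. So the necklace check on seven points settles every
  \<open>n\<close>.\<close>

lemma no_factorisation_large:
  assumes n: "n \<ge> 7"
  shows "no_factorisation n {3, 5, 6, 7} (cycle_of_list [2, 3, 4, 5, 6]) (cycle_of_list [1, 6, 7])"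
  unfolding no_factorisation_def
proof (intro conjI ballI impI notI)
  let ?\<sigma> = "cycle_of_list [2, 3, 4, 5, 6 :: nat]" and ?\<tau> = "cycle_of_list [1, 6, 7 :: nat]"
  let ?S = "{3, 5, 6, 7 :: nat}"
  show "?S \<subseteq> {1..n}" using n by auto
  show "even (card ?S)" by simp
  show "?\<tau> \<in> carrier (alt_group n)" by (rule cycle3_alt) (use n in auto)
  have "?\<sigma> = cycle_of_list [2, 3, 4] \<circ> cycle_of_list [4, 5, 6]" by (simp add: comp_assoc)
  moreover have "cycle_of_list [2, 3, 4 :: nat] \<in> carrier (alt_group n)"
    "cycle_of_list [4, 5, 6 :: nat] \<in> carrier (alt_group n)"
    by (rule cycle3_alt; use n in auto)+
  ultimately show "?\<sigma> \<in> carrier (alt_group n)"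
    using alt_group_comp by metis
  fix \<alpha> \<beta> :: "nat \<Rightarrow> nat"
  assume alt: "\<alpha> \<in> carrier (alt_group n)" "\<beta> \<in> carrier (alt_group n)"
    and stab: "\<alpha> ` ?S = ?S" "\<beta> ` ?S = ?S"
    and eq: "(\<beta> \<circ> ?\<tau> \<circ> inv' \<beta>) \<circ> (\<alpha> \<circ> ?\<sigma> \<circ> inv' \<alpha>) = ?\<sigma> \<circ> ?\<tau>"
  have perm: "\<alpha> permutes {1..n}" "\<beta> permutes {1..n}"
    using alt by (simp_all add: alt_group_carrier)
  have inj: "\<alpha> i = \<alpha> j \<longleftrightarrow> i = j" "\<beta> i = \<beta> j \<longleftrightarrow> i = j" for i j
    using perm[THEN permutes_inj] by (simp_all add: inj_eq)
  define s where "s = \<alpha> \<circ> ?\<sigma> \<circ> inv' \<alpha>"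
  define t where "t = \<beta> \<circ> ?\<tau> \<circ> inv' \<beta>"
  define z where "z = ?\<sigma> \<circ> ?\<tau>"
  have ts: "t (s x) = z x" for x using eq unfolding s_def[symmetric] t_def[symmetric] z_def by (metis comp_apply)
  have z: "z 1 = 2" "z 2 = 3" "z 3 = 4" "z 4 = 5" "z 5 = 6" "z 6 = 7" "z 7 = 1"
    by (simp_all add: z_def transpose_def)
  have z_out: "z x = x" if "x \<notin> {1..7}" for x
    using that by (auto simp: z_def transpose_def)
  have sa: "s (\<alpha> i) = \<alpha> (?\<sigma> i)" for i
    using permutes_inverses(2)[OF perm(1)] by (simp add: s_def)
  have tb: "t (\<beta> i) = \<beta> (?\<tau> i)" for i
    using permutes_inverses(2)[OF perm(2)] by (simp add: t_def)
  have s_val: "s (\<alpha> 2) = \<alpha> 3" "s (\<alpha> 3) = \<alpha> 4" "s (\<alpha> 4) = \<alpha> 5" "s (\<alpha> 5) = \<alpha> 6" "s (\<alpha> 6) = \<alpha> 2"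
    unfolding sa by (simp_all add: transpose_def)
  have t_val: "t (\<beta> 1) = \<beta> 6" "t (\<beta> 6) = \<beta> 7" "t (\<beta> 7) = \<beta> 1"
    unfolding tb by (simp_all add: transpose_def)
  define A where "A = \<alpha> ` {2, 3, 4, 5, 6}"
  define B where "B = \<beta> ` {1, 6, 7}"
  have s_fix: "s x = x" if "x \<notin> A" for x
  proof -
    obtain i where i: "x = \<alpha> i" using permutes_surj[OF perm(1)] by blast
    hence "i \<notin> {2, 3, 4, 5, 6}" using that by (auto simp: A_def)
    thus ?thesis unfolding i sa by (auto simp: transpose_def)
  qed
  have t_fix: "t x = x" if "x \<notin> B" for x
  proof -
    obtain i where i: "x = \<beta> i" using permutes_surj[OF perm(2)] by blast
    hence "i \<notin> {1, 6, 7}" using that by (auto simp: B_def)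
    thus ?thesis unfolding i tb by (auto simp: transpose_def)
  qed
  have s_move: "s x \<in> A" "s x \<noteq> x" if "x \<in> A" for x
    using that s_val inj(1) by (auto simp: A_def)
  have t_move: "t x \<in> B" "t x \<noteq> x" if "x \<in> B" for x
    using that t_val inj(2) by (auto simp: B_def)
  \<comment> \<open>The seven-cycle fixes none of these points, so one of the two factors must move
    each of them.\<close>
  have cover: "{1..7} \<subseteq> A \<union> B"
  proof
    fix x :: nat assume "x \<in> {1..7}"
    hence "x = 1 \<or> x = 2 \<or> x = 3 \<or> x = 4 \<or> x = 5 \<or> x = 6 \<or> x = 7" by auto
    hence "z x \<noteq> x" using z by auto
    thus "x \<in> A \<union> B" using ts[of x] s_fix[of x] t_fix[of x] by (metis UnCI)
  qed
  \<comment> \<open>A point beyond 7 is fixed by \<open>z\<close>, so a factor moving it must be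
    undone by the other one, and the point lies in both \<open>A\<close> and \<open>B\<close>. Then
    the union has at least 8 elements and the intersection at least 1, but these numbers add up to
    \<open>5 + 3\<close>.\<close>
  have AB: "A \<union> B \<subseteq> {1..7}"
  proof
    fix x assume x: "x \<in> A \<union> B"
    show "x \<in> {1..7}"
    proof (rule ccontr)
      assume out: "x \<notin> {1..7}"
      have tsx: "t (s x) = x" using ts z_out[OF out] by simp
      have xB: "x \<in> B"
      proof (rule ccontr)
        assume nB: "x \<notin> B"
        hence xA: "x \<in> A" using x by blast
        have "s x \<notin> B" using tsx t_move(1)[of "s x"] nB by auto
        hence "s x = x" using t_fix[of "s x"] tsx by simp
        thus False using s_move(2)[OF xA] by simp
      qed
      have xA: "x \<in> A"
      proof (rule ccontr)
        assume "x \<notin> A"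
        hence "t x = x" using s_fix tsx by simp
        thus False using t_move(2)[OF xB] by simp
      qed
      have fin: "finite A" "finite B" by (simp_all add: A_def B_def)
      have "card A = card {2, 3, 4, 5, 6 :: nat}" "card B = card {1, 6, 7 :: nat}"
        unfolding A_def B_def using perm[THEN permutes_inj_on] by (simp_all only: card_image)
      hence "card (A \<union> B) + card (A \<inter> B) = 8" using card_Un_Int[OF fin] by simp
      moreover have "card (A \<inter> B) \<ge> 1"
        using xA xB fin by (metis IntI Suc_leI card_gt_0_iff empty_iff finite_Int One_nat_def)
      moreover have "card (insert x {1..7}) \<le> card (A \<union> B)"
        using cover x fin by (intro card_mono) auto
      hence "8 \<le> card (A \<union> B)" using out by simp
      ultimately show False by simp
    qed
  qed
  have in7: "\<alpha> i \<in> {1..7}" if "i \<in> {2, 3, 4, 5, 6}" for i using AB that by (auto simp: A_def)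
  have in7': "\<beta> i \<in> {1..7}" if "i \<in> {1, 6, 7}" for i using AB that by (auto simp: B_def)
  have rest: "{1..7} - ?S = {1, 2, 4}" by auto
  have "\<alpha> i \<in> {1, 2, 4}" if "i \<in> {2, 4}" for i
  proof -
    have "\<alpha> i \<notin> ?S" using permutes_values_in(2)[OF perm(1) stab(1), of i] that n by auto
    thus ?thesis using in7[of i] that unfolding rest[symmetric] by blast
  qed
  hence a_blue: "\<alpha> 2 \<in> {1, 2, 4}" "\<alpha> 4 \<in> {1, 2, 4}" by simp_all
  have a_red: "\<alpha> 3 \<in> ?S" "\<alpha> 5 \<in> ?S" "\<alpha> 6 \<in> ?S" using stab(1) by blast+
  have "\<beta> 1 \<notin> ?S" using permutes_values_in(2)[OF perm(2) stab(2), of 1] n by auto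
  hence b_blue: "\<beta> 1 \<in> {1, 2, 4}" using in7'[of 1] unfolding rest[symmetric] by blast
  have b_red: "\<beta> 6 \<in> ?S" "\<beta> 7 \<in> ?S" "\<beta> 6 \<noteq> \<beta> 7" using stab(2) inj(2) by auto
  \<comment> \<open>The inverse of the three-cycle \<open>t\<close>; it expresses the five-cycle as
    \<open>s = t' \<circ> z\<close>, whose orbit the finite check follows.\<close>
  define t' where "t' = (\<lambda>x. if x = \<beta> 6 then \<beta> 1 else if x = \<beta> 7 then \<beta> 6 else if x = \<beta> 1 then \<beta> 7 else x)"
  have t': "t' (t x) = x" for x
  proof (cases "x \<in> B")
    case True
    thus ?thesis using t_val inj(2) by (auto simp: B_def t'_def)
  next
    case False
    thus ?thesis using t_fix[OF False] by (auto simp: B_def t'_def)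
  qed
  have st: "s x = t' (z x)" for x using t'[of "s x"] ts by simp
  have chain: "\<alpha> 3 = t' (z (\<alpha> 2))" "\<alpha> 4 = t' (z (\<alpha> 3))" "\<alpha> 5 = t' (z (\<alpha> 4))"
    "\<alpha> 6 = t' (z (\<alpha> 5))" "\<alpha> 2 = t' (z (\<alpha> 6))"
    unfolding st[symmetric] s_val by simp_all
  have t'': "t' = unrotate (\<beta> 1) (\<beta> 6) (\<beta> 7)" by (simp add: t'_def unrotate_def fun_eq_iff)
  have z': "z i = next7 i" if "i \<in> {1, 2, 4} \<union> ?S" for i using that z by (auto simp: next7_def)
  have chain': "unrotate (\<beta> 1) (\<beta> 6) (\<beta> 7) (next7 (\<alpha> 2)) = \<alpha> 3"
    "unrotate (\<beta> 1) (\<beta> 6) (\<beta> 7) (next7 (\<alpha> 3)) = \<alpha> 4"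
    "unrotate (\<beta> 1) (\<beta> 6) (\<beta> 7) (next7 (\<alpha> 4)) = \<alpha> 5"
    "unrotate (\<beta> 1) (\<beta> 6) (\<beta> 7) (next7 (\<alpha> 5)) = \<alpha> 6"
    "unrotate (\<beta> 1) (\<beta> 6) (\<beta> 7) (next7 (\<alpha> 6)) = \<alpha> 2"
    unfolding t''[symmetric] using chain z'[OF UnI1[OF a_blue(1)]] z'[OF UnI1[OF a_blue(2)]]
      z'[OF UnI2[OF a_red(1)]] z'[OF UnI2[OF a_red(2)]] z'[OF UnI2[OF a_red(3)]]
    by (simp_all only:)
  show False
    using no_necklace[rule_format, OF b_blue b_red a_blue(1) a_red(1) chain'(1) a_blue(2) chain'(2)
        a_red(2) chain'(3) a_red(3) chain'(4)] chain'(5) ..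
qed

section \<open>The Stembridge subgroup for n congruent to 2 modulo 4\<close>

lemma chi_eq_parity: "finite A \<Longrightarrow> chi A f = (if (\<Sum>i\<in>A. f i) = 0 then 1 else -1)"
proof (induction A rule: finite_induct)
  case empty
  thus ?case by (simp add: chi_def)
next
  case (insert x A)
  have "chi (insert x A) f = (if f x = 1 then -1 else 1) * chi A f"
    using insert.hyps unfolding chi_def by simp
  moreover have "(\<Sum>i\<in>insert x A. f i) = f x + (\<Sum>i\<in>A. f i)" using insert.hyps by simp
  ultimately show ?case
    unfolding insert.IH by (cases "f x"; cases "\<Sum>i\<in>A. f i") simp_all
qed

lemma permutation_of_permutes: "p permutes A \<Longrightarrow> finite A \<Longrightarrow> permutation p"
  unfolding permutation_permutes by blast

text \<open>Exchanges only the first \<open>k\<close> points with their partners in the second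
  block, so that the sign can be found by adding one transposition at a time; the full swap is
  \<open>k = m\<close>.\<close>

definition block_swap :: "nat \<Rightarrow> nat \<Rightarrow> nat \<Rightarrow> nat"
  where "block_swap m k x = (if 1 \<le> x \<and> x \<le> k then x + m else if m < x \<and> x \<le> m + k then x - m else x)"

lemma block_swap_Suc:
  assumes "Suc k \<le> m"
  shows "block_swap m (Suc k) = transpose (Suc k) (m + Suc k) \<circ> block_swap m k"
  using assms by (auto simp: block_swap_def transpose_def fun_eq_iff)

lemma block_swap_sign:
  "k \<le> m \<Longrightarrow> block_swap m k permutes {1..2 * m} \<and> sign (block_swap m k) = (-1) ^ k"
proof (induction k)
  case 0
  have "block_swap m 0 = id" by (auto simp: block_swap_def fun_eq_iff)
  thus ?case by (simp only: permutes_id sign_id power_0 simp_thms)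
next
  case (Suc k)
  hence IH: "block_swap m k permutes {1..2 * m}" "sign (block_swap m k) = (-1) ^ k" by simp_all
  have t: "transpose (Suc k) (m + Suc k) permutes {1..2 * m}"
    by (rule permutes_swap_id) (use Suc.prems in auto)
  have "permutation (block_swap m k)" "permutation (transpose (Suc k) (m + Suc k))"
    using IH(1) t by (auto intro: permutation_of_permutes)
  hence sgn: "sign (transpose (Suc k) (m + Suc k) \<circ> block_swap m k) = - ((-1) ^ k)"
    using Suc.prems by (simp add: sign_compose sign_swap_id IH(2))
  show ?case
    unfolding block_swap_Suc[OF Suc.prems] sgn by (intro conjI permutes_compose[OF IH(1) t]) simp
qed

section \<open>Two blocks of odd size \<open>m\<close>, a cycle on each, and the swap\<close>

locale two_odd_blocks =
  fixes m n :: nat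
  assumes m_odd: "odd m" and n_def: "n = 2 * m"
begin

definition s where "s = block_swap m m"
definition S where "S = {1..m}"
definition c where "c = cycle_of_list [1..<Suc m]"
definition u where "u = c \<circ> (s \<circ> inv' c \<circ> s)"

lemma m_pos: "m \<ge> 1" using m_odd by (cases m) auto

lemma s_permutes: "s permutes {1..n}" and s_sign: "sign s = -1"
  using block_swap_sign[of m m] m_odd by (simp_all add: s_def n_def)

lemma s_invol: "s (s x) = x"
  by (auto simp: s_def block_swap_def)

lemma s_inv: "inv' s = s"
  by (rule inv_unique_comp) (simp_all add: fun_eq_iff s_invol)

lemma s_S: "x \<in> S \<Longrightarrow> s x \<in> {1..n} - S" "x \<in> {1..n} - S \<Longrightarrow> s x \<in> S"
  by (auto simp: s_def block_swap_def S_def n_def)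

lemma s_image: "s ` S = {1..n} - S" "s ` ({1..n} - S) = S"
proof -
  show "s ` S = {1..n} - S"
    using s_S s_invol by (metis (no_types, lifting) image_eqI image_subsetI subsetI subset_antisym)
  show "s ` ({1..n} - S) = S"
    using s_S s_invol by (metis (no_types, lifting) image_eqI image_subsetI subsetI subset_antisym)
qed

lemma S_sub: "S \<subseteq> {1..n}"
  by (auto simp: S_def n_def)

lemma c_permutes: "c permutes S"
  using cycle_permutes[of "[1..<Suc m]"] by (simp add: c_def S_def atLeastLessThanSuc_atLeastAtMost del: upt_Suc)

lemma c_permutation: "permutation c"
  using c_permutes by (rule permutation_of_permutes) (simp add: S_def)

lemma c_pow: "c ^^ m = id"
  using cycle_is_id_root[of "[1..<Suc m]"] by (simp add: c_def del: upt_Suc)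

lemma c_transitive: "x \<in> S \<Longrightarrow> (c ^^ (x - 1)) 1 = x"
proof -
  assume x: "x \<in> S"
  have "map (c ^^ (x - 1)) [1..<Suc m] = rotate (x - 1) [1..<Suc m]"
    unfolding c_def by (rule cyclic_rotation) simp
  hence "map (c ^^ (x - 1)) [1..<Suc m] ! 0 = rotate (x - 1) [1..<Suc m] ! 0" by simp
  moreover have "(x - 1) mod m = x - 1" using x m_pos by (intro mod_less) (auto simp: S_def)
  ultimately show ?thesis using x m_pos by (simp add: S_def nth_rotate del: upt_Suc)
qed

lemma c_pow_permutation: "permutation (c ^^ k) \<and> sign (c ^^ k) = sign c ^ k"
proof (induction k)
  case 0
  show ?case by (simp only: funpow.simps permutation_id sign_id power_0 simp_thms)
next
  case (Suc k)
  show ?case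
    unfolding funpow.simps power_Suc sign_compose[OF c_permutation conjunct1[OF Suc]] conjunct2[OF Suc]
    by (intro conjI permutation_compose[OF c_permutation conjunct1[OF Suc]]) (rule refl)
qed

text \<open>The \<open>m\<close>-th power of \<open>c\<close> is trivial and \<open>m\<close> is
  odd.\<close>

lemma c_sign: "sign c = 1"
proof -
  have "sign c ^ m = 1" using c_pow_permutation[of m] unfolding c_pow sign_id by simp
  thus ?thesis using m_odd by (cases c rule: sign_cases) simp_all
qed

text \<open>A permutation commuting with a transitive cycle is determined by its value at one point,
  so it is a power of the cycle, which is even.\<close>

lemma commuting_with_c:
  assumes e: "e permutes S" and comm: "\<And>x. x \<in> S \<Longrightarrow> e (c x) = c (e x)"
  shows "sign e = 1"
proof -
  have one: "1 \<in> S" using m_pos by (simp add: S_def)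
  have cS: "c x \<in> S" if "x \<in> S" for x using c_permutes that by (simp add: permutes_in_image)
  have cSk: "(c ^^ k) x \<in> S" if "x \<in> S" for x k using that by (induction k) (auto intro: cS)
  have comm_pow: "e ((c ^^ k) x) = (c ^^ k) (e x)" if "x \<in> S" for x k
    using that by (induction k) (auto simp: comm cSk)
  have "e 1 \<in> S" using e one by (simp add: permutes_in_image)
  define k where "k = e 1 - 1"
  have e1: "e 1 = (c ^^ k) 1" unfolding k_def using c_transitive[OF \<open>e 1 \<in> S\<close>] by simp
  have "e x = (c ^^ k) x" for x
  proof (cases "x \<in> S")
    case True
    have "e x = e ((c ^^ (x - 1)) 1)" using c_transitive[OF True] by simp
    also have "\<dots> = (c ^^ (x - 1)) ((c ^^ k) 1)" using comm_pow[OF one] e1 by simp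
    also have "\<dots> = (c ^^ k) ((c ^^ (x - 1)) 1)"
      by (simp only: funpow_add[symmetric, THEN fun_cong, unfolded comp_apply] add.commute)
    finally show ?thesis using c_transitive[OF True] by simp
  next
    case False
    have "(c ^^ j) x = x" for j by (induction j) (simp_all add: permutes_not_in[OF c_permutes False])
    thus ?thesis using permutes_not_in[OF e False] by simp
  qed
  hence "e = c ^^ k" ..
  thus ?thesis using c_pow_permutation[of k] c_sign by simp
qed

lemma u_S: "x \<in> S \<Longrightarrow> u x = c x"
proof -
  assume x: "x \<in> S"
  hence "s x \<notin> S" using s_S(1) by blast
  hence "inv' c (s x) = s x" by (rule permutes_not_in[OF permutes_inv[OF c_permutes]])
  thus ?thesis by (simp add: u_def s_invol)
qed

lemma c_permutes_n: "c permutes {1..n}"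
  using c_permutes S_sub by (rule permutes_subset)

lemma u_permutes: "u permutes {1..n}"
  unfolding u_def by (intro permutes_compose permutes_inv s_permutes c_permutes_n)

lemma u_even: "u \<in> carrier (alt_group n)"
proof -
  have p: "permutation s" "permutation c" "permutation (inv' c)"
    using s_permutes c_permutation by (auto intro: permutation_of_permutes permutation_inverse)
  have "sign u = sign c * (sign s * sign (inv' c) * sign s)"
    unfolding u_def using p by (simp add: sign_compose permutation_compose)
  hence "sign u = 1" using p by (simp add: s_sign c_sign sign_inverse)
  thus ?thesis using u_permutes by (simp add: alt_group_carrier sign_def split: if_splits)
qed

lemma u_image: "u ` S = S"
proof -
  have "u ` S = c ` S" using u_S by (intro image_cong) auto
  thus ?thesis using permutes_image[OF c_permutes] by simp
qed

text \<open>The swap inverts \<open>u\<close>: in \<open>s u s u\<close> the factor \<open>c\<close>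
  of \<open>u\<close> first cancels against its inverse, and then the transported cycle
  does.\<close>

lemma s_u: "s (u (s (u x))) = x"
proof -
  define c' where "c' = s \<circ> c \<circ> s"
  define ci where "ci = s \<circ> inv' c \<circ> s"
  have c'ci: "c' (ci x) = x" "ci (c' x) = x" for x
    by (simp_all add: c'_def ci_def s_invol permutes_inverses[OF c_permutes])
  have "s (u (s y)) = c' (inv' c y)" for y by (simp add: u_def c'_def s_invol)
  hence "s (u (s (u x))) = c' (inv' c (c (ci x)))" by (simp add: u_def ci_def)
  also have "\<dots> = x" by (simp add: permutes_inverses[OF c_permutes] c'ci)
  finally show ?thesis .
qed

text \<open>On \<open>S\<close> the powers of \<open>u\<close> are those of \<open>c\<close>; on the
  complement, \<open>s\<close> turns them into powers of the inverse of \<open>u\<close> on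
  \<open>S\<close>.\<close>

lemma u_pow_m: "u ^^ m = id"
proof -
  have on_S: "(u ^^ k) x = (c ^^ k) x \<and> (u ^^ k) x \<in> S" if "x \<in> S" for k x
    using that by (induction k) (auto simp: u_S permutes_in_image[OF c_permutes])
  have s_u': "u (s y) = s (inv' u y)" for y
    using s_u[of "inv' u y"] s_invol permutes_inverses(1)[OF u_permutes] by metis
  have "(u ^^ m) x = x" for x
  proof -
    consider "x \<in> S" | "x \<in> {1..n} - S" | "x \<notin> {1..n}" by blast
    thus ?thesis
    proof cases
      case 1
      thus ?thesis using on_S[OF 1, of m] c_pow by simp
    next
      case 2
      define y where "y = s x"
      have y: "y \<in> S" "x = s y" using 2 s_S(2) s_invol by (simp_all add: y_def)
      have inv_pow: "(u ^^ k) (s z) = s ((inv' u ^^ k) z)" for k z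
        by (induction k) (simp_all add: s_u')
      have "(u ^^ m) y = y" using on_S[OF y(1), of m] c_pow by simp
      hence "(inv' u ^^ m) y = (inv' u ^^ m) ((u ^^ m) y)" by simp
      also have "(inv' u ^^ k) ((u ^^ k) z) = z" for k z
      proof (induction k arbitrary: z)
        case (Suc k)
        have "(inv' u ^^ Suc k) ((u ^^ Suc k) z) = (inv' u ^^ k) (inv' u (u ((u ^^ k) z)))"
          by (simp add: funpow_swap1)
        thus ?case using Suc permutes_inverses(2)[OF u_permutes] by simp
      qed simp
      finally show ?thesis using inv_pow y(2) by simp
    next
      case 3
      have "(u ^^ k) x = x" for k by (induction k) (simp_all add: permutes_not_in[OF u_permutes 3])
      thus ?thesis .
    qed
  qed
  thus ?thesis by (simp add: fun_eq_iff)
qed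

text \<open>Writing \<open>\<alpha> = s t\<close>, the permutation \<open>t\<close> preserves \<open>S\<close> and is a product of permutations \<open>p\<close> of \<open>S\<close> and \<open>q\<close>
  of its complement. The hypothesis says that \<open>p\<inverse> (s q s)\<close> commutes with the cycle \<open>c\<close>, so that it is
  even; hence \<open>t\<close> is even, whereas \<open>\<alpha> = s t\<close> is odd.\<close>

lemma swapping_conjugator_odd:
  assumes \<alpha>: "\<alpha> permutes {1..n}" "\<alpha> ` S = {1..n} - S"
    and inv: "\<And>x. s (\<alpha> (u (inv' \<alpha> (s (\<alpha> (u (inv' \<alpha> x))))))) = x"
  shows "sign \<alpha> = -1"
proof -
  define t where "t = s \<circ> \<alpha>"
  have t: "t permutes {1..n}" unfolding t_def using \<alpha>(1) s_permutes by (rule permutes_compose)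
  have tS: "t ` S = S" unfolding t_def image_comp[symmetric] \<alpha>(2) s_image ..
  have tSc: "t ` ({1..n} - S) = {1..n} - S"
    unfolding image_set_diff[OF permutes_inj[OF t]] permutes_image[OF t] tS ..
  define p where "p = restrict_id t S"
  define q where "q = restrict_id t ({1..n} - S)"
  define q' where "q' = s \<circ> q \<circ> s"
  have p: "p permutes S" unfolding p_def
    by (intro permutes_restrict_id bij_betw_imageI permutes_inj_on[OF t] tS)
  have q: "q permutes {1..n} - S" unfolding q_def
    by (intro permutes_restrict_id bij_betw_imageI permutes_inj_on[OF t] tSc)
  have tpq: "t = p \<circ> q"
  proof
    fix x
    consider "x \<in> S" | "x \<in> {1..n} - S" | "x \<notin> {1..n}" by blast
    thus "t x = (p \<circ> q) x"
    proof cases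
      case 2
      hence "t x \<notin> S" using tSc by blast
      thus ?thesis using 2 by (simp add: p_def q_def restrict_id_def)
    qed (use permutes_not_in[OF t] S_sub in \<open>auto simp: p_def q_def restrict_id_def\<close>)
  qed
  have q'S: "q' permutes S"
  proof (rule bij_imp_permutes)
    have "bij_betw s S ({1..n} - S)"
      by (intro bij_betw_imageI permutes_inj_on[OF s_permutes] s_image)
    moreover have "bij_betw q ({1..n} - S) ({1..n} - S)" using q by (rule permutes_imp_bij)
    moreover have "bij_betw s ({1..n} - S) S"
      by (intro bij_betw_imageI permutes_inj_on[OF s_permutes] s_image)
    ultimately show "bij_betw q' S S" unfolding q'_def by (metis bij_betw_trans comp_assoc)
    fix x assume "x \<notin> S"
    hence "s x \<notin> {1..n} - S" using s_S(2)[of "s x"] s_invol by metis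
    thus "q' x = x" using permutes_not_in[OF q] by (simp add: q'_def s_invol)
  qed
  \<comment> \<open>\<open>e\<close> compares the actions of \<open>t\<close> on the two blocks
    after identifying these by \<open>s\<close>.\<close>
  define e where "e = inv' p \<circ> q'"
  have e: "e permutes S" unfolding e_def using q'S permutes_inv[OF p] by (rule permutes_compose)
  have te: "t (e x) = s (t (s x))" if x: "x \<in> S" for x
  proof -
    have "e x \<in> S" using e x by (simp add: permutes_in_image)
    hence "t (e x) = p (e x)" by (simp add: p_def restrict_id_def)
    also have "\<dots> = s (q (s x))" by (simp add: e_def q'_def permutes_inverses[OF p])
    also have "q (s x) = t (s x)" using s_S(1)[OF x] by (simp add: q_def restrict_id_def)
    finally show ?thesis .
  qed
  have \<alpha>t: "\<alpha> x = s (t x)" for x by (simp add: t_def s_invol)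
  have inv\<alpha>: "inv' \<alpha> x = inv' t (s x)" for x
    using permutes_inverses[OF t] permutes_inverses[OF \<alpha>(1)] \<alpha>t by (metis s_invol)
  \<comment> \<open>The hypothesis in terms of \<open>t\<close>: the conjugate of \<open>u\<close>
    by \<open>t\<close> is also inverted by \<open>s\<close>.\<close>
  have rel: "t (u (inv' t (s (t (u (inv' t y)))))) = s y" for y
    using inv[of "s y"] unfolding \<alpha>t inv\<alpha> s_invol .
  have "e (c x) = c (e x)" if x: "x \<in> S" for x
  proof -
    have cx: "c x \<in> S" "e x \<in> S" "c (e x) \<in> S"
      using x c_permutes e by (simp_all add: permutes_in_image)
    have us: "u (s (u z)) = s z" for z using s_u[of z] s_invol by metis
    have "inv' t (s (t (s x))) = e x" using te[OF x] permutes_inverses(2)[OF t] by metis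
    have "t (c (e x)) = t (u (e x))" using u_S[OF cx(2)] by simp
    also have "\<dots> = s (t (s (c x)))"
    proof -
      define y where "y = t (s (c x))"
      have iy: "inv' t y = s (c x)" unfolding y_def by (rule permutes_inverses(2)[OF t])
      have "u (s (c x)) = s x" using us[of x] u_S[OF x] by simp
      hence "t (u (inv' t (s (t (s x))))) = s y" using rel[of y] unfolding iy by simp
      thus ?thesis using \<open>inv' t (s (t (s x))) = e x\<close> unfolding y_def by simp
    qed
    also have "\<dots> = t (e (c x))" using te[OF cx(1)] by simp
    finally show ?thesis using permutes_inj[OF t] by (simp add: inj_eq)
  qed
  from commuting_with_c[OF e this] have "sign e = 1" .
  have perms: "permutation p" "permutation q" "permutation q'" "permutation s" "permutation t" "permutation \<alpha>"
    using p q q'S s_permutes t \<alpha>(1)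
    by (auto intro!: permutation_of_permutes finite_subset[OF S_sub] simp del: atLeastAtMost_iff)
  have "sign q' = sign q" unfolding q'_def using perms by (simp add: sign_compose permutation_compose s_sign)
  moreover have "sign e = sign p * sign q'"
    unfolding e_def using perms by (simp add: sign_compose permutation_inverse sign_inverse)
  ultimately have "sign t = 1"
    using \<open>sign e = 1\<close> perms unfolding tpq by (simp add: sign_compose)
  moreover have "sign t = - sign \<alpha>" unfolding t_def using perms by (simp add: sign_compose s_sign)
  ultimately show ?thesis by simp
qed

section \<open>The weight of admissible pairs for the Stembridge subgroup\<close>

lemma chi_complement:
  assumes "q \<in> F_pow n" "parity n q = 0"
  shows "chi S q * chi ({1..n} - S) q = 1"
proof -
  have "chi S q * chi ({1..n} - S) q = chi (S \<union> ({1..n} - S)) q"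
    by (intro chi_union[symmetric] finite_subset[OF S_sub]) auto
  also have "S \<union> ({1..n} - S) = {1..n}" using S_sub by blast
  also have "chi {1..n} q = 1"
    unfolding chi_eq_parity[OF finite_atLeastAtMost] using assms(2) unfolding parity_def by (rule if_P)
  finally show ?thesis .
qed

text \<open>The sign part of the product consists of \<open>p\<close> twice, up to a permutation
  preserving \<open>S\<close>, which contributes a square; and of \<open>q\<close> twice, once moved
  to the other block by \<open>s\<close>, which contributes the character of all points, trivial on
  even vectors.\<close>

lemma stembridge_conjugates_chi:
  assumes a: "p \<in> F_pow n" "\<alpha> \<in> carrier (alt_group n)"
    and b: "q \<in> F_pow n" "\<beta> \<in> carrier (alt_group n)" "parity n q = 0"
    and \<alpha>S: "\<alpha> ` S = S"
    and eq: "(\<alpha> \<circ> u \<circ> inv' \<alpha>) \<circ> (\<beta> \<circ> s \<circ> inv' \<beta>) = s"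
  shows "chi S (fst (conj_hyp n (p, \<alpha>) (0, u) \<otimes>\<^bsub>hyperoctahedral n\<^esub> conj_hyp n (q, \<beta>) (0, s))) = 1"
proof -
  have perm: "\<alpha> permutes {1..n}" "\<beta> permutes {1..n}"
    using a(2) b(2) by (simp_all only: alt_group_carrier)
  define v where "v = \<alpha> \<circ> u \<circ> inv' \<alpha>"
  define w where "w = \<beta> \<circ> s \<circ> inv' \<beta>"
  have v: "v permutes {1..n}" and w: "w permutes {1..n}"
    unfolding v_def w_def by (intro permutes_compose permutes_inv perm u_permutes s_permutes)+
  have inv_image: "inv' \<pi> ` S = S" if "\<pi> permutes {1..n}" "\<pi> ` S = S" for \<pi>
    using image_inv_f_f[OF permutes_inj[OF that(1)], of S] that(2) by simp
  have "v ` S = \<alpha> ` u ` inv' \<alpha> ` S" unfolding v_def by (simp only: image_comp comp_assoc)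
  hence vS: "v ` S = S" unfolding inv_image[OF perm(1) \<alpha>S] u_image \<alpha>S .
  have vw: "inv' w \<circ> inv' v = s"
    using o_inv_distrib[OF permutes_bij[OF v] permutes_bij[OF w]] eq s_inv
    unfolding v_def[symmetric] w_def[symmetric] by simp
  have "fst (conj_hyp n (p, \<alpha>) (0, u) \<otimes>\<^bsub>hyperoctahedral n\<^esub> conj_hyp n (q, \<beta>) (0, s))
      = (p + (p \<circ> inv' v)) + ((q \<circ> inv' v) + (q \<circ> s))"
    unfolding conj_hyperoctahedral[OF a(1) perm(1) u_permutes] conj_hyperoctahedral[OF b(1) perm(2) s_permutes]
      v_def[symmetric] w_def[symmetric]
    by (simp only: mult_hyperoctahedral fst_conv zero_comp_fun add_0_right fun_add_comp comp_assoc vw)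
  moreover have "chi S (p \<circ> inv' v) = chi S p" "chi S (q \<circ> inv' v) = chi S q"
    unfolding chi_comp[OF permutes_inv[OF v]] inv_image[OF v vS] by (rule refl)+
  moreover have "chi S (q \<circ> s) = chi ({1..n} - S) q"
    unfolding chi_comp[OF s_permutes] s_image ..
  ultimately show ?thesis
    using chi_complement[OF b(1,3)] by (simp only: chi_add chi_square mult_1_left)
qed

theorem stembridge_not_strong_gelfand:
  "\<not> strong_gelfand_subgroup (stembridge_subgroup n) (hyperoctahedral n)"
proof
  let ?H = "hyperoctahedral n" and ?J = "stembridge_subgroup n"
  assume sg: "strong_gelfand_subgroup ?J ?H"
  have snd_mult: "snd (x \<otimes>\<^bsub>?H\<^esub> y) = snd x \<circ> snd y" for x y
    by (cases x; cases y) (simp add: mult_hyperoctahedral)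
  have snd_conj: "snd (conj_hyp n a (0, \<pi>)) = snd a \<circ> \<pi> \<circ> inv' (snd a)"
    if a: "a \<in> ?J" and \<pi>: "\<pi> permutes {1..n}" for a \<pi>
  proof -
    obtain p \<alpha> where p: "a = (p, \<alpha>)" by force
    hence "p \<in> F_pow n" "\<alpha> permutes {1..n}"
      using a unfolding p stembridge_subgroup_iff alt_group_carrier by blast+
    from conj_hyperoctahedral[OF this \<pi>] show ?thesis unfolding p by simp
  qed
  have x: "(0, u) \<in> carrier ?H" and y: "(0, s) \<in> carrier ?H"
    using F_pow_0 u_permutes s_permutes carrier_hyperoctahedral by blast+
  have par0: "parity n 0 = 0" by (simp add: parity_def)
  have u_pow: "u ^^ k \<in> carrier (alt_group n)" for k
  proof (induction k)
    case 0
    show ?case unfolding funpow.simps alt_group_carrier using permutes_id evenperm_id by blast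
  next
    case (Suc k)
    show ?case unfolding funpow.simps by (rule alt_group_comp[OF u_even Suc])
  qed
  \<comment> \<open>\<open>v\<close> is chosen with \<open>u v^2 = u^m = 1\<close>, which needs
    \<open>m\<close> odd. As \<open>s\<close> inverts \<open>u\<close>, conjugating \<open>s\<close>
    by \<open>v\<close> gives \<open>v^2 s\<close>, so \<open>u\<close> times this conjugate is
    \<open>s\<close>: an admissible pair.\<close>
  define j where "j = (m - 1) div 2"
  define v where "v = u ^^ j"
  have j: "Suc (j + j) = m" using m_odd m_pos unfolding j_def by presburger
  have v: "v \<in> carrier (alt_group n)" unfolding v_def by (rule u_pow)
  have vp: "v permutes {1..n}" using v by (simp only: alt_group_carrier)
  have id_J: "(0, id) \<in> ?J" and v_J: "(0, v) \<in> ?J"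
    using F_pow_0 par0 v u_pow[of 0] unfolding stembridge_subgroup_iff funpow.simps by blast+
  have su: "u (s (u z)) = s z" for z using s_u[of z] s_invol by metis
  have sv: "(u ^^ k) (s ((u ^^ k) z)) = s z" for k z
  proof (induction k arbitrary: z)
    case (Suc k)
    have "(u ^^ Suc k) (s ((u ^^ Suc k) z)) = (u ^^ k) (u (s (u ((u ^^ k) z))))"
      by (simp add: funpow_swap1)
    thus ?case using su Suc by simp
  qed simp
  have uvv: "u (v (v z)) = z" for z
  proof -
    have "u (v (v z)) = (u ^^ Suc (j + j)) z" unfolding v_def by (simp add: funpow_add)
    thus ?thesis unfolding j u_pow_m by simp
  qed
  have u_pow_S: "(u ^^ k) ` S = S" for k
  proof (induction k)
    case (Suc k)
    thus ?case using u_image by (simp only: funpow.simps image_comp[symmetric])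
  qed simp
  have "\<exists>a\<in>?J. \<exists>b\<in>?J. snd b ` S = S \<and> (snd (conj_hyp n b (0, s)) \<circ> snd a) ` S = S
    \<and> snd (conj_hyp n b (0, s) \<otimes>\<^bsub>?H\<^esub> conj_hyp n a (0, u)) = s"
  proof (rule strong_gelfand_stabiliser[OF sg x y S_sub one_neq_zero])
    fix a b assume ab: "a \<in> ?J" "b \<in> ?J" and aS: "snd a ` S = S"
      and bS: "(snd (conj_hyp n a (0, u)) \<circ> snd b) ` S = S"
      and prod: "snd (conj_hyp n a (0, u) \<otimes>\<^bsub>?H\<^esub> conj_hyp n b (0, s)) = s"
    obtain p \<alpha> q \<beta> where pq: "a = (p, \<alpha>)" "b = (q, \<beta>)" by force
    note J = ab[unfolded pq stembridge_subgroup_iff]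
    note c = snd_conj[OF ab(1) u_permutes] snd_conj[OF ab(2) s_permutes]
    have "snd (conj_hyp n a (0, u)) \<circ> snd (conj_hyp n b (0, s)) = s"
      using prod unfolding snd_mult[of "conj_hyp n a (0, u)" "conj_hyp n b (0, s)"] .
    note facts = aS bS[unfolded c] this[unfolded c]
    show "chi S (fst (conj_hyp n a (0, u) \<otimes>\<^bsub>?H\<^esub> conj_hyp n b (0, s))) = 1"
      unfolding pq
      by (rule stembridge_conjugates_chi) (use J facts in \<open>simp_all only: pq snd_conv\<close>)
  next
    show "(0, id) \<in> ?J" "(0, v) \<in> ?J" by fact+
    show "snd (0, id) ` S = S" by simp
    note c = snd_conj[OF id_J u_permutes] snd_conj[OF v_J s_permutes]
    show "(snd (conj_hyp n (0, id) (0, u)) \<circ> snd (0, v)) ` S = S"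
      unfolding c using u_pow_S[of "Suc j"]
      by (simp only: snd_conv funpow.simps v_def inv_id id_comp comp_id)
    have "u (v (s (inv' v z))) = s z" for z
    proof -
      have "u (v (v (s (v (inv' v z))))) = s (v (inv' v z))" by (rule uvv)
      moreover have "v (s (v (inv' v z))) = s (inv' v z)" unfolding v_def by (rule sv)
      ultimately show ?thesis unfolding permutes_inverses(1)[OF vp] by simp
    qed
    hence "u \<circ> (v \<circ> s \<circ> inv' v) = s" by (simp add: fun_eq_iff)
    thus "snd (conj_hyp n (0, id) (0, u) \<otimes>\<^bsub>?H\<^esub> conj_hyp n (0, v) (0, s)) = s"
      unfolding snd_mult[of "conj_hyp n (0, id) (0, u)" "conj_hyp n (0, v) (0, s)"] c
      by (simp only: snd_conv inv_id id_comp comp_id)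
  qed
  then obtain a b where ab: "a \<in> ?J" "b \<in> ?J" "snd b ` S = S"
    "(snd (conj_hyp n b (0, s)) \<circ> snd a) ` S = S"
    "snd (conj_hyp n b (0, s) \<otimes>\<^bsub>?H\<^esub> conj_hyp n a (0, u)) = s" by (elim bexE conjE)
  define \<alpha> where "\<alpha> = snd a"
  define \<beta> where "\<beta> = snd b"
  have alt: "\<alpha> \<in> carrier (alt_group n)" "\<beta> \<in> carrier (alt_group n)"
    using ab(1,2) stembridge_subgroup_iff unfolding \<alpha>_def \<beta>_def by (metis prod.collapse)+
  hence perm: "\<alpha> permutes {1..n}" "\<beta> permutes {1..n}" and even: "sign \<alpha> = 1"
    by (simp_all add: alt_group_carrier sign_def)
  define w where "w = \<beta> \<circ> s \<circ> inv' \<beta>"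
  have w: "w permutes {1..n}" unfolding w_def by (intro permutes_compose permutes_inv perm s_permutes)
  have w_invol: "w (w z) = z" for z
    by (simp add: w_def permutes_inverses[OF perm(2)] s_invol)
  note c = snd_conj[OF ab(1) u_permutes] snd_conj[OF ab(2) s_permutes]
  have waS: "(w \<circ> \<alpha>) ` S = S" and wu: "w \<circ> (\<alpha> \<circ> u \<circ> inv' \<alpha>) = s"
    using ab(4,5) unfolding snd_mult[of "conj_hyp n b (0, s)" "conj_hyp n a (0, u)"] c
    unfolding w_def \<alpha>_def \<beta>_def .
  \<comment> \<open>In the other order, the conjugate of \<open>u\<close> by \<open>\<alpha>\<close>
    is the product \<open>w s\<close> of two involutions, so \<open>s\<close> inverts it.\<close>
  have eq: "\<alpha> (u (inv' \<alpha> z)) = w (s z)" for z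
    using fun_cong[OF wu, of z] w_invol[of "\<alpha> (u (inv' \<alpha> z))"] by simp
  have bS: "\<beta> ` S = S" using ab(3) unfolding \<beta>_def .
  have inv_bS: "inv' \<beta> ` S = S"
    using image_inv_f_f[OF permutes_inj[OF perm(2)], of S] bS by simp
  have "w ` S = \<beta> ` s ` inv' \<beta> ` S" unfolding w_def by (simp only: image_comp comp_assoc)
  also have "\<dots> = \<beta> ` ({1..n} - S)" unfolding inv_bS s_image ..
  also have "\<dots> = {1..n} - S"
    unfolding image_set_diff[OF permutes_inj[OF perm(2)]] permutes_image[OF perm(2)] bS ..
  finally have wS: "w ` S = {1..n} - S" .
  \<comment> \<open>\<open>w\<close> is conjugate to \<open>s\<close> by a permutation preserving
    \<open>S\<close>, so it exchanges the blocks; as \<open>w \<circ> \<alpha>\<close> preserves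
    \<open>S\<close>, \<open>\<alpha>\<close> exchanges them too.\<close>
  have "\<alpha> ` S = w ` (w \<circ> \<alpha>) ` S" by (simp add: image_image w_invol)
  hence "\<alpha> ` S = {1..n} - S" unfolding waS wS .
  moreover have "s (\<alpha> (u (inv' \<alpha> (s (\<alpha> (u (inv' \<alpha> z))))))) = z" for z
    unfolding eq s_invol w_invol ..
  ultimately have "sign \<alpha> = -1" by (rule swapping_conjugator_odd[OF perm(1)])
  thus False using even by simp
qed

end

section \<open>Combination of the cases\<close>

lemma (in over_alternating) few_sign_changes_not_strong_gelfand:
  assumes "n \<ge> 4" "strong_gelfand_subgroup K (hyperoctahedral n)"
  shows "\<not> sign_changes K \<subseteq> diag_F n"
proof
  assume diag: "sign_changes K \<subseteq> diag_F n"
  have "\<exists>S \<sigma> \<tau>. no_factorisation n S \<sigma> \<tau>"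
  proof (cases "n \<ge> 7")
    case True
    thus ?thesis using no_factorisation_large by blast
  next
    case False
    hence "n = 4 \<or> n = 5 \<or> n = 6" using assms(1) by linarith
    thus ?thesis using no_factorisation_4 no_factorisation_5 no_factorisation_6 by blast
  qed
  then obtain S \<sigma> \<tau> where nf: "no_factorisation n S \<sigma> \<tau>" by blast
  hence "S \<subseteq> {1..n}" "even (card S)" "\<sigma> \<in> carrier (alt_group n)" "\<tau> \<in> carrier (alt_group n)"
    unfolding no_factorisation_def by blast+
  from stabiliser_factorisation[OF assms(2) diag this] nf show False
    unfolding no_factorisation_def by blast
qed

theorem proposition6p18:
  fixes n :: nat and K :: "((nat \<Rightarrow> bit) \<times> (nat \<Rightarrow> nat)) set"
  assumes "n \<ge> 3"
    and "strong_gelfand_subgroup K (hyperoctahedral n)"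
    and "snd ` K = carrier (alt_group n)"
  shows "K = wreath_alt n
    \<or> (K = stembridge_subgroup n \<and> (n \<ge> 4 \<longrightarrow> n mod 4 \<noteq> 2))
    \<or> (n = 3 \<and> (conjugate_in (hyperoctahedral n) (diag_alt 3) K
                \<or> conjugate_in (hyperoctahedral n) (alt_copy 3) K))"
proof -
  interpret over_alternating n K
    using assms unfolding over_alternating_def strong_gelfand_subgroup_def by blast
  consider "sign_changes K \<subseteq> diag_F n" | "K = wreath_alt n" | "K = stembridge_subgroup n"
    using trichotomy by blast
  thus ?thesis
  proof cases
    case 1
    hence "\<not> n \<ge> 4" using few_sign_changes_not_strong_gelfand[OF _ assms(2)] by blast
    hence "n = 3" using assms(1) by simp
    thus ?thesis using conjugate_of_diagonal[OF _ 1] by blast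
  next
    case 3
    have "n mod 4 \<noteq> 2"
    proof
      assume "n mod 4 = 2"
      hence "odd (n div 2)" "n = 2 * (n div 2)" by presburger+
      then interpret two_odd_blocks "n div 2" n by unfold_locales
      show False using stembridge_not_strong_gelfand assms(2) unfolding 3 by contradiction
    qed
    thus ?thesis using 3 by blast
  qed blast
qed

end
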